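(* Let $a\in\mathbb{R}$, $\mu_1,\mu_2\in\mathbb{R}$, $\sigma_1,\sigma_2>0$ and $q>0$. Let $X$ be the unique strong solution of $$\mathrm{d} X_t=(\mu_1 \mathbf{1}_{\{X_t \le a\}}+\mu_2 \mathbf{1}_{\{X_t> a\}})\,\mathrm{d} t+(\sigma_1\mathbf{1}_{\{X_t\le a\}}+\sigma_2\mathbf{1}_{\{X_t> a\}})\,\mathrm{d} B_t ,$$ and let $e_q$ be an exponential random variable with rate $q$ independent of $X$. Then for any starting point $x<a$, $$\mathbb{P}_{x}(X_{e_q}\in \mathrm{d} z)= \begin{cases} \dfrac{q e^{\delta_1^+ (z-a)}}{\sqrt{2q\sigma_1^2+\mu_1^2}}\left[e^{-\delta_1^+ (x-a)}+\dfrac{( \delta_1^+-\delta_2^+)e^{\delta_1^-(x-a)}}{\delta_1^-+\delta_2^+}\right]\mathrm{d}z, & z\le x< a,\\[2ex] \dfrac{q e^{\delta_1^-(x-a)}}{\sqrt{2q\sigma_1^2+\mu_1^2}}\left[e^{-\delta_1^- (z-a)}+\dfrac{(\delta_1^+ - \delta_2^+)e^{\delta_1^+(z-a)}}{\delta_1^-+\delta_2^+}\right]\mathrm{d}z, & x< z\le a,\\[2ex] \dfrac{q}{\sqrt{2q\sigma_2^2+\mu_2^2}}\,\dfrac{\delta_2^-+\delta_2^+}{\delta_1^-+\delta_2^+}\, e^{\delta_1^-(x-a)}e^{-\delta_2^-(z-a)}\,\mathrm{d}z, & z>a>x. \end{cases}$$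
   Context: $B$ is a standard one-dimensional Brownian motion on a complete filtered probability space satisfying the usual conditions; $\mathbb{P}_x$ denotes the law under which $X_0=x$. It is known that the stochastic differential equation has a unique strong solution. For $i=1,2$, $$\delta_i^{+}:=\frac{\sqrt{2q\sigma_i^2+\mu_i^2}+\mu_i}{\sigma_i^2},\qquad \delta_i^{-}:=\frac{\sqrt{2q\sigma_i^2+\mu_i^2}-\mu_i}{\sigma_i^2}.$$ An identity $\mathbb{P}_x(X_{e_q}\in\mathrm{d}z)=f(z)\,\mathrm{d}z$ on a set of $z$ means that the law of $X_{e_q}$ restricted to that set is absolutely continuous with density $f$. Since $e_q$ is independent of $X$, $\mathbb{P}_{x}(X_{e_q}\in \mathrm{d}z)=\int_0^\infty qe^{-qt}\,\mathbb{P}_x(X_t\in \mathrm{d}z)\,\mathrm{d} t$. *)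

theory Defs
  imports "HOL-Probability.Probability"
begin

text \<open>
  Time is \<open>[0, \<infinity>)\<close>, embedded in \<^typ>\<open>real\<close>: a filtration on \<open>[0, \<infinity>)\<close> is extended to negative
  indices in any monotone way (e.g. constantly), and nothing below looks at processes or
  filtrations at negative times.
\<close>

locale usual_filtered_prob_space =
  prob_space M + complete_measure M + filtration "space M" F
  for M :: "'a measure" and F :: "real \<Rightarrow> 'a measure" +
  assumes sub: "\<And>t. t \<ge> 0 \<Longrightarrow> subalgebra M (F t)"
    and null_sets_F: "\<And>t. t \<ge> 0 \<Longrightarrow> null_sets M \<subseteq> sets (F t)"
    and right_continuous_F: "\<And>t. t \<ge> 0 \<Longrightarrow> sets (F t) = (\<Inter>s\<in>{t<..}. sets (F s))"

definition adapted :: "(real \<Rightarrow> 'a measure) \<Rightarrow> (real \<Rightarrow> 'a \<Rightarrow> real) \<Rightarrow> bool" where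
  "adapted F X \<longleftrightarrow> (\<forall>t\<ge>0. X t \<in> borel_measurable (F t))"

definition progressive :: "(real \<Rightarrow> 'a measure) \<Rightarrow> (real \<Rightarrow> 'a \<Rightarrow> real) \<Rightarrow> bool" where
  "progressive F H \<longleftrightarrow>
     (\<forall>T\<ge>0. (\<lambda>(t, \<omega>). H t \<omega>) \<in> borel_measurable (restrict_space borel {0..T} \<Otimes>\<^sub>M F T))"

definition continuous_paths :: "'a measure \<Rightarrow> (real \<Rightarrow> 'a \<Rightarrow> real) \<Rightarrow> bool" where
  "continuous_paths M X \<longleftrightarrow> (AE \<omega> in M. continuous_on {0..} (\<lambda>t. X t \<omega>))"

definition brownian_motion ::
    "'a measure \<Rightarrow> (real \<Rightarrow> 'a measure) \<Rightarrow> (real \<Rightarrow> 'a \<Rightarrow> real) \<Rightarrow> bool" where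
  "brownian_motion M F B \<longleftrightarrow>
     adapted F B \<and> continuous_paths M B \<and> (AE \<omega> in M. B 0 \<omega> = 0) \<and>
     (\<forall>s t. 0 \<le> s \<and> s < t \<longrightarrow>
        distributed M lborel (\<lambda>\<omega>. B t \<omega> - B s \<omega>) (normal_density 0 (sqrt (t - s))) \<and>
        prob_space.indep_set M (sets (F s))
          (sets (vimage_algebra (space M) (\<lambda>\<omega>. B t \<omega> - B s \<omega>) borel)))"

text \<open>The filtration generated by \<open>B\<close>, augmented by the null sets of \<open>M\<close>.\<close>

definition augmented_filtration ::
    "'a measure \<Rightarrow> (real \<Rightarrow> 'a \<Rightarrow> real) \<Rightarrow> real \<Rightarrow> 'a measure" where
  "augmented_filtration M B t =
     sigma (space M) ({B s -` A \<inter> space M |s A. 0 \<le> s \<and> s \<le> t \<and> A \<in> sets borel} \<union> null_sets M)"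

text \<open>
  A simple process is given by a number \<open>k\<close> of steps, times \<open>0 \<le> \<tau> 0 \<le> \<dots> \<le> \<tau> k\<close> and bounded
  variables \<open>\<xi> i\<close>, the value on \<open>(\<tau> i, \<tau> (i + 1)]\<close>, measurable at time \<open>\<tau> i\<close>.
\<close>

definition simple_data ::
    "'a measure \<Rightarrow> (real \<Rightarrow> 'a measure) \<Rightarrow> nat \<Rightarrow> (nat \<Rightarrow> real) \<Rightarrow> (nat \<Rightarrow> 'a \<Rightarrow> real) \<Rightarrow> bool" where
  "simple_data M F k \<tau> \<xi> \<longleftrightarrow>
     0 \<le> \<tau> 0 \<and>
     (\<forall>i<k. \<tau> i \<le> \<tau> (Suc i) \<and> \<xi> i \<in> borel_measurable (F (\<tau> i)) \<and> bounded (\<xi> i ` space M))"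

definition simple_process ::
    "nat \<Rightarrow> (nat \<Rightarrow> real) \<Rightarrow> (nat \<Rightarrow> 'a \<Rightarrow> real) \<Rightarrow> real \<Rightarrow> 'a \<Rightarrow> real" where
  "simple_process k \<tau> \<xi> t \<omega> = (\<Sum>i<k. \<xi> i \<omega> * indicator {\<tau> i<..\<tau> (Suc i)} t)"

definition simple_integral ::
    "(real \<Rightarrow> 'a \<Rightarrow> real) \<Rightarrow> nat \<Rightarrow> (nat \<Rightarrow> real) \<Rightarrow> (nat \<Rightarrow> 'a \<Rightarrow> real) \<Rightarrow> real \<Rightarrow> 'a \<Rightarrow> real" where
  "simple_integral B k \<tau> \<xi> t \<omega> =
     (\<Sum>i<k. \<xi> i \<omega> * (B (min (\<tau> (Suc i)) t) \<omega> - B (min (\<tau> i) t) \<omega>))"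

text \<open>
  \<open>ito_integral M F B H I\<close>: the process \<open>I\<close> is (a continuous version of) \<open>t \<mapsto> \<integral>\<^sub>0\<^sup>t H\<^sub>s dB\<^sub>s\<close>, as the
  \<open>L\<^sup>2\<close> limit of integrals of simple processes. The approximation condition forces
  \<open>E \<integral>\<^sub>0\<^sup>T H\<^sub>t\<^sup>2 dt < \<infinity>\<close> for all \<open>T\<close>, so this is the square-integrable theory; it covers every
  bounded progressive integrand.
\<close>

definition ito_integral ::
    "'a measure \<Rightarrow> (real \<Rightarrow> 'a measure) \<Rightarrow> (real \<Rightarrow> 'a \<Rightarrow> real) \<Rightarrow>
     (real \<Rightarrow> 'a \<Rightarrow> real) \<Rightarrow> (real \<Rightarrow> 'a \<Rightarrow> real) \<Rightarrow> bool" where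
  "ito_integral M F B H I \<longleftrightarrow>
     progressive F H \<and> adapted F I \<and> continuous_paths M I \<and>
     (\<exists>k \<tau> \<xi>. (\<forall>n::nat. simple_data M F (k n) (\<tau> n) (\<xi> n)) \<and>
        (\<forall>T\<ge>0.
          (\<lambda>n. \<integral>\<^sup>+\<omega>. (\<integral>\<^sup>+t\<in>{0..T}.
             ennreal ((simple_process (k n) (\<tau> n) (\<xi> n) t \<omega> - H t \<omega>)\<^sup>2) \<partial>lborel) \<partial>M)
            \<longlonglongrightarrow> 0 \<and>
          (\<lambda>n. \<integral>\<^sup>+\<omega>. ennreal ((simple_integral B (k n) (\<tau> n) (\<xi> n) T \<omega> - I T \<omega>)\<^sup>2) \<partial>M)
            \<longlonglongrightarrow> 0))"

text \<open>
  \<open>strong_solution M F B b s x X\<close>: \<open>X\<close> is a strong solution of \<open>dX\<^sub>t = b(X\<^sub>t) dt + s(X\<^sub>t) dB\<^sub>t\<close>,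
  \<open>X\<^sub>0 = x\<close>, i.e. a solution that is adapted to the augmented filtration of the driving Brownian
  motion \<open>B\<close>.
\<close>

definition strong_solution ::
    "'a measure \<Rightarrow> (real \<Rightarrow> 'a measure) \<Rightarrow> (real \<Rightarrow> 'a \<Rightarrow> real) \<Rightarrow>
     (real \<Rightarrow> real) \<Rightarrow> (real \<Rightarrow> real) \<Rightarrow> real \<Rightarrow> (real \<Rightarrow> 'a \<Rightarrow> real) \<Rightarrow> bool" where
  "strong_solution M F B b s x X \<longleftrightarrow>
     adapted (augmented_filtration M B) X \<and> continuous_paths M X \<and>
     (AE \<omega> in M. X 0 \<omega> = x) \<and>
     (\<exists>I. ito_integral M F B (\<lambda>t \<omega>. s (X t \<omega>)) I \<and>
        (AE \<omega> in M. \<forall>t\<ge>0.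
           set_integrable lborel {0..t} (\<lambda>u. b (X u \<omega>)) \<and>
           X t \<omega> = x + (LINT u:{0..t}|lborel. b (X u \<omega>)) + I t \<omega>))"

definition indep_of_process ::
    "'a measure \<Rightarrow> ('a \<Rightarrow> real) \<Rightarrow> (real \<Rightarrow> 'a \<Rightarrow> real) \<Rightarrow> bool" where
  "indep_of_process M e X \<longleftrightarrow>
     prob_space.indep_set M
       (sets (vimage_algebra (space M) e borel))
       (sets (vimage_algebra (space M) (\<lambda>\<omega>. \<lambda>t\<in>{0..}. X t \<omega>) (Pi\<^sub>M {0..} (\<lambda>_. borel))))"

text \<open>
  \<open>has_density_on M Y S f\<close> renders \<open>P(Y \<in> dz) = f(z) dz\<close> on \<open>S\<close>. Nonnegativity of \<open>f\<close> is part
  of the claim, because \<^const>\<open>ennreal\<close> would cut off negative values.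
\<close>

definition has_density_on ::
    "'a measure \<Rightarrow> ('a \<Rightarrow> real) \<Rightarrow> real set \<Rightarrow> (real \<Rightarrow> real) \<Rightarrow> bool" where
  "has_density_on M Y S f \<longleftrightarrow>
     Y \<in> borel_measurable M \<and> (\<forall>z\<in>S. 0 \<le> f z) \<and>
     f \<in> borel_measurable (restrict_space borel S) \<and>
     restrict_space (distr M borel Y) S = density (restrict_space lborel S) (\<lambda>z. ennreal (f z))"

definition delta_plus :: "real \<Rightarrow> real \<Rightarrow> real \<Rightarrow> real" where
  "delta_plus q \<mu> \<sigma> = (sqrt (2 * q * \<sigma>\<^sup>2 + \<mu>\<^sup>2) + \<mu>) / \<sigma>\<^sup>2"

definition delta_minus :: "real \<Rightarrow> real \<Rightarrow> real \<Rightarrow> real" where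
  "delta_minus q \<mu> \<sigma> = (sqrt (2 * q * \<sigma>\<^sup>2 + \<mu>\<^sup>2) - \<mu>) / \<sigma>\<^sup>2"

end

(* The law of X at the exponential time e is identified through the resolvent equation
   E[(q g - L g)(X_e)] = q g(x), where L is the generator. For smooth g it follows from the Ito
   formula in expectation. If the stochastic integral is replaced by the integral of a simple
   process, that formula holds because a Taylor expansion gives it over a short interval up to an
   error of order dt^(3/2); the L^2 limit then needs no property of the Ito integral beyond its
   definition. Averaging g over short intervals extends the resolvent equation to functions that are
   C^1 with a kink of g' at a. Gluing exponentials at a such that q g - L g is a single exponential on
   one side of a and vanishes on the other one yields the Laplace transforms of the law restricted
   to either side of a, and these determine it. *)

theory Submission
  imports Defs
begin

text \<open>The coefficients jump at \<open>a\<close>, so \<open>q g - L g\<close> is in general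
  discontinuous there; the proof lives on functions for which it is nevertheless explicit. Two
  bounded solutions of \<open>q g = L g\<close> are at hand:
  \<open>exp (delta_minus q \<mu>1 \<sigma>1 * (y - a))\<close> below \<open>a\<close> and
  \<open>exp (- delta_plus q \<mu>2 \<sigma>2 * (y - a))\<close> above. Adding multiples of them to
  a further exponential \<open>exp (k * (y - a))\<close> on one side does not change
  \<open>q g - L g\<close>, and the two multiples are fixed by continuity of \<open>g\<close> and
  \<open>g'\<close> at \<open>a\<close>. The determinant of this linear system is \<open>delta_minus
  q \<mu>1 \<sigma>1 + delta_plus q \<mu>2 \<sigma>2\<close>, the denominator in all three
  densities. An exponent that is itself a root gives the trivial equation, so the exponents have to
  avoid it; even multiples of the root do. Such a sequence of equally spaced exponents is enough,
  because an exponential carries the half-line into [0, 1], where it becomes the sequence of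
  moments.\<close>

section \<open>Joint measurability of continuous processes\<close>

text \<open>The range is countable, so a process sampled along it is jointly measurable whatever its
  paths look like. \<open>Suc n\<close> avoids a division by zero at \<open>n = 0\<close>.\<close>

definition grid_floor :: "nat \<Rightarrow> real \<Rightarrow> real" where
  "grid_floor n t = of_int \<lfloor>real (Suc n) * t\<rfloor> / real (Suc n)"

lemma grid_floor_tendsto: "(\<lambda>n. grid_floor n t) \<longlonglongrightarrow> t"
proof (rule tendsto_sandwich[of "\<lambda>n. t - 1 / real (Suc n)" _ _ "\<lambda>n. t"])
  show "\<forall>\<^sub>F n in sequentially. t - 1 / real (Suc n) \<le> grid_floor n t"
  proof (rule always_eventually, rule allI)
    fix n
    have "real (Suc n) * t - 1 \<le> of_int \<lfloor>real (Suc n) * t\<rfloor>" by linarith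
    then have "(real (Suc n) * t - 1) / real (Suc n) \<le> grid_floor n t"
      unfolding grid_floor_def by (intro divide_right_mono) auto
    then show "t - 1 / real (Suc n) \<le> grid_floor n t" by (simp add: diff_divide_distrib)
  qed
  show "\<forall>\<^sub>F n in sequentially. grid_floor n t \<le> t"
  proof (rule always_eventually, rule allI)
    fix n
    have "of_int \<lfloor>real (Suc n) * t\<rfloor> \<le> real (Suc n) * t" by linarith
    then have "grid_floor n t \<le> (real (Suc n) * t) / real (Suc n)"
      unfolding grid_floor_def by (intro divide_right_mono) auto
    then show "grid_floor n t \<le> t" by simp
  qed
  have "(\<lambda>n. t - 1 / real (Suc n)) \<longlonglongrightarrow> t - 0"
    by (intro tendsto_diff tendsto_const LIMSEQ_Suc[OF lim_1_over_n])
  then show "(\<lambda>n. t - 1 / real (Suc n)) \<longlonglongrightarrow> t" by simp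
qed auto

text \<open>For each integer index the sample is a measurable function of the second component
  alone; the countably many pieces are selected by the measurable index
  \<open>\<lfloor>real (Suc n) * t\<rfloor>\<close>.\<close>

lemma measurable_grid_process:
  fixes Y :: "real \<Rightarrow> 'a \<Rightarrow> real"
  assumes "\<And>t. Y t \<in> borel_measurable M"
  shows "(\<lambda>(t, \<omega>). Y (grid_floor n t) \<omega>) \<in> borel_measurable (borel \<Otimes>\<^sub>M M)"
proof -
  have "(\<lambda>p. (\<lambda>i p. Y (of_int i / real (Suc n)) (snd p)) \<lfloor>real (Suc n) * fst p\<rfloor> p)
      \<in> borel_measurable (borel \<Otimes>\<^sub>M M)"
  proof (rule measurable_compose_countable[where f = "\<lambda>(i::int) p. Y (of_int i / real (Suc n)) (snd p)"])
    fix i :: int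
    show "(\<lambda>p. Y (of_int i / real (Suc n)) (snd p)) \<in> borel_measurable (borel \<Otimes>\<^sub>M M)"
      using measurable_compose[OF measurable_snd assms] .
  qed measurable
  then show ?thesis by (simp add: case_prod_beta grid_floor_def)
qed

text \<open>Continuity in time makes the process a pointwise limit of its samples at grid times.
  Continuity is asked of every path, which is why versions with that property are constructed
  later.\<close>

lemma measurable_continuous_process:
  fixes Y :: "real \<Rightarrow> 'a \<Rightarrow> real"
  assumes meas: "\<And>t. Y t \<in> borel_measurable M"
    and cont: "\<And>\<omega>. \<omega> \<in> space M \<Longrightarrow> continuous_on UNIV (\<lambda>t. Y t \<omega>)"
  shows "(\<lambda>(t, \<omega>). Y t \<omega>) \<in> borel_measurable (borel \<Otimes>\<^sub>M M)"
proof (rule borel_measurable_LIMSEQ_real)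
  show "(\<lambda>(t, \<omega>). Y (grid_floor n t) \<omega>) \<in> borel_measurable (borel \<Otimes>\<^sub>M M)" for n
    by (rule measurable_grid_process[OF meas])
  fix p :: "real \<times> 'a" assume "p \<in> space (borel \<Otimes>\<^sub>M M)"
  then have \<omega>: "snd p \<in> space M" by (auto simp: space_pair_measure)
  have "isCont (\<lambda>t. Y t (snd p)) (fst p)"
    using cont[OF \<omega>] by (simp add: continuous_on_eq_continuous_at)
  from isCont_tendsto_compose[OF this grid_floor_tendsto[of "fst p"]]
  show "(\<lambda>n. (\<lambda>(t, \<omega>). Y (grid_floor n t) \<omega>) p) \<longlonglongrightarrow> (\<lambda>(t, \<omega>). Y t \<omega>) p"
    by (simp add: case_prod_beta)
qed

section \<open>Test functions and their Taylor expansions\<close>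

text \<open>Lipschitz continuity of \<open>g''\<close> takes the place of a bounded third
  derivative, because it is all that the averages of a function with a kink in \<open>g'\<close>
  possess. One constant for all bounds keeps the error terms short.\<close>

definition test_function ::
    "real \<Rightarrow> (real \<Rightarrow> real) \<Rightarrow> (real \<Rightarrow> real) \<Rightarrow> (real \<Rightarrow> real) \<Rightarrow> bool" where
  "test_function C g g' g'' \<longleftrightarrow>
     (\<forall>y. (g has_real_derivative g' y) (at y)) \<and> (\<forall>y. (g' has_real_derivative g'' y) (at y)) \<and>
     (\<forall>y. \<bar>g y\<bar> \<le> C \<and> \<bar>g' y\<bar> \<le> C \<and> \<bar>g'' y\<bar> \<le> C) \<and> (\<forall>y z. \<bar>g'' y - g'' z\<bar> \<le> C * \<bar>y - z\<bar>)"

lemma lipschitz_if_bounded_derivative: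
  fixes f f' :: "real \<Rightarrow> real"
  assumes "\<And>y. (f has_real_derivative f' y) (at y)" and "\<And>y. \<bar>f' y\<bar> \<le> C"
  shows "\<bar>f y - f z\<bar> \<le> C * \<bar>y - z\<bar>"
  using field_differentiable_bound[of UNIV f f' C y z] assms by auto

context
  fixes C g g' g'' assumes tf: "test_function C g g' g''"
begin

lemma test_function_D:
  "(g has_real_derivative g' y) (at y)" "(g' has_real_derivative g'' y) (at y)"
  "\<bar>g y\<bar> \<le> C" "\<bar>g' y\<bar> \<le> C" "\<bar>g'' y\<bar> \<le> C" "\<bar>g'' y - g'' z\<bar> \<le> C * \<bar>y - z\<bar>"
  using tf unfolding test_function_def by auto

lemma test_function_nonneg: "0 \<le> C"
  using test_function_D(3)[of 0] by linarith

lemma test_function_lipschitz: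
  "\<bar>g y - g z\<bar> \<le> C * \<bar>y - z\<bar>" "\<bar>g' y - g' z\<bar> \<le> C * \<bar>y - z\<bar>"
  by (rule lipschitz_if_bounded_derivative, rule test_function_D, rule test_function_D)+

lemma test_function_continuous:
  "continuous_on UNIV g" "continuous_on UNIV g'" "continuous_on UNIV g''"
proof -
  show "continuous_on UNIV g" "continuous_on UNIV g'"
    by (rule DERIV_continuous_on, rule test_function_D)+
  have "C-lipschitz_on UNIV g''"
    using test_function_D(6) test_function_nonneg by (auto intro!: lipschitz_onI simp: dist_real_def)
  then show "continuous_on UNIV g''" by (rule lipschitz_on_continuous_on)
qed

lemma test_function_measurable:
  "g \<in> borel_measurable borel" "g' \<in> borel_measurable borel" "g'' \<in> borel_measurable borel"
  using test_function_continuous by (auto intro: borel_measurable_continuous_onI)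

text \<open>Mean value theorem with the Lipschitz bound on \<open>g'\<close>. Only the order in
  \<open>h\<close> matters, so here and below the sharp numerical constants are given up.\<close>

lemma test_function_taylor1: "\<bar>g (y + h) - g y - g' y * h\<bar> \<le> C * h\<^sup>2"
proof -
  have "\<exists>\<zeta>. \<bar>\<zeta> - y\<bar> \<le> \<bar>h\<bar> \<and> g (y + h) - g y = h * g' \<zeta>"
  proof (cases h "0::real" rule: linorder_cases)
    case less
    obtain z where "z > y + h" "z < y" "g y - g (y + h) = (y - (y + h)) * g' z"
      using MVT2[of "y + h" y g g'] less test_function_D(1) by auto
    then show ?thesis using less by (intro exI[of _ z]) (auto simp: algebra_simps)
  next
    case greater
    obtain z where "z > y" "z < y + h" "g (y + h) - g y = (y + h - y) * g' z"
      using MVT2[of y "y + h" g g'] greater test_function_D(1) by auto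
    then show ?thesis using greater by (intro exI[of _ z]) (auto simp: algebra_simps)
  qed (auto intro: exI[of _ y])
  then obtain \<zeta> where z: "\<bar>\<zeta> - y\<bar> \<le> \<bar>h\<bar>" "g (y + h) - g y = h * g' \<zeta>" by auto
  have "\<bar>g (y + h) - g y - g' y * h\<bar> = \<bar>h\<bar> * \<bar>g' \<zeta> - g' y\<bar>"
    unfolding z(2) by (simp add: algebra_simps flip: abs_mult)
  also have "\<dots> \<le> \<bar>h\<bar> * (C * \<bar>h\<bar>)"
    using test_function_lipschitz(2)[of \<zeta> y] z(1) test_function_nonneg
    by (intro mult_left_mono order_trans[OF test_function_lipschitz(2)]) auto
  finally show ?thesis by (simp add: power2_eq_square algebra_simps flip: abs_mult)
qed

text \<open>The Lagrange remainder contains \<open>g''\<close> at an intermediate point; moving it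
  to \<open>y\<close> costs \<open>C * \<bar>h\<bar>\<close> by the Lipschitz bound and makes the
  error cubic.\<close>

lemma test_function_taylor2: "\<bar>g (y + h) - g y - g' y * h - g'' y * h\<^sup>2 / 2\<bar> \<le> C * \<bar>h\<bar> ^ 3"
proof -
  define diff where "diff m = (if m = 0 then g else if m = 1 then g' else g'')" for m :: nat
  have D: "\<forall>m t. m < 2 \<and> a \<le> t \<and> t \<le> b \<longrightarrow> DERIV (diff m) t :> diff (Suc m) t" for a b
    using test_function_D(1,2) by (auto simp: diff_def less_2_cases_iff)
  have "\<exists>\<zeta>. \<bar>\<zeta> - y\<bar> \<le> \<bar>h\<bar> \<and> g (y + h) = g y + g' y * h + g'' \<zeta> * h\<^sup>2 / 2"
  proof (cases h "0::real" rule: linorder_cases)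
    case less
    with Taylor_down[of 2 diff g "y + h" y y, OF _ _ D] obtain t where
      "y + h < t" "t < y" "g (y + h) = (\<Sum>m<2. diff m y / fact m * (y + h - y) ^ m) + diff 2 t / fact 2 * (y + h - y)\<^sup>2"
      by (auto simp: diff_def)
    then show ?thesis
      using less by (intro exI[of _ t]) (auto simp: diff_def numeral_2_eq_2)
  next
    case greater
    with Taylor_up[of 2 diff g y "y + h" y, OF _ _ D] obtain t where
      "y < t" "t < y + h" "g (y + h) = (\<Sum>m<2. diff m y / fact m * (y + h - y) ^ m) + diff 2 t / fact 2 * (y + h - y)\<^sup>2"
      by (auto simp: diff_def)
    then show ?thesis
      using greater by (intro exI[of _ t]) (auto simp: diff_def numeral_2_eq_2)
  qed (auto intro: exI[of _ y])
  then obtain \<zeta> where z: "\<bar>\<zeta> - y\<bar> \<le> \<bar>h\<bar>" "g (y + h) = g y + g' y * h + g'' \<zeta> * h\<^sup>2 / 2" by auto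
  have "g (y + h) - g y - g' y * h - g'' y * h\<^sup>2 / 2 = (g'' \<zeta> - g'' y) * (h\<^sup>2 / 2)"
    unfolding z(2) by (simp add: field_simps)
  then have "\<bar>g (y + h) - g y - g' y * h - g'' y * h\<^sup>2 / 2\<bar> = \<bar>g'' \<zeta> - g'' y\<bar> * (h\<^sup>2 / 2)"
    by (simp only: abs_mult) simp
  also have "\<dots> \<le> (C * \<bar>h\<bar>) * h\<^sup>2"
    using z(1) test_function_nonneg
    by (intro mult_mono order_trans[OF test_function_D(6)]) (auto intro: mult_left_mono)
  finally show ?thesis by (simp add: power3_eq_cube power2_eq_square mult.assoc)
qed

text \<open>Here \<open>\<alpha>\<close> stands for the drift, of order dt, and \<open>w\<close> for
  the noise, of order dt^(1/2), so each error term is at most of order dt^(3/2). The noise is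
  expanded first; the drift then starts from \<open>u + w\<close>, and moving its slope back to
  \<open>u\<close> produces the mixed term.\<close>

lemma test_function_increment:
  "\<bar>g (u + \<alpha> + w) - g u - g' u * \<alpha> - g' u * w - g'' u * w\<^sup>2 / 2\<bar>
     \<le> C * (\<alpha>\<^sup>2 + \<bar>w\<bar> * \<bar>\<alpha>\<bar> + \<bar>w\<bar> ^ 3)"
proof -
  have "\<bar>g (u + w + \<alpha>) - g (u + w) - g' (u + w) * \<alpha>\<bar> \<le> C * \<alpha>\<^sup>2"
    by (rule test_function_taylor1)
  moreover have "\<bar>g (u + w) - g u - g' u * w - g'' u * w\<^sup>2 / 2\<bar> \<le> C * \<bar>w\<bar> ^ 3"
    by (rule test_function_taylor2)
  moreover have "\<bar>(g' (u + w) - g' u) * \<alpha>\<bar> \<le> (C * \<bar>w\<bar>) * \<bar>\<alpha>\<bar>"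
    using test_function_lipschitz(2)[of "u + w" u] unfolding abs_mult by (intro mult_right_mono) auto
  moreover have "g (u + \<alpha> + w) - g u - g' u * \<alpha> - g' u * w - g'' u * w\<^sup>2 / 2 =
    (g (u + w + \<alpha>) - g (u + w) - g' (u + w) * \<alpha>) + (g (u + w) - g u - g' u * w - g'' u * w\<^sup>2 / 2)
    + (g' (u + w) - g' u) * \<alpha>"
    by (simp add: algebra_simps)
  ultimately show ?thesis by (simp add: algebra_simps abs_le_iff)
qed

end

section \<open>Moments and independence of Gaussian increments\<close>

text \<open>The odd absolute moments carry a factor \<open>sqrt (2 / pi)\<close>, which is estimated
  by 1. The third moment is what turns the cubic Taylor error into \<Delta>^(3/2).\<close>

lemma (in prob_space) normal_increment_moments:
  assumes "distributed M lborel \<eta> (normal_density 0 (sqrt \<Delta>))" and "0 < \<Delta>"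
  shows "integrable M \<eta>" "expectation \<eta> = 0"
    and "integrable M (\<lambda>\<omega>. (\<eta> \<omega>)\<^sup>2)" "expectation (\<lambda>\<omega>. (\<eta> \<omega>)\<^sup>2) = \<Delta>"
    and "integrable M (\<lambda>\<omega>. \<bar>\<eta> \<omega>\<bar>)" "expectation (\<lambda>\<omega>. \<bar>\<eta> \<omega>\<bar>) \<le> sqrt \<Delta>"
    and "integrable M (\<lambda>\<omega>. \<bar>\<eta> \<omega>\<bar> ^ 3)" "expectation (\<lambda>\<omega>. \<bar>\<eta> \<omega>\<bar> ^ 3) \<le> 2 * (\<Delta> * sqrt \<Delta>)"
proof -
  have s: "sqrt \<Delta> > 0" using assms by simp
  have nn: "\<And>x. 0 \<le> normal_density 0 (sqrt \<Delta>) x" using s by (intro normal_density_nonneg)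
  have m2: "has_bochner_integral lborel (\<lambda>x. normal_density 0 (sqrt \<Delta>) x * (x - 0)^(2*1)) (fact (2*1) / ((2 / (sqrt \<Delta>)\<^sup>2)^1 * fact 1))"
    using normal_moment_even[OF s, of 0 1] by simp
  have m1: "has_bochner_integral lborel (\<lambda>x. normal_density 0 (sqrt \<Delta>) x * \<bar>x - 0\<bar>^(2*0+1)) (2^0 * (sqrt \<Delta>)^(2*0+1) * fact 0 * sqrt (2 / pi))"
    using normal_moment_abs_odd[OF s, of 0 0] by simp
  have cube: "sqrt \<Delta> ^ 3 = \<Delta> * sqrt \<Delta>" using assms(2) by (simp add: power3_eq_cube)
  have m3: "has_bochner_integral lborel (\<lambda>x. normal_density 0 (sqrt \<Delta>) x * \<bar>x\<bar> ^ 3)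
      (2 * (\<Delta> * sqrt \<Delta>) * sqrt (2 / pi))"
    using normal_moment_abs_odd[OF s, of 0 1] by (simp add: cube numeral_3_eq_3[symmetric])
  have pi: "sqrt (2 / pi) \<le> 1" using pi_ge_two by (simp add: real_sqrt_le_1_iff)
  show "integrable M (\<lambda>\<omega>. (\<eta> \<omega>)\<^sup>2)"
    using distributed_integrable[OF assms(1), of "\<lambda>x. x^2"] m2 nn by (auto simp: has_bochner_integral_iff)
  show "expectation (\<lambda>\<omega>. (\<eta> \<omega>)\<^sup>2) = \<Delta>"
    using distributed_integral[OF assms(1), of "\<lambda>x. x^2"] m2 nn assms(2) by (auto simp: has_bochner_integral_iff)
  show a: "integrable M (\<lambda>\<omega>. \<bar>\<eta> \<omega>\<bar>)"
    using distributed_integrable[OF assms(1), of "\<lambda>x. \<bar>x\<bar>"] m1 nn by (auto simp: has_bochner_integral_iff)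
  have \<eta>: "\<eta> \<in> borel_measurable M" using distributed_measurable[OF assms(1)] by simp
  show "integrable M \<eta>" using a \<eta> by (rule integrable_abs_cancel)
  show "expectation \<eta> = 0" using normal_distributed_expectation[OF s assms(1)] .
  have "expectation (\<lambda>\<omega>. \<bar>\<eta> \<omega>\<bar>) = sqrt \<Delta> * sqrt (2 / pi)"
    using distributed_integral[OF assms(1), of "\<lambda>x. \<bar>x\<bar>"] m1 nn by (auto simp: has_bochner_integral_iff)
  then show "expectation (\<lambda>\<omega>. \<bar>\<eta> \<omega>\<bar>) \<le> sqrt \<Delta>"
    using mult_left_mono[OF pi, of "sqrt \<Delta>"] s by simp
  show "integrable M (\<lambda>\<omega>. \<bar>\<eta> \<omega>\<bar> ^ 3)"
    using distributed_integrable[OF assms(1), of "\<lambda>x. \<bar>x\<bar>^3"] m3 nn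
    by (simp add: has_bochner_integral_iff)
  have "expectation (\<lambda>\<omega>. \<bar>\<eta> \<omega>\<bar> ^ 3) = 2 * (\<Delta> * sqrt \<Delta>) * sqrt (2 / pi)"
    using distributed_integral[OF assms(1), of "\<lambda>x. \<bar>x\<bar>^3"] m3 nn
    by (simp add: has_bochner_integral_iff)
  then show "expectation (\<lambda>\<omega>. \<bar>\<eta> \<omega>\<bar> ^ 3) \<le> 2 * (\<Delta> * sqrt \<Delta>)"
    using mult_left_mono[OF pi, of "2 * (\<Delta> * sqrt \<Delta>)"] s assms(2) by simp
qed

text \<open>The sigma-algebra generated by \<open>Y\<close> lies in \<open>sets G\<close>, and
  independence passes to smaller families. This converts the independence of \<open>F s\<close> in
  \<open>brownian_motion\<close> into one of random variables.\<close>

lemma (in prob_space) indep_var_if_indep_set: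
  assumes ind: "indep_set (sets G) (sets (vimage_algebra (space M) \<eta> borel))"
    and G: "subalgebra M G" and Y: "Y \<in> borel_measurable G" and \<eta>: "\<eta> \<in> borel_measurable M"
  shows "indep_var borel Y borel \<eta>"
proof -
  let ?A = "sigma_sets (space M) {Y -` A \<inter> space M |A. A \<in> sets borel}"
  let ?B = "sigma_sets (space M) {\<eta> -` A \<inter> space M |A. A \<in> sets borel}"
  have sp: "space G = space M" using G by (simp add: subalgebra_def)
  have "{Y -` A \<inter> space M |A. A \<in> sets borel} \<subseteq> sets G"
    using measurable_sets[OF Y] unfolding sp by blast
  then have A: "?A \<subseteq> sets G"
    using sets.sigma_sets_subset[of _ G] unfolding sp by blast
  have B: "?B = sets (vimage_algebra (space M) \<eta> borel)"
    by (simp add: sets_vimage_algebra)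
  have "indep_set ?A ?B"
    using ind A unfolding B indep_sets2_eq by (meson subset_eq)
  then show ?thesis
    unfolding indep_var_eq using \<eta> measurable_from_subalg[OF G Y] by simp
qed

section \<open>Ito formula over one interval\<close>

text \<open>A bounded function on a strip of finite product measure. The intervals are half-open so
  that consecutive ones join without overlap.\<close>

lemma (in prob_space) Fubini_bounded:
  fixes f :: "real \<Rightarrow> 'a \<Rightarrow> real"
  assumes f[measurable]: "(\<lambda>(u, \<omega>). f u \<omega>) \<in> borel_measurable (borel \<Otimes>\<^sub>M M)"
    and bnd: "\<And>u \<omega>. \<omega> \<in> space M \<Longrightarrow> \<bar>f u \<omega>\<bar> \<le> K"
  shows "set_integrable lborel {s<..t} (\<lambda>u. expectation (f u))"
    and "integrable M (\<lambda>\<omega>. LINT u:{s<..t}|lborel. f u \<omega>)"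
    and "expectation (\<lambda>\<omega>. LINT u:{s<..t}|lborel. f u \<omega>) = (LINT u:{s<..t}|lborel. expectation (f u))"
proof -
  interpret P: pair_sigma_finite lborel M ..
  have f'[measurable]: "(\<lambda>(u, \<omega>). f u \<omega>) \<in> borel_measurable (lborel \<Otimes>\<^sub>M M)"
    using f by (simp cong: measurable_cong_sets sets_pair_measure_cong)
  have I: "integrable (lborel \<Otimes>\<^sub>M M) (\<lambda>(u, \<omega>). indicator {s<..t} u * f u \<omega>)"
  proof (rule integrableI_bounded_set[where A = "{s<..t} \<times> space M" and B = K])
    show "emeasure (lborel \<Otimes>\<^sub>M M) ({s<..t} \<times> space M) < \<infinity>"
      by (cases "s \<le> t") (auto simp: emeasure_pair_measure_Times emeasure_space_1)
    show "AE p\<in>{s<..t} \<times> space M in lborel \<Otimes>\<^sub>M M. norm (case p of (u, \<omega>) \<Rightarrow> indicator {s<..t} u * f u \<omega>) \<le> K"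
      using bnd by (intro AE_I2) auto
    show "AE p in lborel \<Otimes>\<^sub>M M. p \<notin> {s<..t} \<times> space M \<longrightarrow> (case p of (u, \<omega>) \<Rightarrow> indicator {s<..t} u * f u \<omega>) = 0"
      by (intro AE_I2) (auto simp: space_pair_measure split: split_indicator_asm)
  qed measurable
  show "set_integrable lborel {s<..t} (\<lambda>u. expectation (f u))"
    using P.integrable_fst'[OF I] unfolding set_integrable_def by simp
  show "integrable M (\<lambda>\<omega>. LINT u:{s<..t}|lborel. f u \<omega>)"
    using P.integrable_snd[OF I] unfolding set_lebesgue_integral_def by simp
  show "expectation (\<lambda>\<omega>. LINT u:{s<..t}|lborel. f u \<omega>) = (LINT u:{s<..t}|lborel. expectation (f u))"
    using P.Fubini_integral[OF I] unfolding set_lebesgue_integral_def by simp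
qed

lemma half_square_le:
  fixes h K :: real
  assumes "\<bar>h\<bar> \<le> K" shows "\<bar>h\<^sup>2 / 2\<bar> \<le> K\<^sup>2"
proof -
  have "h\<^sup>2 \<le> K\<^sup>2" using power_mono[OF assms, of 2] by simp
  moreover have "0 \<le> h\<^sup>2" by simp
  ultimately show ?thesis by linarith
qed

text \<open>Used with \<open>L\<close> a bound on \<open>g'\<close> and \<open>g''\<close>, and
  again with \<open>L\<close> a Lipschitz bound on their increments; hence free variables
  \<open>y\<close>, \<open>z\<close> instead of a test function.\<close>

lemma generator_le:
  fixes b h y z K L :: real
  assumes "\<bar>b\<bar> \<le> K" "\<bar>h\<bar> \<le> K" "\<bar>y\<bar> \<le> L" "\<bar>z\<bar> \<le> L"
  shows "\<bar>b * y + h\<^sup>2 / 2 * z\<bar> \<le> (K + K\<^sup>2) * L"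
proof -
  have "0 \<le> L" "0 \<le> K" using assms by linarith+
  have "\<bar>b * y\<bar> \<le> K * L" unfolding abs_mult using assms \<open>0 \<le> K\<close> by (intro mult_mono) auto
  moreover have "\<bar>h\<^sup>2 / 2 * z\<bar> \<le> K\<^sup>2 * L"
    unfolding abs_mult[of _ z] using assms \<open>0 \<le> L\<close> by (intro mult_mono half_square_le) auto
  ultimately show ?thesis by (simp add: algebra_simps)
qed

lemma (in prob_space) integrable_bounded:
  fixes f :: "'a \<Rightarrow> real"
  assumes "f \<in> borel_measurable M" "\<And>\<omega>. \<omega> \<in> space M \<Longrightarrow> \<bar>f \<omega>\<bar> \<le> K"
  shows "integrable M f"
  using assms by (intro integrable_const_bound[where B = K]) auto

lemma (in prob_space) abs_expectation_le:
  fixes f :: "'a \<Rightarrow> real"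
  assumes "\<And>\<omega>. \<omega> \<in> space M \<Longrightarrow> \<bar>f \<omega>\<bar> \<le> K"
  shows "\<bar>expectation f\<bar> \<le> K"
proof (cases "integrable M f")
  case True
  have "\<bar>expectation f\<bar> \<le> expectation (\<lambda>\<omega>. \<bar>f \<omega>\<bar>)" by (rule integral_abs_bound)
  also have "\<dots> \<le> K" using True assms by (intro integral_le_const AE_I2) auto
  finally show ?thesis .
next
  \<comment> \<open>The integral of a non-integrable function is 0, and \<open>0 \<le> K\<close>
    follows from the bound at any point of the space.\<close>
  case False
  obtain \<omega> where "\<omega> \<in> space M" using not_empty by auto
  with assms[of \<omega>] False show ?thesis by (simp add: not_integrable_integral_eq)
qed

text \<open>Increments of order (t - s)^(3/2) force the derivative to vanish. This takes the place
  of summing the errors over finer and finer partitions.\<close>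

lemma constant_if_superlinear_modulus:
  fixes D :: "real \<Rightarrow> real"
  assumes D: "\<And>s t. c \<le> s \<Longrightarrow> s < t \<Longrightarrow> t \<le> d \<Longrightarrow> t - s \<le> 1 \<Longrightarrow> \<bar>D t - D s\<bar> \<le> L * ((t - s) * sqrt (t - s))"
    and "c \<le> d"
  shows "D d = D c"
proof -
  have "(D has_field_derivative 0) (at z within {c..d})" if z: "z \<in> {c..d}" for z
  proof -
    have "((\<lambda>y. (D y - D z) / (y - z)) \<longlongrightarrow> 0) (at z within {c..d})"
    proof (rule Lim_null_comparison)
      \<comment> \<open>The assumption covers ordered pairs at distance at most 1: the cases order
        the points, and the radius 1 of the neighbourhood supplies the rest.\<close>
      have "\<bar>D y - D z\<bar> \<le> L * (\<bar>y - z\<bar> * sqrt \<bar>y - z\<bar>)" if "y \<in> {c..d}" "y \<noteq> z" "dist y z < 1" for y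
        using D[of y z] D[of z y] that z by (cases "y < z") (auto simp: dist_real_def abs_minus_commute)
      then have "\<bar>(D y - D z) / (y - z)\<bar> \<le> L * sqrt \<bar>y - z\<bar>" if "y \<in> {c..d}" "y \<noteq> z" "dist y z < 1" for y
        using that by (simp add: divide_le_eq abs_divide mult_ac)
      then show "\<forall>\<^sub>F y in at z within {c..d}. norm ((D y - D z) / (y - z)) \<le> L * sqrt \<bar>y - z\<bar>"
        unfolding eventually_at by (intro exI[of _ 1]) auto
      have "((\<lambda>y. L * sqrt \<bar>y - z\<bar>) \<longlongrightarrow> L * sqrt \<bar>z - z\<bar>) (at z within {c..d})"
        by (intro tendsto_intros)
      then show "((\<lambda>y. L * sqrt \<bar>y - z\<bar>) \<longlongrightarrow> 0) (at z within {c..d})" by simp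
    qed
    then show ?thesis by (simp add: has_field_derivative_iff)
  qed
  from has_field_derivative_zero_constant[OF convex_closed_interval this]
  obtain k where "\<And>z. z \<in> {c..d} \<Longrightarrow> D z = k" by (auto simp: convex_real_interval)
  with \<open>c \<le> d\<close> show ?thesis by simp
qed

lemma set_integral_Ioc_bound:
  fixes f :: "real \<Rightarrow> real"
  assumes f: "set_integrable lborel {s<..t} f" and "\<And>u. u \<in> {s<..t} \<Longrightarrow> \<bar>f u\<bar> \<le> K" and "s \<le> t"
  shows "\<bar>LINT u:{s<..t}|lborel. f u\<bar> \<le> K * (t - s)"
proof -
  have "norm (LINT u:{s<..t}|lborel. f u) \<le> (\<integral>u. indicator {s<..t} u * K \<partial>lborel)"
    unfolding set_lebesgue_integral_def
  proof (rule Bochner_Integration.integral_norm_bound_integral)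
    show "integrable lborel (\<lambda>u. indicator {s<..t} u * K)"
      using assms(3) by (intro integrable_mult_left integrable_real_indicator) auto
  qed (use assms in \<open>auto simp: set_integrable_def indicator_def\<close>)
  then show ?thesis using assms by (simp add: mult.commute)
qed

lemma set_integrable_bounded_Ioc:
  fixes f :: "real \<Rightarrow> real"
  assumes "f \<in> borel_measurable borel" "\<And>u. \<bar>f u\<bar> \<le> K"
  shows "set_integrable lborel {s<..t} f"
  unfolding set_integrable_def using assms
  by (intro integrableI_bounded_set_indicator[where B = K]) (cases "s \<le> t"; auto)+

text \<open>\<open>Y\<close> is known at time \<open>s\<close>, hence independent of the increment,
  and the expectations factor into moments of \<open>Y\<close> and of the increment. The bound on
  \<open>Y\<close> gives its integrability.\<close>

lemma (in usual_filtered_prob_space) brownian_increment: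
  assumes bm: "brownian_motion M F B" and st: "0 \<le> s" "s < t"
    and Y: "Y \<in> borel_measurable (F s)" and K: "\<And>\<omega>. \<omega> \<in> space M \<Longrightarrow> \<bar>Y \<omega>\<bar> \<le> K"
  shows "integrable M (\<lambda>\<omega>. Y \<omega> * (B t \<omega> - B s \<omega>))" "expectation (\<lambda>\<omega>. Y \<omega> * (B t \<omega> - B s \<omega>)) = 0"
    and "integrable M (\<lambda>\<omega>. Y \<omega> * (B t \<omega> - B s \<omega>)\<^sup>2)"
      "expectation (\<lambda>\<omega>. Y \<omega> * (B t \<omega> - B s \<omega>)\<^sup>2) = expectation Y * (t - s)"
proof -
  let ?\<eta> = "\<lambda>\<omega>. B t \<omega> - B s \<omega>"
  have d: "distributed M lborel ?\<eta> (normal_density 0 (sqrt (t - s)))"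
    and ind: "indep_set (sets (F s)) (sets (vimage_algebra (space M) ?\<eta> borel))"
    using bm st unfolding brownian_motion_def by auto
  have \<eta>: "?\<eta> \<in> borel_measurable M" using distributed_measurable[OF d] by simp
  have iv: "indep_var borel Y borel ?\<eta>"
    by (rule indep_var_if_indep_set[OF ind sub Y \<eta>]) fact
  then have iv2: "indep_var borel ((\<lambda>y. y) \<circ> Y) borel ((\<lambda>y. y\<^sup>2) \<circ> ?\<eta>)"
    by (rule indep_var_compose) auto
  have iY: "integrable M Y"
    using measurable_from_subalg[OF sub[OF st(1)] Y] K by (rule integrable_bounded)
  have "0 < t - s" using st by simp
  note m = normal_increment_moments[OF d this]
  show "integrable M (\<lambda>\<omega>. Y \<omega> * ?\<eta> \<omega>)"
    by (rule indep_var_integrable[OF iv iY m(1)])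
  show "expectation (\<lambda>\<omega>. Y \<omega> * ?\<eta> \<omega>) = 0"
    using indep_var_lebesgue_integral[OF iv iY m(1)] m(2) by simp
  show "integrable M (\<lambda>\<omega>. Y \<omega> * (?\<eta> \<omega>)\<^sup>2)"
    using indep_var_integrable[OF iv2] iY m(3) by (simp add: o_def)
  show "expectation (\<lambda>\<omega>. Y \<omega> * (?\<eta> \<omega>)\<^sup>2) = expectation Y * (t - s)"
    using indep_var_lebesgue_integral[OF iv2] iY m(3,4) by (simp add: o_def)
qed

context usual_filtered_prob_space
begin

lemma measurable_F_mono:
  assumes "0 \<le> s" "s \<le> t" "f \<in> borel_measurable (F s)"
  shows "f \<in> borel_measurable (F t)"
  using assms sets_F_mono[of s t] sub[of s] sub[of t] unfolding subalgebra_def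
  by (auto intro: measurable_mono[THEN subsetD, OF order_refl])

context
  fixes B :: "real \<Rightarrow> 'a \<Rightarrow> real" and C K c d :: real and g g' g'' :: "real \<Rightarrow> real"
    and U \<beta> :: "real \<Rightarrow> 'a \<Rightarrow> real" and \<xi> :: "'a \<Rightarrow> real"
  assumes bm: "brownian_motion M F B" and tf: "test_function C g g' g''"
    and cd: "0 \<le> c" "c \<le> d" and K: "1 \<le> K"
    and U[measurable]: "(\<lambda>(u, \<omega>). U u \<omega>) \<in> borel_measurable (borel \<Otimes>\<^sub>M M)"
    and \<beta>[measurable]: "(\<lambda>(u, \<omega>). \<beta> u \<omega>) \<in> borel_measurable (borel \<Otimes>\<^sub>M M)"
    and \<beta>_le: "\<And>u \<omega>. \<omega> \<in> space M \<Longrightarrow> \<bar>\<beta> u \<omega>\<bar> \<le> K"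
    and \<xi>: "\<xi> \<in> borel_measurable (F c)" and \<xi>_le: "\<And>\<omega>. \<omega> \<in> space M \<Longrightarrow> \<bar>\<xi> \<omega>\<bar> \<le> K"
    and adapted: "\<And>t. c \<le> t \<Longrightarrow> t \<le> d \<Longrightarrow> U t \<in> borel_measurable (F t)"
    and increment: "\<And>s t. c \<le> s \<Longrightarrow> s < t \<Longrightarrow> t \<le> d \<Longrightarrow>
      AE \<omega> in M. U t \<omega> = U s \<omega> + (LINT u:{s<..t}|lborel. \<beta> u \<omega>) + \<xi> \<omega> * (B t \<omega> - B s \<omega>)"
begin

lemma \<beta>_path[measurable]: "\<omega> \<in> space M \<Longrightarrow> (\<lambda>u. \<beta> u \<omega>) \<in> borel_measurable borel"
  using measurable_Pair1[OF \<beta>, of \<omega>] by simp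

lemma drift_increment_le:
  assumes "\<omega> \<in> space M" "s \<le> t" shows "\<bar>LINT u:{s<..t}|lborel. \<beta> u \<omega>\<bar> \<le> K * (t - s)"
  using set_integral_Ioc_bound[OF set_integrable_bounded_Ioc[OF \<beta>_path[OF assms(1)] \<beta>_le[OF assms(1)]]]
    \<beta>_le[OF assms(1)] assms(2) by simp

lemma measurable_U[measurable]: "U t \<in> borel_measurable M"
  using measurable_Pair2[OF U, of t] by simp

lemma measurable_\<xi>[measurable]: "\<xi> \<in> borel_measurable M"
  by (rule measurable_from_subalg[OF sub[OF cd(1)] \<xi>])

lemma measurable_test[measurable]:
  "g \<in> borel_measurable borel" "g' \<in> borel_measurable borel" "g'' \<in> borel_measurable borel"
  using test_function_measurable[OF tf] .

lemma brownian_increment_moments: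
  assumes "c \<le> s" "s < t"
  shows "integrable M (\<lambda>\<omega>. \<bar>B t \<omega> - B s \<omega>\<bar>)" "expectation (\<lambda>\<omega>. \<bar>B t \<omega> - B s \<omega>\<bar>) \<le> sqrt (t - s)"
    and "integrable M (\<lambda>\<omega>. \<bar>B t \<omega> - B s \<omega>\<bar> ^ 3)"
      "expectation (\<lambda>\<omega>. \<bar>B t \<omega> - B s \<omega>\<bar> ^ 3) \<le> 2 * ((t - s) * sqrt (t - s))"
  using normal_increment_moments(5-8)[of "\<lambda>\<omega>. B t \<omega> - B s \<omega>" "t - s"] bm cd assms
  unfolding brownian_motion_def by auto

lemma integrable_step_terms:
  assumes "s \<le> t"
  shows "integrable M (\<lambda>\<omega>. g' (U s \<omega>) * (LINT u:{s<..t}|lborel. \<beta> u \<omega>))"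
    and "integrable M (\<lambda>\<omega>. (\<xi> \<omega>)\<^sup>2 * g'' (U s \<omega>))"
proof -
  let ?\<alpha> = "\<lambda>\<omega>. LINT u:{s<..t}|lborel. \<beta> u \<omega>"
  have C0: "0 \<le> C" by (rule test_function_nonneg[OF tf])
  have [measurable]: "?\<alpha> \<in> borel_measurable M"
    using Fubini_bounded(2)[OF \<beta> \<beta>_le] by (rule borel_measurable_integrable)
  show "integrable M (\<lambda>\<omega>. g' (U s \<omega>) * ?\<alpha> \<omega>)"
  proof (rule integrable_bounded[where K = "C * (K * (t - s))"])
    fix \<omega> assume "\<omega> \<in> space M"
    then show "\<bar>g' (U s \<omega>) * ?\<alpha> \<omega>\<bar> \<le> C * (K * (t - s))"
      unfolding abs_mult using test_function_D(4)[OF tf] drift_increment_le assms C0 by (intro mult_mono) auto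
  qed measurable
  show "integrable M (\<lambda>\<omega>. (\<xi> \<omega>)\<^sup>2 * g'' (U s \<omega>))"
  proof (rule integrable_bounded[where K = "K\<^sup>2 * C"])
    fix \<omega> assume "\<omega> \<in> space M"
    then show "\<bar>(\<xi> \<omega>)\<^sup>2 * g'' (U s \<omega>)\<bar> \<le> K\<^sup>2 * C"
      unfolding abs_mult power_abs using test_function_D(5)[OF tf] \<xi>_le C0 by (intro mult_mono power_mono) auto
  qed measurable
qed

text \<open>The drift moves \<open>U\<close> by order t - s and the noise by order (t - s)^(1/2);
  for \<open>t - s \<le> 1\<close> the second dominates. This modulus is what later allows
  derivatives to be frozen at the left endpoint.\<close>

lemma ito_step_L1:
  assumes "c \<le> s" "s \<le> t" "t \<le> d" "t - s \<le> 1"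
  shows "integrable M (\<lambda>\<omega>. \<bar>U t \<omega> - U s \<omega>\<bar>)"
    and "expectation (\<lambda>\<omega>. \<bar>U t \<omega> - U s \<omega>\<bar>) \<le> 2 * K * sqrt (t - s)"
proof -
  have "integrable M (\<lambda>\<omega>. \<bar>U t \<omega> - U s \<omega>\<bar>) \<and>
    expectation (\<lambda>\<omega>. \<bar>U t \<omega> - U s \<omega>\<bar>) \<le> 2 * K * sqrt (t - s)"
  proof (cases "s = t")
    case False
    then have st: "s < t" using assms by simp
    let ?\<eta> = "\<lambda>\<omega>. \<bar>B t \<omega> - B s \<omega>\<bar>"
    have i: "integrable M (\<lambda>\<omega>. K * (t - s) + K * ?\<eta> \<omega>)"
      using brownian_increment_moments(1)[OF assms(1) st] by simp
    have ae: "AE \<omega> in M. \<bar>U t \<omega> - U s \<omega>\<bar> \<le> K * (t - s) + K * ?\<eta> \<omega>"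
      using increment[OF assms(1) st assms(3)]
    proof (rule AE_mp, intro AE_I2 impI)
      fix \<omega> assume \<omega>: "\<omega> \<in> space M"
        and eq: "U t \<omega> = U s \<omega> + (LINT u:{s<..t}|lborel. \<beta> u \<omega>) + \<xi> \<omega> * (B t \<omega> - B s \<omega>)"
      have "\<bar>\<xi> \<omega> * (B t \<omega> - B s \<omega>)\<bar> \<le> K * ?\<eta> \<omega>"
        unfolding abs_mult using \<xi>_le[OF \<omega>] by (intro mult_right_mono) auto
      then show "\<bar>U t \<omega> - U s \<omega>\<bar> \<le> K * (t - s) + K * ?\<eta> \<omega>"
        using drift_increment_le[OF \<omega> assms(2)] unfolding eq by linarith
    qed
    have int: "integrable M (\<lambda>\<omega>. \<bar>U t \<omega> - U s \<omega>\<bar>)"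
      by (rule Bochner_Integration.integrable_bound[OF i]) (use ae in auto)
    have "expectation (\<lambda>\<omega>. \<bar>U t \<omega> - U s \<omega>\<bar>) \<le> expectation (\<lambda>\<omega>. K * (t - s) + K * ?\<eta> \<omega>)"
      by (rule integral_mono_AE[OF int i ae])
    also have "\<dots> = K * (t - s) + K * expectation ?\<eta>"
      using brownian_increment_moments(1)[OF assms(1) st] by (simp add: prob_space)
    also have "\<dots> \<le> K * sqrt (t - s) + K * sqrt (t - s)"
    proof (intro add_mono mult_left_mono)
      show "t - s \<le> sqrt (t - s)"
        using assms(2,4) by (intro real_le_rsqrt) (simp add: power2_eq_square mult_le_one mult_left_le)
    qed (use K brownian_increment_moments(2)[OF assms(1) st] in auto)
    finally show ?thesis using int by simp
  qed simp
  then show "integrable M (\<lambda>\<omega>. \<bar>U t \<omega> - U s \<omega>\<bar>)"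
    "expectation (\<lambda>\<omega>. \<bar>U t \<omega> - U s \<omega>\<bar>) \<le> 2 * K * sqrt (t - s)" by auto
qed

text \<open>Derivatives are frozen at time \<open>s\<close>. In expectation the term linear in the
  Brownian increment vanishes and its square becomes \<open>t - s\<close>, since
  \<open>\<xi>\<close> and \<open>U s\<close> are known at \<open>s\<close>. The drift integral
  stays inside the expectation because it may depend on the increment.\<close>

lemma ito_step_taylor:
  assumes st: "c \<le> s" "s < t" "t \<le> d" "t - s \<le> 1"
  shows "\<bar>expectation (\<lambda>\<omega>. g (U t \<omega>)) - expectation (\<lambda>\<omega>. g (U s \<omega>))
     - expectation (\<lambda>\<omega>. g' (U s \<omega>) * (LINT u:{s<..t}|lborel. \<beta> u \<omega>))
     - (t - s) / 2 * expectation (\<lambda>\<omega>. (\<xi> \<omega>)\<^sup>2 * g'' (U s \<omega>))\<bar> \<le> 4 * C * K ^ 3 * ((t - s) * sqrt (t - s))"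
proof -
  let ?\<eta> = "\<lambda>\<omega>. B t \<omega> - B s \<omega>" and ?\<alpha> = "\<lambda>\<omega>. LINT u:{s<..t}|lborel. \<beta> u \<omega>"
  let ?\<Delta> = "t - s" and ?r = "(t - s) * sqrt (t - s)"
  have C0: "0 \<le> C" by (rule test_function_nonneg[OF tf])
  have s0: "0 \<le> s" using st cd by simp
  have \<Delta>: "0 < ?\<Delta>" "?\<Delta> \<le> sqrt ?\<Delta>" "0 \<le> ?r"
    using st by (auto intro!: real_le_rsqrt simp: power2_eq_square mult_left_le)
  note tfD = test_function_D[OF tf]
  have Us: "U s \<in> borel_measurable (F s)" using adapted[of s] st by simp
  have \<xi>s[measurable]: "\<xi> \<in> borel_measurable (F s)" by (rule measurable_F_mono[OF cd(1) st(1) \<xi>])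
  have b1: "\<bar>g' (U s \<omega>) * \<xi> \<omega>\<bar> \<le> C * K" if "\<omega> \<in> space M" for \<omega>
    unfolding abs_mult using tfD(4) \<xi>_le[OF that] C0 by (intro mult_mono) auto
  have b2: "\<bar>(\<xi> \<omega>)\<^sup>2 * g'' (U s \<omega>)\<bar> \<le> K\<^sup>2 * C" if "\<omega> \<in> space M" for \<omega>
    unfolding abs_mult power_abs using tfD(5) \<xi>_le[OF that] C0 by (intro mult_mono power_mono) auto
  have m1: "(\<lambda>\<omega>. g' (U s \<omega>) * \<xi> \<omega>) \<in> borel_measurable (F s)"
    "(\<lambda>\<omega>. (\<xi> \<omega>)\<^sup>2 * g'' (U s \<omega>)) \<in> borel_measurable (F s)"
    using Us by measurable
  note i1 = brownian_increment(1,2)[OF bm s0 st(2) m1(1) b1]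
  note i2 = brownian_increment(3,4)[OF bm s0 st(2) m1(2) b2]
  have ig: "integrable M (\<lambda>\<omega>. g (U u \<omega>))" for u
    using tfD(3) by (intro integrable_bounded[where K = C]) auto
  note i\<alpha> = integrable_step_terms(1)[OF less_imp_le[OF st(2)]]
  \<comment> \<open>The remainder keeps the random terms in the increment of \<open>B\<close>; only
    its expectation replaces them by 0 and \<open>t - s\<close>, but the Taylor bound needs them
    pathwise.\<close>
  define R where "R \<omega> = g (U t \<omega>) - g (U s \<omega>) - g' (U s \<omega>) * ?\<alpha> \<omega>
      - g' (U s \<omega>) * \<xi> \<omega> * ?\<eta> \<omega> - (\<xi> \<omega>)\<^sup>2 * g'' (U s \<omega>) * (?\<eta> \<omega>)\<^sup>2 / 2" for \<omega>
  have iR: "integrable M R"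
    unfolding R_def using ig i\<alpha> i1(1) i2(1) by (intro Bochner_Integration.integrable_diff integrable_divide) auto
  have "expectation R = expectation (\<lambda>\<omega>. g (U t \<omega>)) - expectation (\<lambda>\<omega>. g (U s \<omega>))
     - expectation (\<lambda>\<omega>. g' (U s \<omega>) * ?\<alpha> \<omega>) - ?\<Delta> / 2 * expectation (\<lambda>\<omega>. (\<xi> \<omega>)\<^sup>2 * g'' (U s \<omega>))"
    unfolding R_def using ig i\<alpha> i1 i2 by simp
  moreover have "\<bar>expectation R\<bar> \<le> 4 * C * K ^ 3 * ?r"
  proof -
    let ?bound = "\<lambda>\<omega>. C * (K\<^sup>2 * ?\<Delta>\<^sup>2 + K\<^sup>2 * ?\<Delta> * \<bar>?\<eta> \<omega>\<bar> + K ^ 3 * \<bar>?\<eta> \<omega>\<bar> ^ 3)"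
    note m = brownian_increment_moments[OF st(1,2)]
    have ib: "integrable M ?bound"
      using m(1,3) by (intro Bochner_Integration.integrable_add integrable_mult_right) auto
    have ae: "AE \<omega> in M. \<bar>R \<omega>\<bar> \<le> ?bound \<omega>"
      using increment[OF st(1,2,3)]
    proof (rule AE_mp, intro AE_I2 impI)
      fix \<omega> assume \<omega>: "\<omega> \<in> space M" and eq: "U t \<omega> = U s \<omega> + ?\<alpha> \<omega> + \<xi> \<omega> * ?\<eta> \<omega>"
      have \<alpha>1: "\<bar>?\<alpha> \<omega>\<bar> \<le> K * ?\<Delta>" using drift_increment_le[OF \<omega>] st by simp
      then have \<alpha>2: "(?\<alpha> \<omega>)\<^sup>2 \<le> K\<^sup>2 * ?\<Delta>\<^sup>2"
        using power_mono[OF \<alpha>1, of 2] by (simp add: power_mult_distrib)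
      have w: "\<bar>\<xi> \<omega> * ?\<eta> \<omega>\<bar> \<le> K * \<bar>?\<eta> \<omega>\<bar>"
        unfolding abs_mult using \<xi>_le[OF \<omega>] by (intro mult_right_mono) auto
      have "\<bar>\<xi> \<omega> * ?\<eta> \<omega>\<bar> * \<bar>?\<alpha> \<omega>\<bar> \<le> K * \<bar>?\<eta> \<omega>\<bar> * (K * ?\<Delta>)"
        using w \<alpha>1 K by (intro mult_mono) auto
      moreover have "\<bar>\<xi> \<omega> * ?\<eta> \<omega>\<bar> ^ 3 \<le> K ^ 3 * \<bar>?\<eta> \<omega>\<bar> ^ 3"
        using power_mono[OF w, of 3] by (simp add: power_mult_distrib)
      ultimately have "C * ((?\<alpha> \<omega>)\<^sup>2 + \<bar>\<xi> \<omega> * ?\<eta> \<omega>\<bar> * \<bar>?\<alpha> \<omega>\<bar> + \<bar>\<xi> \<omega> * ?\<eta> \<omega>\<bar> ^ 3) \<le> ?bound \<omega>"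
        using \<alpha>2 C0 by (intro mult_left_mono) (simp_all add: power2_eq_square algebra_simps)
      with test_function_increment[OF tf, of "U s \<omega>" "?\<alpha> \<omega>" "\<xi> \<omega> * ?\<eta> \<omega>"]
      show "\<bar>R \<omega>\<bar> \<le> ?bound \<omega>"
        unfolding R_def eq by (simp add: power_mult_distrib mult_ac)
    qed
    have "\<bar>expectation R\<bar> \<le> expectation (\<lambda>\<omega>. \<bar>R \<omega>\<bar>)" by (rule integral_abs_bound)
    also have "\<dots> \<le> expectation ?bound"
      using iR ib ae by (intro integral_mono_AE) auto
    also have "\<dots> = C * (K\<^sup>2 * ?\<Delta>\<^sup>2 + K\<^sup>2 * ?\<Delta> * expectation (\<lambda>\<omega>. \<bar>?\<eta> \<omega>\<bar>) + K ^ 3 * expectation (\<lambda>\<omega>. \<bar>?\<eta> \<omega>\<bar> ^ 3))"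
      using m(1,3) by (simp add: prob_space)
    \<comment> \<open>With \<open>1 \<le> K\<close> and \<open>t - s \<le> 1\<close>, the squared
      drift, the mixed term and the cubed noise contribute the multiples 1, 1 and 2, which add up to
      the constant 4.\<close>
    also have "\<dots> \<le> C * (K ^ 3 * ?r + K ^ 3 * ?r + K ^ 3 * (2 * ?r))"
    proof (intro mult_left_mono add_mono C0)
      have "K\<^sup>2 * ?\<Delta>\<^sup>2 \<le> K ^ 3 * (?\<Delta> * sqrt ?\<Delta>)"
        using K \<Delta> by (intro mult_mono power_increasing) (auto simp: power2_eq_square)
      then show "K\<^sup>2 * ?\<Delta>\<^sup>2 \<le> K ^ 3 * ?r" by simp
      have "K\<^sup>2 * (?\<Delta> * expectation (\<lambda>\<omega>. \<bar>?\<eta> \<omega>\<bar>)) \<le> K ^ 3 * ?r"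
        using K \<Delta> m(2) by (intro mult_mono power_increasing) (auto intro!: mult_left_mono mult_nonneg_nonneg integral_nonneg)
      then show "K\<^sup>2 * ?\<Delta> * expectation (\<lambda>\<omega>. \<bar>?\<eta> \<omega>\<bar>) \<le> K ^ 3 * ?r" by simp
    qed (use m(4) K in auto)
    finally show ?thesis by (simp add: algebra_simps)
  qed
  ultimately show ?thesis by simp
qed

text \<open>The difference \<open>D\<close> of the two sides, as a function of the right endpoint,
  has increments of order (t - s)^(3/2) and is therefore constant. Two errors enter with the same
  constant: the Taylor remainder with derivatives frozen at \<open>s\<close>, and the cost of
  letting these derivatives run again under the time integral.\<close>

lemma ito_interval:
  "expectation (\<lambda>\<omega>. g (U d \<omega>)) - expectation (\<lambda>\<omega>. g (U c \<omega>)) =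
   (LINT u:{c<..d}|lborel. expectation (\<lambda>\<omega>. \<beta> u \<omega> * g' (U u \<omega>) + (\<xi> \<omega>)\<^sup>2 / 2 * g'' (U u \<omega>)))"
proof -
  let ?G = "\<lambda>u \<omega>. \<beta> u \<omega> * g' (U u \<omega>) + (\<xi> \<omega>)\<^sup>2 / 2 * g'' (U u \<omega>)"
  let ?\<psi> = "\<lambda>u. expectation (?G u)"
  define D where "D t = expectation (\<lambda>\<omega>. g (U t \<omega>)) - (LINT u:{c<..t}|lborel. ?\<psi> u)" for t
  note tfD = test_function_D[OF tf]
  have C0: "0 \<le> C" by (rule test_function_nonneg[OF tf])
  have K2: "(K + K\<^sup>2) * L \<le> 2 * K\<^sup>2 * L" if "0 \<le> L" for L
    using K that by (intro mult_right_mono) (auto simp: power2_eq_square)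
  have meas: "(\<lambda>(u, \<omega>). \<beta> u \<omega> * g' (V u \<omega>) + (\<xi> \<omega>)\<^sup>2 / 2 * g'' (V u \<omega>)) \<in> borel_measurable (borel \<Otimes>\<^sub>M M)"
    if [measurable]: "(\<lambda>(u, \<omega>). V u \<omega>) \<in> borel_measurable (borel \<Otimes>\<^sub>M M)" for V :: "real \<Rightarrow> 'a \<Rightarrow> real"
    by measurable
  have bnd: "\<bar>\<beta> u \<omega> * g' (V u \<omega>) + (\<xi> \<omega>)\<^sup>2 / 2 * g'' (V u \<omega>)\<bar> \<le> 2 * K\<^sup>2 * C"
    if "\<omega> \<in> space M" for u \<omega> and V :: "real \<Rightarrow> 'a \<Rightarrow> real"
    by (rule order_trans[OF generator_le[OF \<beta>_le[OF that] \<xi>_le[OF that] tfD(4,5)] K2[OF C0]])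
  have "D d = D c"
  proof (rule constant_if_superlinear_modulus[OF _ cd(2)])
    fix s t assume st: "c \<le> s" "s < t" "t \<le> d" "t - s \<le> 1"
    \<comment> \<open>The derivatives are frozen at \<open>s\<close> while the drift runs on; the
      time integral of \<open>?H\<close> is then exactly the expression in
      \<open>ito_step_taylor\<close>.\<close>
    let ?H = "\<lambda>u \<omega>. \<beta> u \<omega> * g' (U s \<omega>) + (\<xi> \<omega>)\<^sup>2 / 2 * g'' (U s \<omega>)"
    let ?\<alpha> = "\<lambda>\<omega>. LINT u:{s<..t}|lborel. \<beta> u \<omega>"
    have mH: "(\<lambda>(u, \<omega>). ?H u \<omega>) \<in> borel_measurable (borel \<Otimes>\<^sub>M M)" by measurable
    have bG: "\<bar>?G u \<omega>\<bar> \<le> 2 * K\<^sup>2 * C" and bH: "\<bar>?H u \<omega>\<bar> \<le> 2 * K\<^sup>2 * C" if "\<omega> \<in> space M" for u \<omega>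
      by (rule bnd[OF that])+
    note FG = Fubini_bounded[OF meas[OF U] bG] and FH = Fubini_bounded[OF mH bH]
    have i\<beta>: "set_integrable lborel {s<..t} (\<lambda>u. \<beta> u \<omega>)" if "\<omega> \<in> space M" for \<omega>
      using set_integrable_bounded_Ioc[OF \<beta>_path[OF that] \<beta>_le[OF that]] .
    note iH = integrable_step_terms[OF less_imp_le[OF st(2)]]
    have "expectation (\<lambda>\<omega>. LINT u:{s<..t}|lborel. ?H u \<omega>)
        = expectation (\<lambda>\<omega>. g' (U s \<omega>) * ?\<alpha> \<omega> + (t - s) / 2 * ((\<xi> \<omega>)\<^sup>2 * g'' (U s \<omega>)))"
    proof (rule Bochner_Integration.integral_cong[OF refl])
      fix \<omega> assume \<omega>: "\<omega> \<in> space M"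
      have "(LINT u:{s<..t}|lborel. ?H u \<omega>) = (LINT u:{s<..t}|lborel. \<beta> u \<omega> * g' (U s \<omega>))
          + (LINT u:{s<..t}|lborel. (\<xi> \<omega>)\<^sup>2 / 2 * g'' (U s \<omega>))"
        by (rule set_integral_add(2)[OF set_integrable_mult_left[OF i\<beta>[OF \<omega>]]
          set_integrable_bounded_Ioc[OF measurable_const order_refl]]) simp
      also have "(LINT u:{s<..t}|lborel. \<beta> u \<omega> * g' (U s \<omega>)) = ?\<alpha> \<omega> * g' (U s \<omega>)"
        by simp
      also have "(LINT u:{s<..t}|lborel. (\<xi> \<omega>)\<^sup>2 / 2 * g'' (U s \<omega>)) = (t - s) * ((\<xi> \<omega>)\<^sup>2 / 2 * g'' (U s \<omega>))"
        using st by (simp add: set_lebesgue_integral_def)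
      finally show "(LINT u:{s<..t}|lborel. ?H u \<omega>) = g' (U s \<omega>) * ?\<alpha> \<omega> + (t - s) / 2 * ((\<xi> \<omega>)\<^sup>2 * g'' (U s \<omega>))"
        by simp
    qed
    then have H: "(LINT u:{s<..t}|lborel. expectation (?H u))
        = expectation (\<lambda>\<omega>. g' (U s \<omega>) * ?\<alpha> \<omega>) + (t - s) / 2 * expectation (\<lambda>\<omega>. (\<xi> \<omega>)\<^sup>2 * g'' (U s \<omega>))"
      using FH(3) iH by simp
    \<comment> \<open>Unfreezing uses that \<open>g'\<close> and \<open>g''\<close> are Lipschitz,
      so that the L1 modulus of \<open>U\<close> controls the difference of the integrands.\<close>
    have close: "\<bar>expectation (?H u) - ?\<psi> u\<bar> \<le> 4 * C * K ^ 3 * sqrt (t - s)" if u: "u \<in> {s<..t}" for u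
    proof -
      have iHu: "integrable M (?H u)" "integrable M (?G u)"
        using bnd by (auto intro!: integrable_bounded[where K = "2 * K\<^sup>2 * C"])
      note L1 = ito_step_L1[of s u]
      have "\<bar>expectation (?H u) - ?\<psi> u\<bar> = \<bar>expectation (\<lambda>\<omega>. ?H u \<omega> - ?G u \<omega>)\<bar>"
        using iHu by simp
      also have "\<dots> \<le> expectation (\<lambda>\<omega>. \<bar>?H u \<omega> - ?G u \<omega>\<bar>)" by (rule integral_abs_bound)
      also have "\<dots> \<le> expectation (\<lambda>\<omega>. 2 * K\<^sup>2 * C * \<bar>U u \<omega> - U s \<omega>\<bar>)"
      proof (rule integral_mono)
        show "integrable M (\<lambda>\<omega>. \<bar>?H u \<omega> - ?G u \<omega>\<bar>)" using iHu by simp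
        show "integrable M (\<lambda>\<omega>. 2 * K\<^sup>2 * C * \<bar>U u \<omega> - U s \<omega>\<bar>)" using L1(1) st u by simp
        fix \<omega> assume \<omega>: "\<omega> \<in> space M"
        have "?H u \<omega> - ?G u \<omega> = \<beta> u \<omega> * (g' (U s \<omega>) - g' (U u \<omega>)) + (\<xi> \<omega>)\<^sup>2 / 2 * (g'' (U s \<omega>) - g'' (U u \<omega>))"
          by (simp add: field_simps)
        also have "\<bar>\<dots>\<bar> \<le> 2 * K\<^sup>2 * (C * \<bar>U s \<omega> - U u \<omega>\<bar>)"
          using tfD(6) test_function_lipschitz(2)[OF tf] C0
          by (intro order_trans[OF generator_le[OF \<beta>_le[OF \<omega>] \<xi>_le[OF \<omega>]] K2]) auto
        finally show "\<bar>?H u \<omega> - ?G u \<omega>\<bar> \<le> 2 * K\<^sup>2 * C * \<bar>U u \<omega> - U s \<omega>\<bar>"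
          by (simp add: mult.assoc abs_minus_commute)
      qed
      also have "\<dots> \<le> 2 * K\<^sup>2 * C * (2 * K * sqrt (u - s))"
        unfolding integral_mult_right_zero using L1(2) st u C0 by (intro mult_left_mono) auto
      also have "\<dots> \<le> 2 * K\<^sup>2 * C * (2 * K * sqrt (t - s))"
        using u C0 K by (intro mult_left_mono) auto
      finally show ?thesis by (simp add: power2_eq_square power3_eq_cube mult_ac)
    qed
    have split: "(LINT u:{c<..t}|lborel. ?\<psi> u) = (LINT u:{c<..s}|lborel. ?\<psi> u) + (LINT u:{s<..t}|lborel. ?\<psi> u)"
    proof -
      have "{c<..t} = {c<..s} \<union> {s<..t}" using st by auto
      then show ?thesis using FG(1) by (simp add: set_integral_Un)
    qed
    have "\<bar>(LINT u:{s<..t}|lborel. expectation (?H u)) - (LINT u:{s<..t}|lborel. ?\<psi> u)\<bar>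
        = \<bar>LINT u:{s<..t}|lborel. expectation (?H u) - ?\<psi> u\<bar>"
      using FG(1) FH(1) by (simp add: set_integral_diff)
    also have "\<dots> \<le> 4 * C * K ^ 3 * sqrt (t - s) * (t - s)"
      using set_integral_diff(1)[OF FH(1) FG(1), of s t] close st by (intro set_integral_Ioc_bound) auto
    also have "\<dots> = 4 * C * K ^ 3 * ((t - s) * sqrt (t - s))" by simp
    finally have "\<bar>(LINT u:{s<..t}|lborel. expectation (?H u)) - (LINT u:{s<..t}|lborel. ?\<psi> u)\<bar>
      \<le> 4 * C * K ^ 3 * ((t - s) * sqrt (t - s))" .
    with ito_step_taylor[OF st] have "\<bar>D t - D s\<bar> \<le> 4 * C * K ^ 3 * ((t - s) * sqrt (t - s)) + 4 * C * K ^ 3 * ((t - s) * sqrt (t - s))"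
      unfolding D_def split H by linarith
    then show "\<bar>D t - D s\<bar> \<le> 8 * C * K ^ 3 * ((t - s) * sqrt (t - s))" by linarith
  qed
  then show ?thesis by (simp add: D_def set_lebesgue_integral_def)
qed

end

end

section \<open>Integrals of simple processes\<close>

lemma simple_data_mono:
  assumes "simple_data M F k \<tau> \<xi>" "i \<le> j" "j \<le> k"
  shows "\<tau> i \<le> \<tau> j"
  using assms(2,3)
proof (induction rule: dec_induct)
  case (step n)
  then show ?case using assms(1) unfolding simple_data_def by (meson Suc_le_lessD less_imp_le_nat order_trans)
qed simp

lemma simple_data_nonneg: "simple_data M F k \<tau> \<xi> \<Longrightarrow> i \<le> k \<Longrightarrow> 0 \<le> \<tau> i"
  using simple_data_mono[of M F k \<tau> \<xi> 0 i] by (auto simp: simple_data_def)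

lemma simple_integral_before:
  assumes "simple_data M F k \<tau> \<xi>" "t \<le> \<tau> 0"
  shows "simple_integral B k \<tau> \<xi> t \<omega> = 0"
  unfolding simple_integral_def
proof (intro sum.neutral ballI)
  fix i assume "i \<in> {..<k}"
  then have "\<tau> 0 \<le> \<tau> i" "\<tau> 0 \<le> \<tau> (Suc i)"
    using simple_data_mono[OF assms(1)] by auto
  with assms(2) show "\<xi> i \<omega> * (B (min (\<tau> (Suc i)) t) \<omega> - B (min (\<tau> i) t) \<omega>) = 0"
    by (simp add: min_absorb2)
qed

lemma simple_integral_after:
  assumes "simple_data M F k \<tau> \<xi>" "\<tau> k \<le> s" "s \<le> t"
  shows "simple_integral B k \<tau> \<xi> t \<omega> = simple_integral B k \<tau> \<xi> s \<omega>"
  unfolding simple_integral_def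
proof (intro sum.cong refl)
  fix i assume "i \<in> {..<k}"
  then have "\<tau> i \<le> \<tau> k" "\<tau> (Suc i) \<le> \<tau> k"
    using simple_data_mono[OF assms(1)] by auto
  with assms(2,3) show "\<xi> i \<omega> * (B (min (\<tau> (Suc i)) t) \<omega> - B (min (\<tau> i) t) \<omega>)
      = \<xi> i \<omega> * (B (min (\<tau> (Suc i)) s) \<omega> - B (min (\<tau> i) s) \<omega>)"
    by (simp add: min_absorb1)
qed

text \<open>Steps before \<open>i\<close> are completed at both times and later ones have not begun,
  so the truncations by \<open>min\<close> cancel except in step \<open>i\<close>.\<close>

lemma simple_integral_cell:
  assumes sd: "simple_data M F k \<tau> \<xi>" and i: "i < k" and "\<tau> i \<le> s" "s \<le> t" "t \<le> \<tau> (Suc i)"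
  shows "simple_integral B k \<tau> \<xi> t \<omega> - simple_integral B k \<tau> \<xi> s \<omega> = \<xi> i \<omega> * (B t \<omega> - B s \<omega>)"
proof -
  have "simple_integral B k \<tau> \<xi> t \<omega> - simple_integral B k \<tau> \<xi> s \<omega> =
    (\<Sum>j<k. if j = i then \<xi> i \<omega> * (B t \<omega> - B s \<omega>) else 0)"
    unfolding simple_integral_def sum_subtractf[symmetric]
  proof (intro sum.cong refl)
    fix j assume "j \<in> {..<k}"
    then have j: "j < k" by simp
    consider "j < i" | "j = i" | "i < j" by linarith
    then show "\<xi> j \<omega> * (B (min (\<tau> (Suc j)) t) \<omega> - B (min (\<tau> j) t) \<omega>) -
       \<xi> j \<omega> * (B (min (\<tau> (Suc j)) s) \<omega> - B (min (\<tau> j) s) \<omega>) = (if j = i then \<xi> i \<omega> * (B t \<omega> - B s \<omega>) else 0)"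
    proof cases
      case 1
      then have "\<tau> j \<le> \<tau> i" "\<tau> (Suc j) \<le> \<tau> i"
        using simple_data_mono[OF sd] i by auto
      with 1 assms(3,4) show ?thesis by (simp add: min_absorb1)
    next
      case 2
      with assms show ?thesis by (simp add: min_absorb1 min_absorb2 algebra_simps)
    next
      case 3
      then have "\<tau> (Suc i) \<le> \<tau> j" "\<tau> (Suc i) \<le> \<tau> (Suc j)"
        using simple_data_mono[OF sd] j by auto
      with 3 assms(4,5) show ?thesis by (simp add: min_absorb2)
    qed
  qed
  also have "\<dots> = \<xi> i \<omega> * (B t \<omega> - B s \<omega>)" using i by simp
  finally show ?thesis .
qed

lemma simple_process_outside:
  assumes sd: "simple_data M F k \<tau> \<xi>" and "u \<le> \<tau> 0 \<or> \<tau> k < u"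
  shows "simple_process k \<tau> \<xi> u \<omega> = 0"
  unfolding simple_process_def
proof (intro sum.neutral ballI)
  fix i assume "i \<in> {..<k}"
  then have "\<tau> 0 \<le> \<tau> i" "\<tau> (Suc i) \<le> \<tau> k"
    using simple_data_mono[OF sd] by auto
  with assms(2) show "\<xi> i \<omega> * indicator {\<tau> i<..\<tau> (Suc i)} u = 0" by auto
qed

lemma simple_process_cell:
  assumes sd: "simple_data M F k \<tau> \<xi>" and i: "i < k" and u: "\<tau> i < u" "u \<le> \<tau> (Suc i)"
  shows "simple_process k \<tau> \<xi> u \<omega> = \<xi> i \<omega>"
proof -
  have "simple_process k \<tau> \<xi> u \<omega> = (\<Sum>j<k. if j = i then \<xi> i \<omega> else 0)"
    unfolding simple_process_def
  proof (intro sum.cong refl)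
    fix j assume "j \<in> {..<k}"
    then have j: "j < k" by simp
    consider "j < i" | "j = i" | "i < j" by linarith
    then show "\<xi> j \<omega> * indicator {\<tau> j<..\<tau> (Suc j)} u = (if j = i then \<xi> i \<omega> else 0)"
    proof cases
      case 1
      then show ?thesis using simple_data_mono[OF sd, of "Suc j" i] i u by auto
    next
      case 3
      then show ?thesis using simple_data_mono[OF sd, of "Suc i" j] j u by auto
    qed (use u in auto)
  qed
  then show ?thesis using i by simp
qed

text \<open>Finitely many bounded images. The bound is raised to at least 1 because the short-step
  estimates absorb lower powers of it into \<open>K ^ 3\<close>.\<close>

lemma simple_data_bounded:
  assumes "simple_data M F k \<tau> \<xi>"
  obtains K where "1 \<le> K" "\<And>i \<omega>. i < k \<Longrightarrow> \<omega> \<in> space M \<Longrightarrow> \<bar>\<xi> i \<omega>\<bar> \<le> K"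
proof -
  have "bounded (\<Union>i\<in>{..<k}. \<xi> i ` space M)"
    using assms unfolding simple_data_def by (intro bounded_UN) auto
  then obtain K where K: "\<And>y. y \<in> (\<Union>i\<in>{..<k}. \<xi> i ` space M) \<Longrightarrow> norm y \<le> K"
    unfolding bounded_iff by auto
  show ?thesis
    by (rule that[of "max 1 K"]) (use K in \<open>force simp: le_max_iff_disj\<close>)+
qed

context usual_filtered_prob_space
begin

lemma simple_data_measurable:
  assumes "simple_data M F k \<tau> \<xi>" "i < k"
  shows "\<xi> i \<in> borel_measurable M"
  using assms simple_data_nonneg[OF assms(1), of i] measurable_from_subalg[OF sub]
  by (auto simp: simple_data_def)

lemma simple_process_measurable:
  assumes "simple_data M F k \<tau> \<xi>"
  shows "(\<lambda>(u, \<omega>). simple_process k \<tau> \<xi> u \<omega>) \<in> borel_measurable (borel \<Otimes>\<^sub>M M)"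
proof -
  have "(\<lambda>p. \<Sum>i<k. \<xi> i (snd p) * indicator {\<tau> i<..\<tau> (Suc i)} (fst p)) \<in> borel_measurable (borel \<Otimes>\<^sub>M M)"
  proof (rule borel_measurable_sum)
    fix i assume "i \<in> {..<k}"
    then have [measurable]: "\<xi> i \<in> borel_measurable M" using simple_data_measurable[OF assms] by simp
    show "(\<lambda>p. \<xi> i (snd p) * indicator {\<tau> i<..\<tau> (Suc i)} (fst p)) \<in> borel_measurable (borel \<Otimes>\<^sub>M M)"
      by measurable
  qed
  then show ?thesis by (simp add: case_prod_beta simple_process_def)
qed

lemma simple_process_bounded:
  assumes sd: "simple_data M F k \<tau> \<xi>" and K: "1 \<le> K" "\<And>i \<omega>. i < k \<Longrightarrow> \<omega> \<in> space M \<Longrightarrow> \<bar>\<xi> i \<omega>\<bar> \<le> K"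
    and \<omega>: "\<omega> \<in> space M"
  shows "\<bar>simple_process k \<tau> \<xi> u \<omega>\<bar> \<le> K"
proof (cases "\<exists>i<k. \<tau> i < u \<and> u \<le> \<tau> (Suc i)")
  case True
  then show ?thesis using simple_process_cell[OF sd] K \<omega> by metis
next
  case False
  then have "simple_process k \<tau> \<xi> u \<omega> = 0"
    unfolding simple_process_def by (intro sum.neutral) (auto simp: indicator_def)
  then show ?thesis using K by simp
qed

text \<open>Inside one step the noise coefficient is the constant-in-time variable
  \<open>\<xi> i\<close>, which is the setting of \<open>ito_interval\<close>; before the first and
  after the last time it is 0. The formulas on these pieces are chained.\<close>

lemma ito_simple:
  assumes bm: "brownian_motion M F B" and tf: "test_function C g g' g''"
    and sd: "simple_data M F k \<tau> \<xi>"
    and U: "(\<lambda>(u, \<omega>). U u \<omega>) \<in> borel_measurable (borel \<Otimes>\<^sub>M M)"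
    and \<beta>: "(\<lambda>(u, \<omega>). \<beta> u \<omega>) \<in> borel_measurable (borel \<Otimes>\<^sub>M M)"
    and \<beta>_le: "\<And>u \<omega>. \<omega> \<in> space M \<Longrightarrow> \<bar>\<beta> u \<omega>\<bar> \<le> K"
    and adapted: "\<And>t. 0 \<le> t \<Longrightarrow> U t \<in> borel_measurable (F t)"
    and increment: "\<And>s t. 0 \<le> s \<Longrightarrow> s < t \<Longrightarrow>
      AE \<omega> in M. U t \<omega> = U s \<omega> + (LINT u:{s<..t}|lborel. \<beta> u \<omega>) +
        (simple_integral B k \<tau> \<xi> t \<omega> - simple_integral B k \<tau> \<xi> s \<omega>)"
    and T: "0 \<le> T"
  shows "expectation (\<lambda>\<omega>. g (U T \<omega>)) - expectation (\<lambda>\<omega>. g (U 0 \<omega>)) =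
   (LINT u:{0<..T}|lborel. expectation (\<lambda>\<omega>. \<beta> u \<omega> * g' (U u \<omega>) + (simple_process k \<tau> \<xi> u \<omega>)\<^sup>2 / 2 * g'' (U u \<omega>)))"
proof -
  obtain L where L: "1 \<le> L" "\<And>i \<omega>. i < k \<Longrightarrow> \<omega> \<in> space M \<Longrightarrow> \<bar>\<xi> i \<omega>\<bar> \<le> L"
    using simple_data_bounded[OF sd] by blast
  define K' where "K' = max K L"
  have K': "1 \<le> K'" "K \<le> K'" "L \<le> K'" using L by (auto simp: K'_def)
  let ?SP = "simple_process k \<tau> \<xi>"
  let ?G = "\<lambda>u \<omega>. \<beta> u \<omega> * g' (U u \<omega>) + (?SP u \<omega>)\<^sup>2 / 2 * g'' (U u \<omega>)"
  let ?\<psi> = "\<lambda>u. expectation (?G u)" and ?e = "\<lambda>t. expectation (\<lambda>\<omega>. g (U t \<omega>))"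
  note [measurable] = U \<beta> simple_process_measurable[OF sd] test_function_measurable[OF tf]
  have \<psi>: "set_integrable lborel {s<..t} ?\<psi>" for s t
  proof (rule Fubini_bounded(1))
    show "(\<lambda>(u, \<omega>). ?G u \<omega>) \<in> borel_measurable (borel \<Otimes>\<^sub>M M)" by measurable
    fix u \<omega> assume \<omega>: "\<omega> \<in> space M"
    show "\<bar>?G u \<omega>\<bar> \<le> (K' + K'\<^sup>2) * C"
      using \<beta>_le[OF \<omega>, of u] simple_process_bounded[OF sd L \<omega>, of u] K' test_function_D(4,5)[OF tf]
      by (intro generator_le) (auto intro: order_trans)
  qed
  \<comment> \<open>Here \<open>\<eta>\<close> is \<open>\<xi> i\<close> on a step and the zero
    function outside all steps.\<close>
  have cell: "?e d - ?e c = (LINT u:{c<..d}|lborel. ?\<psi> u)"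
    if cd: "0 \<le> c" "c \<le> d" and \<eta>: "\<eta> \<in> borel_measurable (F c)" "\<And>\<omega>. \<omega> \<in> space M \<Longrightarrow> \<bar>\<eta> \<omega>\<bar> \<le> L"
      and SI: "\<And>s t \<omega>. c \<le> s \<Longrightarrow> s \<le> t \<Longrightarrow> t \<le> d \<Longrightarrow> simple_integral B k \<tau> \<xi> t \<omega> - simple_integral B k \<tau> \<xi> s \<omega> = \<eta> \<omega> * (B t \<omega> - B s \<omega>)"
      and SP: "\<And>u \<omega>. c < u \<Longrightarrow> u \<le> d \<Longrightarrow> ?SP u \<omega> = \<eta> \<omega>" for c d \<eta>
  proof -
    have "?e d - ?e c = (LINT u:{c<..d}|lborel. expectation (\<lambda>\<omega>. \<beta> u \<omega> * g' (U u \<omega>) + (\<eta> \<omega>)\<^sup>2 / 2 * g'' (U u \<omega>)))"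
    proof (rule ito_interval[OF bm tf cd K'(1) U \<beta> _ \<eta>(1)])
      show "\<bar>\<beta> u \<omega>\<bar> \<le> K'" if "\<omega> \<in> space M" for u \<omega> using \<beta>_le[OF that, of u] K' by linarith
      show "\<bar>\<eta> \<omega>\<bar> \<le> K'" if "\<omega> \<in> space M" for \<omega> using \<eta>(2)[OF that] K' by linarith
      show "U t \<in> borel_measurable (F t)" if "c \<le> t" for t using adapted[of t] that cd by simp
      fix s t assume st: "c \<le> s" "s < t" "t \<le> d"
      then have "0 \<le> s" using cd by simp
      from increment[OF this st(2)]
      show "AE \<omega> in M. U t \<omega> = U s \<omega> + (LINT u:{s<..t}|lborel. \<beta> u \<omega>) + \<eta> \<omega> * (B t \<omega> - B s \<omega>)"
        using SI[of s t] st by simp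
    qed
    also have "\<dots> = (LINT u:{c<..d}|lborel. ?\<psi> u)"
      using SP by (intro set_lebesgue_integral_cong) auto
    finally show ?thesis .
  qed
  have join: "?e d - ?e 0 = (LINT u:{0<..d}|lborel. ?\<psi> u)"
    if "0 \<le> c" "c \<le> d" "?e c - ?e 0 = (LINT u:{0<..c}|lborel. ?\<psi> u)" "?e d - ?e c = (LINT u:{c<..d}|lborel. ?\<psi> u)" for c d
  proof -
    have "{0<..d} = {0<..c} \<union> {c<..d}" using that by auto
    then have "(LINT u:{0<..d}|lborel. ?\<psi> u) = (LINT u:{0<..c}|lborel. ?\<psi> u) + (LINT u:{c<..d}|lborel. ?\<psi> u)"
      using \<psi> by (simp add: set_integral_Un)
    with that show ?thesis by simp
  qed
  have before: "?e t - ?e 0 = (LINT u:{0<..t}|lborel. ?\<psi> u)" if "0 \<le> t" "t \<le> \<tau> 0" for t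
    by (rule cell[of _ _ "\<lambda>_. 0"])
      (use that L simple_integral_before[OF sd] simple_process_outside[OF sd] in auto)
  \<comment> \<open>The claim is carried for all times up to \<open>\<tau> i\<close> and not only at
    \<open>\<tau> i\<close>, since \<open>T\<close> may fall inside a step.\<close>
  have inside: "\<forall>t\<in>{0..\<tau> i}. ?e t - ?e 0 = (LINT u:{0<..t}|lborel. ?\<psi> u)" if "i \<le> k" for i
    using that
  proof (induction i)
    case (Suc i)
    show ?case
    proof
      fix t assume t: "t \<in> {0..\<tau> (Suc i)}"
      have \<tau>: "0 \<le> \<tau> i" using simple_data_nonneg[OF sd, of i] Suc by simp
      show "?e t - ?e 0 = (LINT u:{0<..t}|lborel. ?\<psi> u)"
      proof (cases "t \<le> \<tau> i")
        case False
        show ?thesis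
        proof (rule join[OF \<tau>])
          show "?e t - ?e (\<tau> i) = (LINT u:{\<tau> i<..t}|lborel. ?\<psi> u)"
            by (rule cell[of _ _ "\<xi> i"])
              (use False t \<tau> L Suc sd simple_integral_cell[OF sd, of i] simple_process_cell[OF sd, of i] in
                \<open>auto simp: simple_data_def\<close>)
        qed (use False Suc \<tau> in auto)
      qed (use Suc t in auto)
    qed
  qed (use before in auto)
  show ?thesis
  proof (cases "T \<le> \<tau> k")
    case False
    have \<tau>: "0 \<le> \<tau> k" using simple_data_nonneg[OF sd, of k] by simp
    show ?thesis
    proof (rule join[OF \<tau>])
      show "?e T - ?e (\<tau> k) = (LINT u:{\<tau> k<..T}|lborel. ?\<psi> u)"
      proof (rule cell[of _ _ "\<lambda>_. 0"])
        show "simple_integral B k \<tau> \<xi> t \<omega> - simple_integral B k \<tau> \<xi> s \<omega> = 0 * (B t \<omega> - B s \<omega>)"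
          if "\<tau> k \<le> s" "s \<le> t" for s t \<omega>
          using simple_integral_after[OF sd that, of B \<omega>] by simp
      qed (use False \<tau> L simple_process_outside[OF sd] in auto)
    qed (use False inside[of k] \<tau> in auto)
  qed (use inside[of k] T in auto)
qed

end

section \<open>Ito formula in expectation\<close>

lemma (in finite_measure) integral_tendsto_0_if_L2:
  fixes Z W :: "nat \<Rightarrow> 'a \<Rightarrow> real"
  assumes Z[measurable]: "\<And>n. Z n \<in> borel_measurable M" and W[measurable]: "\<And>n. W n \<in> borel_measurable M"
    and lim: "(\<lambda>n. \<integral>\<^sup>+\<omega>. ennreal ((Z n \<omega>)\<^sup>2) \<partial>M) \<longlonglongrightarrow> 0"
    and W_le: "\<And>n \<omega>. \<omega> \<in> space M \<Longrightarrow> \<bar>W n \<omega>\<bar> \<le> c * (\<bar>Z n \<omega>\<bar> + (Z n \<omega>)\<^sup>2)"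
    and c: "0 \<le> c"
  shows "(\<lambda>n. \<integral>\<omega>. W n \<omega> \<partial>M) \<longlonglongrightarrow> 0"
proof -
  define r where "r n = (\<integral>\<omega>. (Z n \<omega>)\<^sup>2 \<partial>M)" for n
  define m where "m = measure M (space M)"
  have r: "r \<longlonglongrightarrow> 0"
  proof -
    have eq: "r = (\<lambda>n. enn2real (\<integral>\<^sup>+\<omega>. ennreal ((Z n \<omega>)\<^sup>2) \<partial>M))"
      unfolding r_def by (intro ext integral_eq_nn_integral) auto
    show ?thesis unfolding eq by (rule tendsto_enn2real) (use lim in auto)
  qed
  \<comment> \<open>The limit is taken in \<open>ennreal\<close>, where early terms may be infinite,
    so integrability holds only from some index on.\<close>
  have fin: "\<forall>\<^sub>F n in sequentially. integrable M (\<lambda>\<omega>. (Z n \<omega>)\<^sup>2)"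
    using order_tendstoD(2)[OF lim, of \<infinity>]
    by (auto elim!: eventually_mono simp: integrable_iff_bounded)
  have key: "\<bar>\<integral>\<omega>. W n \<omega> \<partial>M\<bar> \<le> c * (\<epsilon> * m + (1 + 1 / \<epsilon>) * r n)"
    if i: "integrable M (\<lambda>\<omega>. (Z n \<omega>)\<^sup>2)" and \<epsilon>: "0 < \<epsilon>" for n \<epsilon>
  proof -
    have ib: "integrable M (\<lambda>\<omega>. c * (\<epsilon> + (1 + 1 / \<epsilon>) * (Z n \<omega>)\<^sup>2))"
      using i by (intro integrable_mult_right Bochner_Integration.integrable_add) auto
    have le: "\<bar>W n \<omega>\<bar> \<le> c * (\<epsilon> + (1 + 1 / \<epsilon>) * (Z n \<omega>)\<^sup>2)" if "\<omega> \<in> space M" for \<omega>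
    proof -
      have "\<bar>z\<bar> \<le> \<epsilon> + z\<^sup>2 / \<epsilon>" for z :: real
      proof (cases "\<bar>z\<bar> \<le> \<epsilon>")
        case False
        then have "\<bar>z\<bar> * \<epsilon> \<le> \<bar>z\<bar> * \<bar>z\<bar>" by (intro mult_left_mono) auto
        then have "\<bar>z\<bar> \<le> z\<^sup>2 / \<epsilon>" using \<epsilon> by (simp add: le_divide_eq power2_eq_square)
        then show ?thesis using \<epsilon> by simp
      next
        case True
        have "0 \<le> z\<^sup>2 / \<epsilon>" using \<epsilon> by simp
        with True show ?thesis by linarith
      qed
      from this[of "Z n \<omega>"] have "c * (\<bar>Z n \<omega>\<bar> + (Z n \<omega>)\<^sup>2) \<le> c * (\<epsilon> + (1 + 1 / \<epsilon>) * (Z n \<omega>)\<^sup>2)"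
        by (intro mult_left_mono c) (simp add: algebra_simps)
      with W_le[OF that, of n] show ?thesis by linarith
    qed
    have "\<bar>\<integral>\<omega>. W n \<omega> \<partial>M\<bar> \<le> (\<integral>\<omega>. c * (\<epsilon> + (1 + 1 / \<epsilon>) * (Z n \<omega>)\<^sup>2) \<partial>M)"
    proof -
      have "integrable M (W n)"
      proof (rule Bochner_Integration.integrable_bound[OF ib W], rule AE_I2)
        fix \<omega> assume "\<omega> \<in> space M"
        from le[OF this] show "norm (W n \<omega>) \<le> norm (c * (\<epsilon> + (1 + 1 / \<epsilon>) * (Z n \<omega>)\<^sup>2))"
          unfolding real_norm_def by linarith
      qed
      then have "(\<integral>\<omega>. \<bar>W n \<omega>\<bar> \<partial>M) \<le> (\<integral>\<omega>. c * (\<epsilon> + (1 + 1 / \<epsilon>) * (Z n \<omega>)\<^sup>2) \<partial>M)"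
        using ib le by (intro integral_mono) auto
      with integral_abs_bound[of M "W n"] show ?thesis by linarith
    qed
    also have "\<dots> = c * (\<epsilon> * m + (1 + 1 / \<epsilon>) * r n)"
      using i by (simp add: r_def m_def)
    finally show ?thesis .
  qed
  show ?thesis
  proof (rule LIMSEQ_I)
    fix e :: real assume e: "0 < e"
    \<comment> \<open>Chosen so that the part not depending on \<open>n\<close> is at most
      \<open>e / 2\<close>; the added 1 covers \<open>c * m = 0\<close>.\<close>
    define \<epsilon> where "\<epsilon> = e / (2 * (c * m + 1))"
    have m: "0 \<le> c * m" using c by (simp add: m_def)
    have \<epsilon>: "0 < \<epsilon>" using e m by (simp add: \<epsilon>_def)
    have "c * m * \<epsilon> \<le> (c * m + 1) * \<epsilon>" using \<epsilon> by (intro mult_right_mono) auto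
    also have "\<dots> = e / 2" using m by (simp add: \<epsilon>_def field_simps)
    finally have 1: "c * m * \<epsilon> \<le> e / 2" .
    have "(\<lambda>n. c * (1 + 1 / \<epsilon>) * r n) \<longlonglongrightarrow> c * (1 + 1 / \<epsilon>) * 0" by (intro tendsto_intros r)
    then have "\<forall>\<^sub>F n in sequentially. c * (1 + 1 / \<epsilon>) * r n < e / 2"
      using e by (intro order_tendstoD(2)) auto
    with fin have "\<forall>\<^sub>F n in sequentially. norm ((\<integral>\<omega>. W n \<omega> \<partial>M) - 0) < e"
    proof eventually_elim
      case (elim n)
      have "c * (\<epsilon> * m + (1 + 1 / \<epsilon>) * r n) = c * m * \<epsilon> + c * (1 + 1 / \<epsilon>) * r n"
        by (simp add: algebra_simps)
      with key[OF elim(1) \<epsilon>] 1 elim(2) show ?case by simp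
    qed
    then show "\<exists>no. \<forall>n\<ge>no. norm ((\<integral>\<omega>. W n \<omega> \<partial>M) - 0) < e" by (simp add: eventually_sequentially)
  qed
qed

context usual_filtered_prob_space
begin

lemma simple_integral_adapted:
  assumes sd: "simple_data M F k \<tau> \<xi>" and B: "\<And>t. 0 \<le> t \<Longrightarrow> B t \<in> borel_measurable (F t)" and t: "0 \<le> t"
  shows "simple_integral B k \<tau> \<xi> t \<in> borel_measurable (F t)"
proof -
  have "(\<lambda>\<omega>. \<Sum>i<k. \<xi> i \<omega> * (B (min (\<tau> (Suc i)) t) \<omega> - B (min (\<tau> i) t) \<omega>)) \<in> borel_measurable (F t)"
  proof (rule borel_measurable_sum)
    fix i assume "i \<in> {..<k}"
    then have i: "i < k" by simp
    have nn: "0 \<le> \<tau> i" "0 \<le> \<tau> (Suc i)" "\<tau> i \<le> \<tau> (Suc i)"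
      using simple_data_nonneg[OF sd] simple_data_mono[OF sd, of i "Suc i"] i by auto
    show "(\<lambda>\<omega>. \<xi> i \<omega> * (B (min (\<tau> (Suc i)) t) \<omega> - B (min (\<tau> i) t) \<omega>)) \<in> borel_measurable (F t)"
    \<comment> \<open>Before \<open>\<tau> i\<close> the coefficient \<open>\<xi> i\<close> may fail
      to be measurable for \<open>F t\<close>, but its step then contributes 0.\<close>
    proof (cases "\<tau> i \<le> t")
      case True
      have [measurable]: "\<xi> i \<in> borel_measurable (F t)"
        using sd i unfolding simple_data_def by (intro measurable_F_mono[OF nn(1) True]) blast
      have [measurable]: "B (min u t) \<in> borel_measurable (F t)" if "0 \<le> u" for u
        using B[of "min u t"] measurable_F_mono[of "min u t" t] that t by simp
      show ?thesis using nn by measurable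
    next
      case False
      with nn show ?thesis by (simp add: min_absorb2)
    qed
  qed
  then show ?thesis by (simp add: simple_integral_def[abs_def])
qed

lemma simple_integral_measurable:
  assumes sd: "simple_data M F k \<tau> \<xi>"
    and B[measurable]: "(\<lambda>(u, \<omega>). B u \<omega>) \<in> borel_measurable (borel \<Otimes>\<^sub>M M)"
  shows "(\<lambda>(u, \<omega>). simple_integral B k \<tau> \<xi> u \<omega>) \<in> borel_measurable (borel \<Otimes>\<^sub>M M)"
proof -
  have "(\<lambda>p. \<Sum>i<k. \<xi> i (snd p) * (B (min (\<tau> (Suc i)) (fst p)) (snd p) - B (min (\<tau> i) (fst p)) (snd p)))
      \<in> borel_measurable (borel \<Otimes>\<^sub>M M)"
  proof (rule borel_measurable_sum)
    fix i assume "i \<in> {..<k}"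
    then have [measurable]: "\<xi> i \<in> borel_measurable M" using simple_data_measurable[OF sd] by simp
    show "(\<lambda>p. \<xi> i (snd p) * (B (min (\<tau> (Suc i)) (fst p)) (snd p) - B (min (\<tau> i) (fst p)) (snd p)))
      \<in> borel_measurable (borel \<Otimes>\<^sub>M M)"
      by measurable
  qed
  then show ?thesis by (simp add: case_prod_beta simple_integral_def)
qed

text \<open>Exchanging \<open>I\<close> for the integral of the \<open>n\<close>-th simple process
  turns \<open>X\<close> into \<open>U n\<close>, which \<open>ito_simple\<close> covers. At each
  time \<open>U n\<close> tends to \<open>X\<close> in L2, which takes care of \<open>g\<close>,
  \<open>g'\<close> and \<open>g''\<close>; the squared coefficients converge only in mean over time
  and probability together.\<close>

lemma ito_formula:
  assumes bm: "brownian_motion M F B" and tf: "test_function C g g' g''"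
    and B': "\<And>t. 0 \<le> t \<Longrightarrow> B' t \<in> borel_measurable (F t)"
      "(\<lambda>(u, \<omega>). B' u \<omega>) \<in> borel_measurable (borel \<Otimes>\<^sub>M M)"
      "AE \<omega> in M. \<forall>t\<ge>0. B' t \<omega> = B t \<omega>"
    and X: "\<And>t. 0 \<le> t \<Longrightarrow> X t \<in> borel_measurable (F t)"
      "(\<lambda>(u, \<omega>). X u \<omega>) \<in> borel_measurable (borel \<Otimes>\<^sub>M M)"
    and I: "\<And>t. 0 \<le> t \<Longrightarrow> I t \<in> borel_measurable (F t)"
      "(\<lambda>(u, \<omega>). I u \<omega>) \<in> borel_measurable (borel \<Otimes>\<^sub>M M)"
    and \<beta>: "(\<lambda>(u, \<omega>). \<beta> u \<omega>) \<in> borel_measurable (borel \<Otimes>\<^sub>M M)"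
      "\<And>u \<omega>. \<omega> \<in> space M \<Longrightarrow> \<bar>\<beta> u \<omega>\<bar> \<le> K"
    and H: "(\<lambda>(u, \<omega>). H u \<omega>) \<in> borel_measurable (borel \<Otimes>\<^sub>M M)"
      "\<And>u \<omega>. \<omega> \<in> space M \<Longrightarrow> \<bar>H u \<omega>\<bar> \<le> K"
    and sd: "\<And>n. simple_data M F (k n) (\<tau> n) (\<xi> n)"
    and lim_H: "\<And>T. 0 \<le> T \<Longrightarrow> (\<lambda>n. \<integral>\<^sup>+\<omega>. (\<integral>\<^sup>+t\<in>{0..T}.
             ennreal ((simple_process (k n) (\<tau> n) (\<xi> n) t \<omega> - H t \<omega>)\<^sup>2) \<partial>lborel) \<partial>M) \<longlonglongrightarrow> 0"
    and lim_I: "\<And>T. 0 \<le> T \<Longrightarrow> (\<lambda>n. \<integral>\<^sup>+\<omega>. ennreal ((simple_integral B' (k n) (\<tau> n) (\<xi> n) T \<omega> - I T \<omega>)\<^sup>2) \<partial>M)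
            \<longlonglongrightarrow> 0"
    and sde: "\<And>s t. 0 \<le> s \<Longrightarrow> s < t \<Longrightarrow>
      AE \<omega> in M. X t \<omega> - X s \<omega> = (LINT u:{s<..t}|lborel. \<beta> u \<omega>) + (I t \<omega> - I s \<omega>)"
    and T: "0 \<le> T"
  shows "expectation (\<lambda>\<omega>. g (X T \<omega>)) - expectation (\<lambda>\<omega>. g (X 0 \<omega>)) =
   (LINT u:{0<..T}|lborel. expectation (\<lambda>\<omega>. \<beta> u \<omega> * g' (X u \<omega>) + (H u \<omega>)\<^sup>2 / 2 * g'' (X u \<omega>)))"
proof -
  let ?SP = "\<lambda>n. simple_process (k n) (\<tau> n) (\<xi> n)" and ?SI = "\<lambda>n. simple_integral B' (k n) (\<tau> n) (\<xi> n)"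
  \<comment> \<open>Only the stochastic integral is exchanged; the drift \<open>\<beta>\<close>
    remains that of \<open>X\<close>, so \<open>U n\<close> need not solve any equation of its
    own.\<close>
  define U where "U n t \<omega> = X t \<omega> - I t \<omega> + ?SI n t \<omega>" for n t \<omega>
  have C: "0 \<le> C" by (rule test_function_nonneg[OF tf])
  have K: "0 \<le> K"
  proof -
    obtain \<omega> where "\<omega> \<in> space M" using not_empty by auto
    from \<beta>(2)[OF this, of 0] show ?thesis by linarith
  qed
  note [measurable] = X(2) I(2) \<beta>(1) H(1) B'(2) test_function_measurable[OF tf]
  have SPm[measurable]: "(\<lambda>(u, \<omega>). ?SP n u \<omega>) \<in> borel_measurable (borel \<Otimes>\<^sub>M M)" for n
    by (rule simple_process_measurable[OF sd])
  have SIm[measurable]: "(\<lambda>(u, \<omega>). ?SI n u \<omega>) \<in> borel_measurable (borel \<Otimes>\<^sub>M M)" for n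
    by (rule simple_integral_measurable[OF sd B'(2)])
  have Um[measurable]: "(\<lambda>(u, \<omega>). U n u \<omega>) \<in> borel_measurable (borel \<Otimes>\<^sub>M M)" for n
    unfolding U_def by measurable
  have sec[measurable]: "X t \<in> borel_measurable M" "I t \<in> borel_measurable M" "U n t \<in> borel_measurable M"
    "H t \<in> borel_measurable M" "\<beta> t \<in> borel_measurable M" "?SI n t \<in> borel_measurable M" "?SP n t \<in> borel_measurable M" for n t
    using measurable_Pair2[OF X(2), of t] measurable_Pair2[OF I(2), of t] measurable_Pair2[OF Um, of t n]
      measurable_Pair2[OF H(1), of t] measurable_Pair2[OF \<beta>(1), of t] measurable_Pair2[OF SIm, of t n]
      measurable_Pair2[OF SPm, of t n] by simp_all
  note tfD = test_function_D[OF tf]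
  \<comment> \<open>\<open>?S\<close> is the integrand that the simple process produces, and
    \<open>?S = ?A + ?R\<close>. In \<open>?A\<close> the coefficient is already \<open>H\<close>
    and only \<open>U n\<close> varies, so it converges at each time; \<open>?R\<close> is the error
    in the squared coefficient and has to be treated on the product space.\<close>
  let ?A = "\<lambda>n u \<omega>. \<beta> u \<omega> * g' (U n u \<omega>) + (H u \<omega>)\<^sup>2 / 2 * g'' (U n u \<omega>)"
  let ?R = "\<lambda>n u \<omega>. ((?SP n u \<omega>)\<^sup>2 - (H u \<omega>)\<^sup>2) / 2 * g'' (U n u \<omega>)"
  let ?S = "\<lambda>n u \<omega>. \<beta> u \<omega> * g' (U n u \<omega>) + (?SP n u \<omega>)\<^sup>2 / 2 * g'' (U n u \<omega>)"
  let ?L = "\<lambda>u \<omega>. \<beta> u \<omega> * g' (X u \<omega>) + (H u \<omega>)\<^sup>2 / 2 * g'' (X u \<omega>)"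
  note bound = generator_le[OF \<beta>(2) H(2)]
  have A_le: "\<bar>?A n u \<omega>\<bar> \<le> (K + K\<^sup>2) * C" and L_le: "\<bar>?L u \<omega>\<bar> \<le> (K + K\<^sup>2) * C"
    if "\<omega> \<in> space M" for n u \<omega>
    by (rule bound[OF that that tfD(4) tfD(5)])+
  \<comment> \<open>This bound depends on \<open>n\<close>, as the simple integrands are not
    uniformly bounded. It gives integrability of each \<open>?R\<close> but cannot dominate the
    limit.\<close>
  have R_le: "\<exists>L. \<forall>u. \<forall>\<omega>\<in>space M. \<bar>?R n u \<omega>\<bar> \<le> L" for n
  proof -
    obtain L where L: "1 \<le> L" "\<And>i \<omega>. i < k n \<Longrightarrow> \<omega> \<in> space M \<Longrightarrow> \<bar>\<xi> n i \<omega>\<bar> \<le> L"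
      using simple_data_bounded[OF sd] by blast
    have "\<bar>?R n u \<omega>\<bar> \<le> (L\<^sup>2 + K\<^sup>2) * C" if \<omega>: "\<omega> \<in> space M" for u \<omega>
    proof -
      have "\<bar>((?SP n u \<omega>)\<^sup>2 - (H u \<omega>)\<^sup>2) / 2\<bar> \<le> L\<^sup>2 + K\<^sup>2"
      proof -
        have "\<bar>?SP n u \<omega>\<bar> \<le> L" by (rule simple_process_bounded[OF sd L \<omega>])
        from half_square_le[OF this] half_square_le[OF H(2)[OF \<omega>, of u]] show ?thesis
          unfolding diff_divide_distrib by (intro order_trans[OF abs_triangle_ineq4] add_mono)
      qed
      then show ?thesis unfolding abs_mult using tfD(5) C by (intro mult_mono) auto
    qed
    then show ?thesis by blast
  qed
  \<comment> \<open>\<open>U n t - X t\<close> is the difference of the simple integral and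
    \<open>I t\<close>, so whatever is bounded by a multiple of it tends to 0 in mean.\<close>
  have SI_L2: "(\<lambda>n. expectation (W n)) \<longlonglongrightarrow> 0"
    if "0 \<le> t" "\<And>n. W n \<in> borel_measurable M" "0 \<le> c"
      "\<And>n \<omega>. \<omega> \<in> space M \<Longrightarrow> \<bar>W n \<omega>\<bar> \<le> c * \<bar>U n t \<omega> - X t \<omega>\<bar>" for t W c
  proof (rule integral_tendsto_0_if_L2[where Z = "\<lambda>n \<omega>. ?SI n t \<omega> - I t \<omega>" and c = c])
    fix n \<omega> assume \<omega>: "\<omega> \<in> space M"
    have "c * \<bar>?SI n t \<omega> - I t \<omega>\<bar> \<le> c * (\<bar>?SI n t \<omega> - I t \<omega>\<bar> + (?SI n t \<omega> - I t \<omega>)\<^sup>2)"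
      using that(3) by (intro mult_left_mono) auto
    with that(4)[OF \<omega>, of n] show "\<bar>W n \<omega>\<bar> \<le> c * (\<bar>?SI n t \<omega> - I t \<omega>\<bar> + (?SI n t \<omega> - I t \<omega>)\<^sup>2)"
      by (simp add: U_def)
  qed (use that lim_I in auto)
  have lim_g: "(\<lambda>n. expectation (\<lambda>\<omega>. g (U n t \<omega>))) \<longlonglongrightarrow> expectation (\<lambda>\<omega>. g (X t \<omega>))" if "0 \<le> t" for t
  proof -
    have "integrable M (\<lambda>\<omega>. g (U n t \<omega>))" "integrable M (\<lambda>\<omega>. g (X t \<omega>))" for n
      using tfD(3) by (auto intro!: integrable_bounded[where K = C])
    then have eq: "expectation (\<lambda>\<omega>. g (U n t \<omega>)) - expectation (\<lambda>\<omega>. g (X t \<omega>)) = expectation (\<lambda>\<omega>. g (U n t \<omega>) - g (X t \<omega>))" for n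
      by simp
    show ?thesis
      unfolding LIM_zero_iff[symmetric, of _ "expectation (\<lambda>\<omega>. g (X t \<omega>))"] eq
      by (rule SI_L2[OF that _ C]) (auto intro: test_function_lipschitz[OF tf])
  qed
  have lim_A: "(\<lambda>n. LINT u:{0<..T}|lborel. expectation (?A n u)) \<longlonglongrightarrow> (LINT u:{0<..T}|lborel. expectation (?L u))"
    unfolding set_lebesgue_integral_def
  proof (rule integral_dominated_convergence[where w = "\<lambda>u. indicator {0<..T} u * ((K + K\<^sup>2) * C)"])
    show "integrable lborel (\<lambda>u. indicator {0<..T} u * ((K + K\<^sup>2) * C))"
      using T by (intro integrable_mult_left integrable_real_indicator) auto
    show "AE u in lborel. (\<lambda>n. indicator {0<..T} u *\<^sub>R expectation (?A n u)) \<longlonglongrightarrow> indicator {0<..T} u *\<^sub>R expectation (?L u)"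
    proof (rule AE_I2)
      fix u
      have "(\<lambda>n. expectation (?A n u)) \<longlonglongrightarrow> expectation (?L u)" if u: "0 < u"
      proof -
        have "integrable M (?A n u)" "integrable M (?L u)" for n
          using A_le L_le by (auto intro!: integrable_bounded[where K = "(K + K\<^sup>2) * C"])
        then have eq: "expectation (?A n u) - expectation (?L u) = expectation (\<lambda>\<omega>. ?A n u \<omega> - ?L u \<omega>)" for n
          by simp
        show ?thesis
          unfolding LIM_zero_iff[symmetric, of _ "expectation (?L u)"] eq
        proof (rule SI_L2[of _ _ "(K + K\<^sup>2) * C"])
          fix n \<omega> assume \<omega>: "\<omega> \<in> space M"
          have "?A n u \<omega> - ?L u \<omega> = \<beta> u \<omega> * (g' (U n u \<omega>) - g' (X u \<omega>)) + (H u \<omega>)\<^sup>2 / 2 * (g'' (U n u \<omega>) - g'' (X u \<omega>))"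
            by (simp add: field_simps)
          also have "\<bar>\<dots>\<bar> \<le> (K + K\<^sup>2) * (C * \<bar>U n u \<omega> - X u \<omega>\<bar>)"
            using tfD(6) test_function_lipschitz(2)[OF tf] by (intro bound[OF \<omega> \<omega>]) auto
          finally show "\<bar>?A n u \<omega> - ?L u \<omega>\<bar> \<le> (K + K\<^sup>2) * C * \<bar>U n u \<omega> - X u \<omega>\<bar>"
            by (simp add: mult.assoc)
        qed (use u K C in auto)
      qed
      then show "(\<lambda>n. indicator {0<..T} u *\<^sub>R expectation (?A n u)) \<longlonglongrightarrow> indicator {0<..T} u *\<^sub>R expectation (?L u)"
        by (auto simp: indicator_def)
    qed
    show "AE u in lborel. norm (indicator {0<..T} u *\<^sub>R expectation (?A n u)) \<le> indicator {0<..T} u * ((K + K\<^sup>2) * C)" for n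
      using abs_expectation_le[OF A_le] by (intro AE_I2) (auto simp: indicator_def)
  qed measurable
  have int_A: "set_integrable lborel {0<..T} (\<lambda>u. expectation (?A n u))" for n
    by (rule Fubini_bounded(1)[OF _ A_le]) measurable
  let ?N = "restrict_space lborel {0<..T} \<Otimes>\<^sub>M M"
  interpret N1: finite_measure "restrict_space lborel {0<..T}"
    using T by (intro finite_measureI) (simp add: space_restrict_space emeasure_restrict_space)
  interpret P: pair_sigma_finite "restrict_space lborel {0<..T}" M ..
  interpret N: finite_measure ?N by (intro finite_measure_pair_measure N1.finite_measure_axioms finite_measure_axioms)
  have N_meas: "f \<in> borel_measurable ?N" if "f \<in> borel_measurable (borel \<Otimes>\<^sub>M M)" for f :: "real \<times> 'a \<Rightarrow> real"
  proof -
    have "(\<lambda>u. u) \<in> restrict_space lborel {0<..T} \<rightarrow>\<^sub>M borel"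
      by (rule measurable_restrict_space1) simp
    then have "(\<lambda>p. (fst p, snd p)) \<in> ?N \<rightarrow>\<^sub>M borel \<Otimes>\<^sub>M M"
      by (intro measurable_Pair measurable_snd measurable_compose[OF measurable_fst])
    from measurable_compose[OF this that] show ?thesis by simp
  qed
  have Rm[measurable]: "(\<lambda>(u, \<omega>). ?R n u \<omega>) \<in> borel_measurable ?N" for n
    by (rule N_meas) measurable
  have Zm[measurable]: "(\<lambda>(u, \<omega>). ?SP n u \<omega> - H u \<omega>) \<in> borel_measurable ?N" for n
    by (rule N_meas) measurable
  have lim_R: "(\<lambda>n. \<integral>p. (case p of (u, \<omega>) \<Rightarrow> ?R n u \<omega>) \<partial>?N) \<longlonglongrightarrow> 0"
  proof (rule N.integral_tendsto_0_if_L2[where Z = "\<lambda>n. \<lambda>(u, \<omega>). ?SP n u \<omega> - H u \<omega>" and c = "C * (1 + K)"])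
    show "(\<lambda>n. \<integral>\<^sup>+p. ennreal ((case p of (u, \<omega>) \<Rightarrow> ?SP n u \<omega> - H u \<omega>)\<^sup>2) \<partial>?N) \<longlonglongrightarrow> 0"
    proof (rule tendsto_sandwich[OF _ _ tendsto_const lim_H[OF T]])
      show "\<forall>\<^sub>F n in sequentially. (\<integral>\<^sup>+p. ennreal ((case p of (u, \<omega>) \<Rightarrow> ?SP n u \<omega> - H u \<omega>)\<^sup>2) \<partial>?N)
        \<le> (\<integral>\<^sup>+\<omega>. (\<integral>\<^sup>+t\<in>{0..T}. ennreal ((?SP n t \<omega> - H t \<omega>)\<^sup>2) \<partial>lborel) \<partial>M)"
      proof (rule always_eventually, rule allI)
        fix n
        have "(\<integral>\<^sup>+p. ennreal ((case p of (u, \<omega>) \<Rightarrow> ?SP n u \<omega> - H u \<omega>)\<^sup>2) \<partial>?N) =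
          (\<integral>\<^sup>+\<omega>. (\<integral>\<^sup>+u. ennreal ((?SP n u \<omega> - H u \<omega>)\<^sup>2) \<partial>restrict_space lborel {0<..T}) \<partial>M)"
          by (subst P.nn_integral_snd[symmetric]) auto
        also have "\<dots> \<le> (\<integral>\<^sup>+\<omega>. (\<integral>\<^sup>+t\<in>{0..T}. ennreal ((?SP n t \<omega> - H t \<omega>)\<^sup>2) \<partial>lborel) \<partial>M)"
          by (intro nn_integral_mono, subst nn_integral_restrict_space)
            (auto intro!: nn_integral_mono split: split_indicator)
        finally show "(\<integral>\<^sup>+p. ennreal ((case p of (u, \<omega>) \<Rightarrow> ?SP n u \<omega> - H u \<omega>)\<^sup>2) \<partial>?N)
          \<le> (\<integral>\<^sup>+\<omega>. (\<integral>\<^sup>+t\<in>{0..T}. ennreal ((?SP n t \<omega> - H t \<omega>)\<^sup>2) \<partial>lborel) \<partial>M)" .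
      qed
    qed simp
    fix n p assume "p \<in> space ?N"
    then obtain u \<omega> where p: "p = (u, \<omega>)" and \<omega>: "\<omega> \<in> space M" by (auto simp: space_pair_measure)
    define z h where "z = ?SP n u \<omega> - H u \<omega>" and "h = H u \<omega>"
    have h: "\<bar>h\<bar> \<le> K" using H(2)[OF \<omega>] by (simp add: h_def)
    \<comment> \<open>Writing the simple value as h + z gives (h + z)^2 - h^2 = z^2 + 2 h z. Only
      the limit coefficient \<open>h\<close> is uniformly bounded, hence the expansion around it and
      the term quadratic in the error.\<close>
    have "((?SP n u \<omega>)\<^sup>2 - (H u \<omega>)\<^sup>2) / 2 = z\<^sup>2 / 2 + h * z"
      by (simp add: z_def h_def power2_eq_square field_simps)
    then have "\<bar>((?SP n u \<omega>)\<^sup>2 - (H u \<omega>)\<^sup>2) / 2\<bar> \<le> z\<^sup>2 / 2 + \<bar>h\<bar> * \<bar>z\<bar>"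
      using abs_triangle_ineq[of "z\<^sup>2 / 2" "h * z"] by (simp add: abs_mult)
    also have "\<dots> \<le> z\<^sup>2 + K * \<bar>z\<bar>"
      using h by (intro add_mono mult_right_mono) auto
    also have "\<dots> \<le> \<bar>z\<bar> + z\<^sup>2 + K * \<bar>z\<bar> + K * z\<^sup>2" using K by simp
    finally have "\<bar>((?SP n u \<omega>)\<^sup>2 - (H u \<omega>)\<^sup>2) / 2\<bar> \<le> \<bar>z\<bar> + z\<^sup>2 + K * \<bar>z\<bar> + K * z\<^sup>2" .
    then have "\<bar>?R n u \<omega>\<bar> \<le> (\<bar>z\<bar> + z\<^sup>2 + K * \<bar>z\<bar> + K * z\<^sup>2) * C"
      unfolding abs_mult[of _ "g'' (U n u \<omega>)"] using tfD(5) C K by (intro mult_mono) auto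
    then show "\<bar>case p of (u, \<omega>) \<Rightarrow> ?R n u \<omega>\<bar> \<le> C * (1 + K) *
        (\<bar>case p of (u, \<omega>) \<Rightarrow> ?SP n u \<omega> - H u \<omega>\<bar> + (case p of (u, \<omega>) \<Rightarrow> ?SP n u \<omega> - H u \<omega>)\<^sup>2)"
      unfolding p prod.case z_def[symmetric] by (simp add: algebra_simps)
  next
    show "0 \<le> C * (1 + K)" using K C by simp
  qed (rule Zm Rm)+
  have int_R: "set_integrable lborel {0<..T} (\<lambda>u. expectation (?R n u))"
    and R_eq: "(\<integral>p. (case p of (u, \<omega>) \<Rightarrow> ?R n u \<omega>) \<partial>?N) = (LINT u:{0<..T}|lborel. expectation (?R n u))"
    and R_int: "integrable M (?R n u)" for n u
  proof -
    obtain L where L: "\<bar>?R n u \<omega>\<bar> \<le> L" if "\<omega> \<in> space M" for u \<omega> using R_le by blast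
    show "integrable M (?R n u)"
      by (rule integrable_bounded[OF _ L]) measurable
    show "set_integrable lborel {0<..T} (\<lambda>u. expectation (?R n u))"
      by (rule Fubini_bounded(1)[OF _ L]) measurable
    have "integrable ?N (\<lambda>(u, \<omega>). ?R n u \<omega>)"
      by (rule N.integrable_const_bound[where B = L, OF _ Rm], rule AE_I2)
        (use L in \<open>auto simp: space_pair_measure\<close>)
    from P.integral_fst'[OF this] show "(\<integral>p. (case p of (u, \<omega>) \<Rightarrow> ?R n u \<omega>) \<partial>?N) = (LINT u:{0<..T}|lborel. expectation (?R n u))"
      unfolding set_lebesgue_integral_def by (simp add: integral_restrict_space)
  qed
  have eq: "expectation (\<lambda>\<omega>. g (U n T \<omega>)) - expectation (\<lambda>\<omega>. g (U n 0 \<omega>)) =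
      (LINT u:{0<..T}|lborel. expectation (?A n u)) + (\<integral>p. (case p of (u, \<omega>) \<Rightarrow> ?R n u \<omega>) \<partial>?N)" for n
  proof -
    have "expectation (\<lambda>\<omega>. g (U n T \<omega>)) - expectation (\<lambda>\<omega>. g (U n 0 \<omega>)) =
      (LINT u:{0<..T}|lborel. expectation (?S n u))"
    proof (rule ito_simple[OF bm tf sd Um \<beta>(1,2) _ _ T])
      show "U n t \<in> borel_measurable (F t)" if "0 \<le> t" for t
        using X(1)[OF that] I(1)[OF that] simple_integral_adapted[OF sd B'(1) that, of n]
        unfolding U_def[abs_def] by measurable
      fix s t :: real assume st: "0 \<le> s" "s < t"
      \<comment> \<open>\<open>ito_simple\<close> integrates against the given \<open>B\<close>,
        whereas joint measurability is available for \<open>B'\<close>; their simple integrals agree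
        almost surely at nonnegative times.\<close>
      show "AE \<omega> in M. U n t \<omega> = U n s \<omega> + (LINT u:{s<..t}|lborel. \<beta> u \<omega>) +
        (simple_integral B (k n) (\<tau> n) (\<xi> n) t \<omega> - simple_integral B (k n) (\<tau> n) (\<xi> n) s \<omega>)"
        using sde[OF st] B'(3)
      proof eventually_elim
        case (elim \<omega>)
        have "?SI n v \<omega> = simple_integral B (k n) (\<tau> n) (\<xi> n) v \<omega>" if "0 \<le> v" for v
          unfolding simple_integral_def
          using elim(2) that simple_data_nonneg[OF sd, of _ n] by (intro sum.cong) auto
        with elim(1) st show ?case by (simp add: U_def)
      qed
    qed
    also have "\<dots> = (LINT u:{0<..T}|lborel. expectation (?A n u) + expectation (?R n u))"
    proof (rule set_lebesgue_integral_cong)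
      show "\<forall>u. u \<in> {0<..T} \<longrightarrow> expectation (?S n u)
        = expectation (?A n u) + expectation (?R n u)"
      proof (intro allI impI)
        fix u
        have "integrable M (?A n u)"
          using A_le by (auto intro!: integrable_bounded[where K = "(K + K\<^sup>2) * C"])
        moreover have "?S n u = (\<lambda>\<omega>. ?A n u \<omega> + ?R n u \<omega>)"
          by (intro ext) (simp add: field_simps)
        ultimately show "expectation (?S n u)
          = expectation (?A n u) + expectation (?R n u)"
          using R_int by (simp only: Bochner_Integration.integral_add)
      qed
    qed simp
    also have "\<dots> = (LINT u:{0<..T}|lborel. expectation (?A n u)) + (\<integral>p. (case p of (u, \<omega>) \<Rightarrow> ?R n u \<omega>) \<partial>?N)"
      unfolding R_eq using int_A int_R by (rule set_integral_add)
    finally show ?thesis .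
  qed
  have "(\<lambda>n. expectation (\<lambda>\<omega>. g (U n T \<omega>)) - expectation (\<lambda>\<omega>. g (U n 0 \<omega>))) \<longlonglongrightarrow>
      expectation (\<lambda>\<omega>. g (X T \<omega>)) - expectation (\<lambda>\<omega>. g (X 0 \<omega>))"
    using lim_g T by (intro tendsto_diff) auto
  moreover have "(\<lambda>n. expectation (\<lambda>\<omega>. g (U n T \<omega>)) - expectation (\<lambda>\<omega>. g (U n 0 \<omega>))) \<longlonglongrightarrow>
      (LINT u:{0<..T}|lborel. expectation (?L u)) + 0"
    unfolding eq by (intro tendsto_add lim_A lim_R)
  ultimately show ?thesis using LIMSEQ_unique by simp
qed

end

section \<open>Law at an independent exponential time\<close>

text \<open>Preimages under the two functions differ within a null set, and completeness makes such
  a set measurable.\<close>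

lemma (in complete_measure) borel_measurable_cong_AE:
  fixes f h :: "'a \<Rightarrow> real"
  assumes f: "f \<in> borel_measurable M" and ae: "AE \<omega> in M. f \<omega> = h \<omega>"
  shows "h \<in> borel_measurable M"
proof (rule measurableI)
  fix A :: "real set" assume A: "A \<in> sets borel"
  show "h -` A \<inter> space M \<in> sets M"
  proof (rule in_sets_AE)
    show "AE \<omega> in M. (\<omega> \<in> f -` A \<inter> space M) = (\<omega> \<in> h -` A \<inter> space M)"
      using ae by eventually_elim auto
    show "f -` A \<inter> space M \<in> sets M" using f A by (rule measurable_sets)
  qed simp
qed simp

lemma (in prob_space) exponential_AE_nonneg:
  assumes e: "distributed M lborel e (exponential_density q)"
  shows "AE \<omega> in M. 0 \<le> e \<omega>"
proof -
  have "AE t in lborel. 0 < ennreal (exponential_density q t) \<longrightarrow> 0 \<le> t"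
    by (intro AE_I2) (auto simp: exponential_density_def)
  with distributed_AE2[OF e, of "\<lambda>t. 0 \<le> t"] show ?thesis by simp
qed

text \<open>Exchanging the integrals leaves the tail probability exp(-q u) as the weight of
  \<open>\<psi> u\<close>, and for the exponential law this tail is the density divided by
  \<open>q\<close>.\<close>

lemma (in prob_space) exponential_discount:
  assumes e: "distributed M lborel e (exponential_density q)" and q: "0 < q"
    and \<psi>[measurable]: "\<psi> \<in> borel_measurable borel" and \<psi>_le: "\<And>u. \<bar>\<psi> u\<bar> \<le> K"
  shows "integrable lborel (\<lambda>t. exponential_density q t * (LINT u:{0<..t}|lborel. \<psi> u))"
    and "(\<integral>t. exponential_density q t * (LINT u:{0<..t}|lborel. \<psi> u) \<partial>lborel) =
      (\<integral>t. exponential_density q t * \<psi> t \<partial>lborel) / q"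
proof -
  let ?p = "exponential_density q"
  have p0: "0 \<le> ?p t" for t using q by (auto simp: exponential_density_def)
  have p: "integrable lborel ?p"
    using distributed_integrable[OF e, of "\<lambda>_. 1"] p0 by simp
  have tail: "(\<integral>t. ?p t * indicator {u..} t \<partial>lborel) = exp (- u * q)" if u: "0 < u" for u
  proof -
    \<comment> \<open>Membership of \<open>u\<close> in \<open>{0<..t}\<close> gives the closed
      half-line, the survival probability the open one; they differ by a null set.\<close>
    have "(\<integral>t. ?p t * indicator {u..} t \<partial>lborel) = (\<integral>t. ?p t * indicator {u<..} t \<partial>lborel)"
    proof (rule integral_cong_AE)
      show "AE t in lborel. ?p t * indicator {u..} t = ?p t * indicator {u<..} t"
        using AE_lborel_singleton[of u] by eventually_elim (auto simp: indicator_def)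
    qed measurable
    also have "\<dots> = expectation (\<lambda>\<omega>. indicator {u<..} (e \<omega>))"
      using p0 by (intro distributed_integral[OF e]) auto
    also have "\<dots> = expectation (indicator {\<omega> \<in> space M. u < e \<omega>})"
      by (intro Bochner_Integration.integral_cong) (auto simp: indicator_def)
    also have "\<dots> = prob {\<omega> \<in> space M. u < e \<omega>}"
      using distributed_measurable[OF e] by simp
    also have "\<dots> = exp (- u * q)" using exponential_distributedD_gt[OF e _ q, of u] u by simp
    finally show ?thesis .
  qed
  let ?f = "\<lambda>(u, t). indicator {0<..} u * \<psi> u * (?p t * indicator {u..} t)"
  \<comment> \<open>Rewritten as an indicator evaluated at the difference of the coordinates, which
    makes joint measurability visible.\<close>
  have ind: "(\<lambda>(u :: real, t :: real). indicator {u..} t :: real) \<in> borel_measurable (lborel \<Otimes>\<^sub>M lborel)"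
  proof -
    have "(\<lambda>(u :: real, t :: real). indicator {u..} t :: real) = (\<lambda>p. indicator {0..} (snd p - fst p :: real))"
      by (auto simp: indicator_def fun_eq_iff)
    then show ?thesis by (simp only:) measurable
  qed
  note [measurable] = this
  have I: "integrable (lborel \<Otimes>\<^sub>M lborel) ?f"
  proof (rule lborel_pair.Fubini_integrable)
    show "integrable lborel (\<lambda>u. \<integral>t. norm (?f (u, t)) \<partial>lborel)"
    proof (rule Bochner_Integration.integrable_bound[where f = "\<lambda>u. K * (?p u / q)"])
      show "integrable lborel (\<lambda>u. K * (?p u / q))" using p by simp
      show "(\<lambda>u. \<integral>t. norm (?f (u, t)) \<partial>lborel) \<in> borel_measurable lborel" by measurable
      show "AE u in lborel. norm (\<integral>t. norm (?f (u, t)) \<partial>lborel) \<le> norm (K * (?p u / q))"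
      proof (rule AE_I2)
        fix u
        have K0: "0 \<le> K" using \<psi>_le[of 0] by linarith
        show "norm (\<integral>t. norm (?f (u, t)) \<partial>lborel) \<le> norm (K * (?p u / q))"
        proof (cases "0 < u")
          case True
          have "(\<integral>t. norm (?f (u, t)) \<partial>lborel) = (\<integral>t. \<bar>\<psi> u\<bar> * (?p t * indicator {u..} t) \<partial>lborel)"
            using True p0 by (intro Bochner_Integration.integral_cong) (auto simp: abs_mult)
          also have "\<dots> = \<bar>\<psi> u\<bar> * exp (- u * q)" using tail[OF True] by simp
          finally have "norm (\<integral>t. norm (?f (u, t)) \<partial>lborel) = \<bar>\<psi> u\<bar> * exp (- u * q)" by simp
          also have "\<dots> \<le> K * exp (- u * q)" using \<psi>_le by (intro mult_right_mono) auto
          also have "\<dots> = norm (K * (?p u / q))"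
            using True q K0 by (simp add: exponential_density_def abs_mult)
          finally show ?thesis .
        qed simp
      qed
    qed
    show "AE u in lborel. integrable lborel (\<lambda>t. ?f (u, t))"
    proof (rule AE_I2)
      fix u
      have "integrable lborel (\<lambda>t. ?p t * indicator {u..} t)"
        by (rule Bochner_Integration.integrable_bound[OF p]) (use p0 in \<open>auto simp: indicator_def\<close>)
      then show "integrable lborel (\<lambda>t. ?f (u, t))" by simp
    qed
  qed measurable
  have inner: "(\<integral>u. ?f (u, t) \<partial>lborel) = ?p t * (LINT u:{0<..t}|lborel. \<psi> u)" for t
  proof -
    have "(\<integral>u. ?f (u, t) \<partial>lborel) = (\<integral>u. ?p t * (indicator {0<..t} u *\<^sub>R \<psi> u) \<partial>lborel)"
      by (intro Bochner_Integration.integral_cong) (auto simp: indicator_def)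
    then show ?thesis unfolding set_lebesgue_integral_def by simp
  qed
  show "integrable lborel (\<lambda>t. ?p t * (LINT u:{0<..t}|lborel. \<psi> u))"
    using lborel_pair.integrable_snd[OF I] unfolding inner[symmetric] by simp
  have "(\<integral>t. ?p t * (LINT u:{0<..t}|lborel. \<psi> u) \<partial>lborel) = (\<integral>u. (\<integral>t. ?f (u, t) \<partial>lborel) \<partial>lborel)"
    unfolding inner[symmetric] using lborel_pair.Fubini_integral[OF I] by simp
  also have "\<dots> = (\<integral>u. ?p u * \<psi> u / q \<partial>lborel)"
  proof (rule integral_cong_AE)
    show "AE u in lborel. (\<integral>t. ?f (u, t) \<partial>lborel) = ?p u * \<psi> u / q"
      using AE_lborel_singleton[of 0]
    proof eventually_elim
      case (elim u)
      then show ?case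
        using tail[of u] q by (cases "0 < u") (auto simp: exponential_density_def)
    qed
  qed measurable
  finally show "(\<integral>t. ?p t * (LINT u:{0<..t}|lborel. \<psi> u) \<partial>lborel) = (\<integral>t. ?p t * \<psi> t \<partial>lborel) / q"
    by simp
qed

text \<open>\<open>G\<close> is the sigma-algebra generated by the path at nonnegative times.
  Regarding the identity as a map into \<open>G\<close> lets independence be used for any functional
  of time and path that is measurable for \<open>G\<close>. Rectangles determine the product
  measure.\<close>

lemma (in prob_space) joint_law_process_time:
  fixes X :: "real \<Rightarrow> 'a \<Rightarrow> real"
  assumes e: "e \<in> borel_measurable M" and ind: "indep_of_process M e X"
  defines "G \<equiv> vimage_algebra (space M) (\<lambda>\<omega>. \<lambda>t\<in>{0..}. X t \<omega>) (Pi\<^sub>M {0..} (\<lambda>_. borel))"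
  shows "(\<lambda>\<omega>. \<omega>) \<in> M \<rightarrow>\<^sub>M G"
    and "distr M borel e \<Otimes>\<^sub>M distr M G (\<lambda>\<omega>. \<omega>) = distr M (borel \<Otimes>\<^sub>M G) (\<lambda>\<omega>. (e \<omega>, \<omega>))"
proof -
  have G: "space G = space M" by (simp add: G_def)
  have i: "indep_set (sets (vimage_algebra (space M) e borel)) (sets G)"
    using ind unfolding indep_of_process_def G_def .
  have GM: "sets G \<subseteq> events" by (rule indep_setD_ev2[OF i])
  have id_vimage: "(\<lambda>\<omega>. \<omega>) -` A \<inter> space M = A" if "A \<in> sets G" for A
    using sets.sets_into_space[OF that] G by auto
  show id: "(\<lambda>\<omega>. \<omega>) \<in> M \<rightarrow>\<^sub>M G"
    using GM G id_vimage by (intro measurableI) auto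
  have eid: "(\<lambda>\<omega>. (e \<omega>, \<omega>)) \<in> M \<rightarrow>\<^sub>M borel \<Otimes>\<^sub>M G"
    using e id by (rule measurable_Pair)
  interpret E: prob_space "distr M borel e" using e by (rule prob_space_distr)
  interpret G: prob_space "distr M G (\<lambda>\<omega>. \<omega>)" using id by (rule prob_space_distr)
  show "distr M borel e \<Otimes>\<^sub>M distr M G (\<lambda>\<omega>. \<omega>) = distr M (borel \<Otimes>\<^sub>M G) (\<lambda>\<omega>. (e \<omega>, \<omega>))"
  proof (rule pair_measure_eqI)
    show "sigma_finite_measure (distr M borel e)" "sigma_finite_measure (distr M G (\<lambda>\<omega>. \<omega>))"
      by unfold_locales
    show "sets (distr M borel e \<Otimes>\<^sub>M distr M G (\<lambda>\<omega>. \<omega>)) = sets (distr M (borel \<Otimes>\<^sub>M G) (\<lambda>\<omega>. (e \<omega>, \<omega>)))"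
      by (simp cong: sets_pair_measure_cong)
    fix A B assume "A \<in> sets (distr M borel e)" "B \<in> sets (distr M G (\<lambda>\<omega>. \<omega>))"
    then have A: "A \<in> sets borel" and B: "B \<in> sets G" by auto
    have "e -` A \<inter> space M \<in> sets (vimage_algebra (space M) e borel)"
      using A by (rule in_vimage_algebra)
    from indep_setD[OF i this B] have "emeasure M (e -` A \<inter> space M \<inter> B) = emeasure M (e -` A \<inter> space M) * emeasure M B"
      by (simp add: emeasure_eq_measure ennreal_mult)
    moreover have "(\<lambda>\<omega>. (e \<omega>, \<omega>)) -` (A \<times> B) \<inter> space M = e -` A \<inter> space M \<inter> B"
      using sets.sets_into_space[OF B] G by auto
    ultimately show "emeasure (distr M borel e) A * emeasure (distr M G (\<lambda>\<omega>. \<omega>)) B =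
        emeasure (distr M (borel \<Otimes>\<^sub>M G) (\<lambda>\<omega>. (e \<omega>, \<omega>))) (A \<times> B)"
      using A B e id eid sets.sets_into_space[OF B] G by (simp add: emeasure_distr Int_absorb2)
  qed
qed

text \<open>The version \<open>X'\<close> is jointly measurable for \<open>M\<close>, but perhaps
  not for the sigma-algebra generated by \<open>X\<close>, so independence cannot be applied to it.
  Fubini is therefore used for a third version \<open>Z\<close>, built from \<open>X\<close> alone,
  and \<open>X'\<close> enters only through its laws at fixed times.\<close>

lemma (in prob_space) law_at_exponential_time:
  fixes X X' :: "real \<Rightarrow> 'a \<Rightarrow> real" and f :: "real \<Rightarrow> real"
  assumes complete: "complete_measure M"
    and e: "distributed M lborel e (exponential_density q)" and q: "0 < q"
    and ind: "indep_of_process M e X"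
    and cont: "AE \<omega> in M. continuous_on {0..} (\<lambda>t. X t \<omega>)"
    and X'[measurable]: "(\<lambda>(t, \<omega>). X' t \<omega>) \<in> borel_measurable (borel \<Otimes>\<^sub>M M)"
    and X'_eq: "AE \<omega> in M. \<forall>t\<ge>0. X' t \<omega> = X t \<omega>"
    and f[measurable]: "f \<in> borel_measurable borel" and f_le: "\<And>y. \<bar>f y\<bar> \<le> K"
  shows "(\<lambda>\<omega>. X (e \<omega>) \<omega>) \<in> borel_measurable M"
    and "expectation (\<lambda>\<omega>. f (X (e \<omega>) \<omega>)) = (\<integral>t. exponential_density q t * expectation (\<lambda>\<omega>. f (X' t \<omega>)) \<partial>lborel)"
proof -
  interpret complete_measure M by fact
  define G where "G = vimage_algebra (space M) (\<lambda>\<omega>. \<lambda>t\<in>{0..}. X t \<omega>) (Pi\<^sub>M {0..} (\<lambda>_. borel :: real measure))"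
  have em[measurable]: "e \<in> borel_measurable M" using distributed_measurable[OF e] by simp
  note id[measurable] = joint_law_process_time(1)[OF em ind, folded G_def]
    and prod = joint_law_process_time(2)[OF em ind, folded G_def]
  have XG: "X t \<in> borel_measurable G" if t: "0 \<le> t" for t
  proof -
    have "(\<lambda>\<omega>. \<lambda>t\<in>{0..}. X t \<omega>) \<in> G \<rightarrow>\<^sub>M Pi\<^sub>M {0..} (\<lambda>_. borel)"
      unfolding G_def by (rule measurable_vimage_algebra1) (auto simp: space_PiM)
    from measurable_compose[OF this measurable_component_singleton[of t]] t show ?thesis by simp
  qed
  \<comment> \<open>\<open>lim\<close> is total, so measurability does not depend on convergence; on
    continuous paths the limit is \<open>X\<close>. \<open>max 0\<close> keeps the sample times in
    the range that generates \<open>G\<close>.\<close>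
  define Z where "Z = (\<lambda>(t, \<omega>). lim (\<lambda>n. X (max 0 (grid_floor n t)) \<omega>))"
  have Z[measurable]: "Z \<in> borel_measurable (borel \<Otimes>\<^sub>M G)"
  proof -
    have "(\<lambda>(t, \<omega>). X (max 0 (grid_floor n t)) \<omega>) \<in> borel_measurable (borel \<Otimes>\<^sub>M G)" for n
      by (rule measurable_grid_process[of "\<lambda>t. X (max 0 t)"]) (rule XG, simp)
    then have "(\<lambda>p. lim (\<lambda>n. (\<lambda>(t, \<omega>). X (max 0 (grid_floor n t)) \<omega>) p)) \<in> borel_measurable (borel \<Otimes>\<^sub>M G)"
      by (rule borel_measurable_lim_metric)
    then show ?thesis by (simp add: Z_def case_prod_beta)
  qed
  have Z_eq: "AE \<omega> in M. \<forall>t\<ge>0. Z (t, \<omega>) = X t \<omega>"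
    using cont
  proof eventually_elim
    case (elim \<omega>)
    show ?case
    proof (intro allI impI)
      fix t :: real assume t: "0 \<le> t"
      have "(\<lambda>n. max 0 (grid_floor n t)) \<longlonglongrightarrow> max 0 t"
        by (intro tendsto_max tendsto_const grid_floor_tendsto)
      then have "(\<lambda>n. X (max 0 (grid_floor n t)) \<omega>) \<longlonglongrightarrow> X (max 0 t) \<omega>"
        by (rule continuous_on_tendsto_compose[OF elim]) (use t in auto)
      then show "Z (t, \<omega>) = X t \<omega>" using t by (simp add: Z_def limI)
    qed
  qed
  have eZ[measurable]: "(\<lambda>\<omega>. Z (e \<omega>, \<omega>)) \<in> borel_measurable M"
    using measurable_compose[OF measurable_Pair[OF em id] Z] .
  have Y: "AE \<omega> in M. Z (e \<omega>, \<omega>) = X (e \<omega>) \<omega>"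
    using Z_eq exponential_AE_nonneg[OF e] by eventually_elim auto
  show meas[measurable]: "(\<lambda>\<omega>. X (e \<omega>) \<omega>) \<in> borel_measurable M"
    by (rule borel_measurable_cong_AE[OF eZ Y])
  let ?G = "distr M G (\<lambda>\<omega>. \<omega>)" and ?E = "distr M borel e"
  interpret E: prob_space ?E by (rule prob_space_distr) simp
  interpret G: prob_space ?G by (rule prob_space_distr) simp
  interpret P: pair_prob_space ?E ?G ..
  have fZ[measurable]: "(\<lambda>p. f (Z p)) \<in> borel_measurable (borel \<Otimes>\<^sub>M G)" by measurable
  have fZ_G: "(\<integral>\<omega>. f (Z (t, \<omega>)) \<partial>?G) = expectation (\<lambda>\<omega>. f (Z (t, \<omega>)))" for t
  proof -
    have "(\<lambda>\<omega>. f (Z (t, \<omega>))) \<in> borel_measurable G"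
      using measurable_Pair2[OF fZ, of t] by simp
    then show ?thesis by (rule integral_distr[OF id])
  qed
  have "expectation (\<lambda>\<omega>. f (X (e \<omega>) \<omega>)) = expectation (\<lambda>\<omega>. f (Z (e \<omega>, \<omega>)))"
    by (rule integral_cong_AE) (use Y in \<open>auto elim: eventually_mono\<close>)
  also have "\<dots> = (\<integral>p. f (Z p) \<partial>(?E \<Otimes>\<^sub>M ?G))"
    unfolding prod by (rule integral_distr[symmetric]) measurable
  also have "\<dots> = (\<integral>t. (\<integral>\<omega>. f (Z (t, \<omega>)) \<partial>?G) \<partial>?E)"
  proof (rule P.integral_fst'[symmetric])
    show "integrable (?E \<Otimes>\<^sub>M ?G) (\<lambda>p. f (Z p))"
    proof (rule P.P.integrable_const_bound[where B = K])
      show "(\<lambda>p. f (Z p)) \<in> borel_measurable (?E \<Otimes>\<^sub>M ?G)"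
        using fZ by (simp cong: measurable_cong_sets sets_pair_measure_cong)
    qed (use f_le in auto)
  qed
  also have "\<dots> = (\<integral>t. expectation (\<lambda>\<omega>. f (Z (t, \<omega>))) \<partial>?E)"
    unfolding fZ_G ..
  also have "\<dots> = (\<integral>t. exponential_density q t * expectation (\<lambda>\<omega>. f (Z (t, \<omega>))) \<partial>lborel)"
  proof -
    have "(\<lambda>(t, \<omega>). f (Z (t, \<omega>))) \<in> borel_measurable (borel \<Otimes>\<^sub>M ?G)"
      using fZ by (simp cong: measurable_cong_sets sets_pair_measure_cong)
    then have "(\<lambda>t. \<integral>\<omega>. f (Z (t, \<omega>)) \<partial>?G) \<in> borel_measurable borel"
      by (rule G.borel_measurable_lebesgue_integral)
    then have h: "(\<lambda>t. expectation (\<lambda>\<omega>. f (Z (t, \<omega>)))) \<in> borel_measurable borel"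
      unfolding fZ_G .
    have "(\<integral>t. expectation (\<lambda>\<omega>. f (Z (t, \<omega>))) \<partial>?E) = expectation (\<lambda>\<omega>'. expectation (\<lambda>\<omega>. f (Z (e \<omega>', \<omega>))))"
      by (rule integral_distr[OF em h])
    also have "\<dots> = (\<integral>t. exponential_density q t * expectation (\<lambda>\<omega>. f (Z (t, \<omega>))) \<partial>lborel)"
      using q h by (intro distributed_integral[OF e, symmetric]) (auto simp: exponential_density_def)
    finally show ?thesis .
  qed
  also have "\<dots> = (\<integral>t. exponential_density q t * expectation (\<lambda>\<omega>. f (X' t \<omega>)) \<partial>lborel)"
  proof (rule Bochner_Integration.integral_cong[OF refl])
    fix t
    have "expectation (\<lambda>\<omega>. f (Z (t, \<omega>))) = expectation (\<lambda>\<omega>. f (X' t \<omega>))" if "0 \<le> t"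
    proof (rule integral_cong_AE)
      show "AE \<omega> in M. f (Z (t, \<omega>)) = f (X' t \<omega>)"
        using Z_eq X'_eq by eventually_elim (use that in auto)
      show "(\<lambda>\<omega>. f (Z (t, \<omega>))) \<in> borel_measurable M" 
        using measurable_compose[OF measurable_Pair[OF measurable_const id] fZ] by simp
      show "(\<lambda>\<omega>. f (X' t \<omega>)) \<in> borel_measurable M"
        using measurable_compose[OF measurable_Pair2[OF X', of t] f] by simp
    qed
    then show "exponential_density q t * expectation (\<lambda>\<omega>. f (Z (t, \<omega>))) = exponential_density q t * expectation (\<lambda>\<omega>. f (X' t \<omega>))"
      by (cases "0 \<le> t") (auto simp: exponential_density_def)
  qed
  finally show "expectation (\<lambda>\<omega>. f (X (e \<omega>) \<omega>)) = (\<integral>t. exponential_density q t * expectation (\<lambda>\<omega>. f (X' t \<omega>)) \<partial>lborel)" .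
qed

section \<open>Resolvent equation\<close>

text \<open>The path is set to 0 off \<open>A\<close> and held constant before time 0. With
  \<open>A\<close> the complement of an exceptional null set, every path is continuous on the whole
  line, as \<open>measurable_continuous_process\<close> demands.\<close>

definition regular_version :: "'a set \<Rightarrow> (real \<Rightarrow> 'a \<Rightarrow> real) \<Rightarrow> real \<Rightarrow> 'a \<Rightarrow> real" where
  "regular_version A Y t \<omega> = indicator A \<omega> * Y (max 0 t) \<omega>"

context usual_filtered_prob_space
begin

text \<open>Adaptedness survives the change because \<open>N\<close>, being null, belongs to every
  \<open>F t\<close> with \<open>t \<ge> 0\<close>.\<close>

lemma regular_version:
  assumes N: "N \<in> null_sets M" and Y: "adapted F Y"
    and cont: "\<forall>\<omega>\<in>space M - N. continuous_on {0..} (\<lambda>t. Y t \<omega>)"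
  shows "0 \<le> t \<Longrightarrow> regular_version (space M - N) Y t \<in> borel_measurable (F t)"
    and "(\<lambda>(t, \<omega>). regular_version (space M - N) Y t \<omega>) \<in> borel_measurable (borel \<Otimes>\<^sub>M M)"
    and "AE \<omega> in M. \<forall>t\<ge>0. regular_version (space M - N) Y t \<omega> = Y t \<omega>"
proof -
  have F: "regular_version (space M - N) Y t \<in> borel_measurable (F (max 0 t))" for t
  proof -
    have t: "0 \<le> max 0 t" by simp
    have [measurable]: "Y (max 0 t) \<in> borel_measurable (F (max 0 t))"
      using Y t unfolding adapted_def by blast
    have "N \<in> sets (F (max 0 t))" using N null_sets_F[OF t] by blast
    then have [measurable]: "space M - N \<in> sets (F (max 0 t))"
      using sub[OF t] sets.compl_sets[of N "F (max 0 t)"] unfolding subalgebra_def by simp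
    show ?thesis unfolding regular_version_def[abs_def] by measurable
  qed
  show "0 \<le> t \<Longrightarrow> regular_version (space M - N) Y t \<in> borel_measurable (F t)"
    using F[of t] by simp
  show "(\<lambda>(t, \<omega>). regular_version (space M - N) Y t \<omega>) \<in> borel_measurable (borel \<Otimes>\<^sub>M M)"
  proof (rule measurable_continuous_process)
    show "regular_version (space M - N) Y t \<in> borel_measurable M" for t
      by (rule measurable_from_subalg[OF sub F]) simp
    fix \<omega> assume \<omega>: "\<omega> \<in> space M"
    show "continuous_on UNIV (\<lambda>t. regular_version (space M - N) Y t \<omega>)"
    proof (cases "\<omega> \<in> N")
      case False
      have "continuous_on UNIV (\<lambda>t. Y (max 0 t) \<omega>)"
        by (rule continuous_on_compose2[OF cont[rule_format]]) (use \<omega> False in \<open>auto intro!: continuous_intros\<close>)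
      with \<omega> False show ?thesis by (simp add: regular_version_def)
    qed (simp add: regular_version_def)
  qed
  have "AE \<omega> in M. \<omega> \<in> space M - N" using AE_not_in[OF N] by auto
  then show "AE \<omega> in M. \<forall>t\<ge>0. regular_version (space M - N) Y t \<omega> = Y t \<omega>"
    by eventually_elim (auto simp: regular_version_def)
qed

text \<open>The generators of the augmented filtration at time \<open>t\<close>, values of
  \<open>B\<close> up to \<open>t\<close> and null sets, already lie in \<open>F t\<close>.\<close>

lemma adapted_if_augmented:
  assumes bm: "brownian_motion M F B" and Y: "adapted (augmented_filtration M B) Y"
  shows "adapted F Y"
  unfolding adapted_def
proof (intro allI impI)
  fix t :: real assume t: "0 \<le> t"
  let ?A = "{B s -` A \<inter> space M |s A. 0 \<le> s \<and> s \<le> t \<and> A \<in> sets borel} \<union> null_sets M"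
  have sp: "space (F t) = space M" using sub[OF t] by (simp add: subalgebra_def)
  have A: "?A \<subseteq> sets (F t)"
  proof -
    have "B s -` A \<inter> space M \<in> sets (F t)" if "0 \<le> s" "s \<le> t" "A \<in> sets borel" for s A
    proof -
      have "B s \<in> borel_measurable (F s)" using bm that by (simp add: brownian_motion_def adapted_def)
      then have "B s \<in> borel_measurable (F t)" by (rule measurable_F_mono[OF that(1,2)])
      from measurable_sets[OF this that(3)] show ?thesis by (simp add: sp)
    qed
    with null_sets_F[OF t] show ?thesis by auto
  qed
  have Pow: "?A \<subseteq> Pow (space M)"
    using order_trans[OF A sets.space_closed] unfolding sp .
  have "sets (augmented_filtration M B t) \<subseteq> sets (F t)"
    unfolding augmented_filtration_def sets_measure_of[OF Pow]
    using sets.sigma_sets_subset[OF A] unfolding sp .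
  moreover have "space (augmented_filtration M B t) = space (F t)"
    unfolding augmented_filtration_def sp by (rule space_measure_of[OF Pow])
  ultimately have "borel_measurable (augmented_filtration M B t) \<subseteq> borel_measurable (F t)"
    by (intro measurable_mono) auto
  with Y t show "Y t \<in> borel_measurable (F t)" unfolding adapted_def by blast
qed

text \<open>One null set serves \<open>X\<close>, \<open>I\<close> and \<open>B\<close>, and the
  equation and both approximation conditions change only on null sets. The quantification over test
  functions sits inside the conclusion so that a single version \<open>X'\<close> works for all of
  them.\<close>

lemma dynkin_smooth:
  assumes bm: "brownian_motion M F B" and ss: "strong_solution M F B b s x X"
    and b[measurable]: "b \<in> borel_measurable borel" and b_le: "\<And>y. \<bar>b y\<bar> \<le> K"
    and s[measurable]: "s \<in> borel_measurable borel" and s_le: "\<And>y. \<bar>s y\<bar> \<le> K"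
  obtains X' where "(\<lambda>(t, \<omega>). X' t \<omega>) \<in> borel_measurable (borel \<Otimes>\<^sub>M M)"
    and "AE \<omega> in M. \<forall>t\<ge>0. X' t \<omega> = X t \<omega>"
    and "\<forall>C g g' g'' T. test_function C g g' g'' \<longrightarrow> 0 \<le> T \<longrightarrow>
      expectation (\<lambda>\<omega>. g (X' T \<omega>)) = g x +
      (LINT u:{0<..T}|lborel. expectation (\<lambda>\<omega>. b (X' u \<omega>) * g' (X' u \<omega>) + (s (X' u \<omega>))\<^sup>2 / 2 * g'' (X' u \<omega>)))"
proof -
  have X: "adapted F X" "continuous_paths M X" "AE \<omega> in M. X 0 \<omega> = x"
    using ss adapted_if_augmented[OF bm] unfolding strong_solution_def by auto
  obtain I where I: "ito_integral M F B (\<lambda>t \<omega>. s (X t \<omega>)) I"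
    and sde: "AE \<omega> in M. \<forall>t\<ge>0. set_integrable lborel {0..t} (\<lambda>u. b (X u \<omega>)) \<and>
           X t \<omega> = x + (LINT u:{0..t}|lborel. b (X u \<omega>)) + I t \<omega>"
    using ss unfolding strong_solution_def by auto
  have Ic: "adapted F I" "continuous_paths M I" using I by (auto simp: ito_integral_def)
  have Bc: "adapted F B" "continuous_paths M B" using bm by (auto simp: brownian_motion_def)
  obtain k \<tau> \<xi> where sd: "\<And>n::nat. simple_data M F (k n) (\<tau> n) (\<xi> n)"
    and lim: "\<And>T. 0 \<le> T \<Longrightarrow> (\<lambda>n. \<integral>\<^sup>+\<omega>. (\<integral>\<^sup>+t\<in>{0..T}.
             ennreal ((simple_process (k n) (\<tau> n) (\<xi> n) t \<omega> - s (X t \<omega>))\<^sup>2) \<partial>lborel) \<partial>M) \<longlonglongrightarrow> 0"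
      "\<And>T. 0 \<le> T \<Longrightarrow> (\<lambda>n. \<integral>\<^sup>+\<omega>. ennreal ((simple_integral B (k n) (\<tau> n) (\<xi> n) T \<omega> - I T \<omega>)\<^sup>2) \<partial>M)
            \<longlonglongrightarrow> 0"
    using I unfolding ito_integral_def by blast
  have "AE \<omega> in M. continuous_on {0..} (\<lambda>t. X t \<omega>) \<and> continuous_on {0..} (\<lambda>t. I t \<omega>) \<and> continuous_on {0..} (\<lambda>t. B t \<omega>)"
    using X(2) Ic(2) Bc(2) unfolding continuous_paths_def by eventually_elim auto
  then obtain N where N: "N \<in> null_sets M" and
    cont: "\<forall>\<omega>\<in>space M - N. continuous_on {0..} (\<lambda>t. X t \<omega>)"
      "\<forall>\<omega>\<in>space M - N. continuous_on {0..} (\<lambda>t. I t \<omega>)"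
      "\<forall>\<omega>\<in>space M - N. continuous_on {0..} (\<lambda>t. B t \<omega>)"
    by (elim AE_E3) auto
  define X' I' B' where "X' = regular_version (space M - N) X" and "I' = regular_version (space M - N) I"
    and "B' = regular_version (space M - N) B"
  note X' = regular_version[OF N X(1) cont(1), folded X'_def]
  note I' = regular_version[OF N Ic(1) cont(2), folded I'_def]
  note B' = regular_version[OF N Bc(1) cont(3), folded B'_def]
  note [measurable] = X'(2)
  let ?d = "\<lambda>Z n T \<omega>. \<integral>\<^sup>+t\<in>{0..T}. ennreal ((simple_process (k n) (\<tau> n) (\<xi> n) t \<omega> - s (Z t \<omega>))\<^sup>2) \<partial>lborel"
    and ?r = "\<lambda>W J n T \<omega>. ennreal ((simple_integral W (k n) (\<tau> n) (\<xi> n) T \<omega> - J T \<omega>)\<^sup>2)"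
  show ?thesis
  proof (rule that[OF X'(2,3)], intro allI impI)
    fix C g g' g'' and T :: real assume tf: "test_function C g g' g''" and T: "0 \<le> T"
    let ?L = "\<lambda>u. expectation (\<lambda>\<omega>. b (X' u \<omega>) * g' (X' u \<omega>) + (s (X' u \<omega>))\<^sup>2 / 2 * g'' (X' u \<omega>))"
    have "expectation (\<lambda>\<omega>. g (X' T \<omega>)) - expectation (\<lambda>\<omega>. g (X' 0 \<omega>)) =
      (LINT u:{0<..T}|lborel. ?L u)"
    proof (rule ito_formula[OF bm tf B' X'(1,2) I'(1,2) _ _ _ _ sd _ _ _ T])
      show "(\<lambda>(u, \<omega>). b (X' u \<omega>)) \<in> borel_measurable (borel \<Otimes>\<^sub>M M)"
        "(\<lambda>(u, \<omega>). s (X' u \<omega>)) \<in> borel_measurable (borel \<Otimes>\<^sub>M M)"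
        by measurable
      show "\<bar>b (X' u \<omega>)\<bar> \<le> K" "\<bar>s (X' u \<omega>)\<bar> \<le> K" for u \<omega>
        using b_le s_le by auto
    next
      fix T :: real assume T: "0 \<le> T"
      have "(\<integral>\<^sup>+\<omega>. ?d X' n T \<omega> \<partial>M)
        = (\<integral>\<^sup>+\<omega>. ?d X n T \<omega> \<partial>M)" for n
      proof (rule nn_integral_cong_AE)
        show "AE \<omega> in M. ?d X' n T \<omega>
          = ?d X n T \<omega>"
          using X'(3) by eventually_elim (auto intro!: nn_integral_cong simp: indicator_def)
      qed
      with lim(1)[OF T]
      show "(\<lambda>n. \<integral>\<^sup>+\<omega>. ?d X' n T \<omega> \<partial>M) \<longlonglongrightarrow> 0"
        by simp
      have "(\<integral>\<^sup>+\<omega>. ?r B' I' n T \<omega> \<partial>M)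
        = (\<integral>\<^sup>+\<omega>. ?r B I n T \<omega> \<partial>M)" for n
      proof (rule nn_integral_cong_AE)
        show "AE \<omega> in M. ?r B' I' n T \<omega>
          = ?r B I n T \<omega>"
          using B'(3) I'(3)
        proof eventually_elim
          case (elim \<omega>)
          have "simple_integral B' (k n) (\<tau> n) (\<xi> n) T \<omega> = simple_integral B (k n) (\<tau> n) (\<xi> n) T \<omega>"
            unfolding simple_integral_def
            using elim(1) T simple_data_nonneg[OF sd, of _ n] by (intro sum.cong) auto
          with elim(2) T show ?case by simp
        qed
      qed
      with lim(2)[OF T]
      show "(\<lambda>n. \<integral>\<^sup>+\<omega>. ?r B' I' n T \<omega> \<partial>M) \<longlonglongrightarrow> 0"
        by simp
    next
      fix r t :: real assume rt: "0 \<le> r" "r < t"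
      show "AE \<omega> in M. X' t \<omega> - X' r \<omega> = (LINT u:{r<..t}|lborel. b (X' u \<omega>)) + (I' t \<omega> - I' r \<omega>)"
        using sde X'(3) I'(3)
      proof eventually_elim
        case (elim \<omega>)
        have i: "set_integrable lborel {0..t} (\<lambda>u. b (X u \<omega>))" using elim(1) rt by auto
        have "{0..t} = {0..r} \<union> {r<..t}" using rt by auto
        then have "(LINT u:{0..t}|lborel. b (X u \<omega>)) = (LINT u:{0..r}|lborel. b (X u \<omega>)) + (LINT u:{r<..t}|lborel. b (X u \<omega>))"
          using set_integral_Un[OF _ set_integrable_subset[OF i] set_integrable_subset[OF i], of "{0..r}" "{r<..t}"] rt
          by (simp add: ivl_disj_int)
        moreover have "(LINT u:{r<..t}|lborel. b (X u \<omega>)) = (LINT u:{r<..t}|lborel. b (X' u \<omega>))"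
          using elim(2) rt by (intro set_lebesgue_integral_cong) auto
        moreover have "X t \<omega> = x + (LINT u:{0..t}|lborel. b (X u \<omega>)) + I t \<omega>"
          "X r \<omega> = x + (LINT u:{0..r}|lborel. b (X u \<omega>)) + I r \<omega>"
          using elim(1) rt by auto
        ultimately show ?case using elim(2,3) rt by simp
      qed
    qed
    moreover have "expectation (\<lambda>\<omega>. g (X' 0 \<omega>)) = g x"
    proof -
      have [measurable]: "X' 0 \<in> borel_measurable M" using measurable_Pair2[OF X'(2), of 0] by simp
      note [measurable] = test_function_measurable[OF tf]
      have "expectation (\<lambda>\<omega>. g (X' 0 \<omega>)) = expectation (\<lambda>\<omega>. g x)"
      proof (rule integral_cong_AE)
        show "AE \<omega> in M. g (X' 0 \<omega>) = g x"
          using X'(3) X(3) by eventually_elim auto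
      qed measurable
      then show ?thesis by (simp add: prob_space)
    qed
    ultimately show "expectation (\<lambda>\<omega>. g (X' T \<omega>)) = g x +
      (LINT u:{0<..T}|lborel. ?L u)"
      by simp
  qed
qed

text \<open>Dynkin's formula is averaged against the exponential density. By
  \<open>exponential_discount\<close> the running time integral of the generator term becomes its
  mean at the exponential time, divided by \<open>q\<close>.\<close>

lemma resolvent_identity_smooth:
  assumes bm: "brownian_motion M F B" and ss: "strong_solution M F B b s x X"
    and b[measurable]: "b \<in> borel_measurable borel" and b_le: "\<And>y. \<bar>b y\<bar> \<le> K"
    and s[measurable]: "s \<in> borel_measurable borel" and s_le: "\<And>y. \<bar>s y\<bar> \<le> K"
    and e: "distributed M lborel e (exponential_density q)" and q: "0 < q"
    and ind: "indep_of_process M e X"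
  shows "(\<lambda>\<omega>. X (e \<omega>) \<omega>) \<in> borel_measurable M"
    and "test_function C g g' g'' \<Longrightarrow>
      expectation (\<lambda>\<omega>. q * g (X (e \<omega>) \<omega>) - (b (X (e \<omega>) \<omega>) * g' (X (e \<omega>) \<omega>) + (s (X (e \<omega>) \<omega>))\<^sup>2 / 2 * g'' (X (e \<omega>) \<omega>))) = q * g x"
proof -
  obtain X' where X': "(\<lambda>(t, \<omega>). X' t \<omega>) \<in> borel_measurable (borel \<Otimes>\<^sub>M M)"
    and X'_eq: "AE \<omega> in M. \<forall>t\<ge>0. X' t \<omega> = X t \<omega>"
    and dynkin: "\<forall>C g g' g'' T. test_function C g g' g'' \<longrightarrow> 0 \<le> T \<longrightarrow>
      expectation (\<lambda>\<omega>. g (X' T \<omega>)) = g x +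
      (LINT u:{0<..T}|lborel. expectation (\<lambda>\<omega>. b (X' u \<omega>) * g' (X' u \<omega>) + (s (X' u \<omega>))\<^sup>2 / 2 * g'' (X' u \<omega>)))"
    using dynkin_smooth[OF bm ss b b_le s s_le] by blast
  have cont: "AE \<omega> in M. continuous_on {0..} (\<lambda>t. X t \<omega>)"
    using ss unfolding strong_solution_def continuous_paths_def by auto
  have complete: "complete_measure M" by unfold_locales
  note law = law_at_exponential_time[OF complete e q ind cont X' X'_eq]
  show Y[measurable]: "(\<lambda>\<omega>. X (e \<omega>) \<omega>) \<in> borel_measurable M"
    by (rule law(1)[of "\<lambda>_. 0" 0]) auto
  assume tf: "test_function C g g' g''"
  note [measurable] = test_function_measurable[OF tf] X'
  note tfD = test_function_D[OF tf]
  let ?p = "exponential_density q"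
  let ?L = "\<lambda>y. b y * g' y + (s y)\<^sup>2 / 2 * g'' y"
  have L_le: "\<bar>?L y\<bar> \<le> (K + K\<^sup>2) * C" for y
    by (rule generator_le[OF b_le s_le tfD(4,5)])
  define \<psi> where "\<psi> t = expectation (\<lambda>\<omega>. ?L (X' t \<omega>))" for t
  have \<psi>: "\<psi> \<in> borel_measurable borel" unfolding \<psi>_def by measurable
  have \<psi>_le: "\<bar>\<psi> u\<bar> \<le> (K + K\<^sup>2) * C" for u unfolding \<psi>_def using L_le by (rule abs_expectation_le)
  note disc = exponential_discount[OF e q \<psi> \<psi>_le]
  have p0: "0 \<le> ?p t" for t using q by (auto simp: exponential_density_def)
  have p: "integrable lborel ?p" "(\<integral>t. ?p t \<partial>lborel) = 1"
    using distributed_integrable[OF e, of "\<lambda>_. 1"] distributed_integral[OF e, of "\<lambda>_. 1"] p0 by (auto simp: prob_space)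
  have "expectation (\<lambda>\<omega>. g (X (e \<omega>) \<omega>)) = (\<integral>t. ?p t * expectation (\<lambda>\<omega>. g (X' t \<omega>)) \<partial>lborel)"
    by (rule law(2)[OF _ tfD(3)]) measurable
  also have "\<dots> = (\<integral>t. g x * ?p t + ?p t * (LINT u:{0<..t}|lborel. \<psi> u) \<partial>lborel)"
  proof (rule Bochner_Integration.integral_cong[OF refl])
    show "?p t * expectation (\<lambda>\<omega>. g (X' t \<omega>)) = g x * ?p t + ?p t * (LINT u:{0<..t}|lborel. \<psi> u)" for t
      using dynkin[rule_format, OF tf, of t] by (cases "0 \<le> t") (auto simp: \<psi>_def algebra_simps exponential_density_def)
  qed
  also have "\<dots> = g x + (\<integral>t. ?p t * \<psi> t \<partial>lborel) / q"
    using p disc by simp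
  also have "(\<integral>t. ?p t * \<psi> t \<partial>lborel) = expectation (\<lambda>\<omega>. ?L (X (e \<omega>) \<omega>))"
    unfolding \<psi>_def by (rule law(2)[OF _ L_le, symmetric]) measurable
  finally have "q * expectation (\<lambda>\<omega>. g (X (e \<omega>) \<omega>)) - expectation (\<lambda>\<omega>. ?L (X (e \<omega>) \<omega>)) = q * g x"
    using q by (simp add: field_simps)
  moreover have "integrable M (\<lambda>\<omega>. g (X (e \<omega>) \<omega>))" "integrable M (\<lambda>\<omega>. ?L (X (e \<omega>) \<omega>))"
    by (rule integrable_bounded[OF _ tfD(3)], measurable, rule integrable_bounded[OF _ L_le], measurable)
  ultimately show "expectation (\<lambda>\<omega>. q * g (X (e \<omega>) \<omega>) - ?L (X (e \<omega>) \<omega>)) = q * g x"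
    by simp
qed

end

lemma left_difference_quotient:
  fixes f :: "real \<Rightarrow> real"
  assumes "(f has_real_derivative D) (at_left y)"
  shows "(\<lambda>n. real (Suc n) * (f y - f (y - 1 / real (Suc n)))) \<longlonglongrightarrow> D"
proof -
  have "((\<lambda>z. (f z - f y) / (z - y)) \<longlongrightarrow> D) (at_left y)"
    using assms by (simp add: has_field_derivative_iff)
  moreover have "filterlim (\<lambda>n. y - 1 / real (Suc n)) (at_left y) sequentially"
    unfolding filterlim_at
  proof (intro conjI always_eventually allI)
    have "(\<lambda>n. y - 1 / real (Suc n)) \<longlonglongrightarrow> y - 0"
      by (intro tendsto_diff tendsto_const LIMSEQ_Suc[OF lim_1_over_n])
    then show "(\<lambda>n. y - 1 / real (Suc n)) \<longlonglongrightarrow> y" by simp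
  qed auto
  ultimately have "(\<lambda>n. (f (y - 1 / real (Suc n)) - f y) / (y - 1 / real (Suc n) - y)) \<longlonglongrightarrow> D"
    by (rule filterlim_compose)
  moreover have "(f (y - 1 / real (Suc n)) - f y) / (y - 1 / real (Suc n) - y) = real (Suc n) * (f y - f (y - 1 / real (Suc n)))" for n
    by (simp add: field_simps)
  ultimately show ?thesis by simp
qed

text \<open>The smooth approximations are the averages of \<open>g\<close> over \<open>[y - 1/n, y]\<close>. Averaging to the left makes their second
  derivatives converge to the left derivative of \<open>g'\<close>, which matches the convention of the coefficients at
  their jump, so no information about \<open>P(X\<^sub>t = a)\<close> is needed.\<close>

lemma (in usual_filtered_prob_space) resolvent_identity:
  assumes bm: "brownian_motion M F B" and ss: "strong_solution M F B b s x X"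
    and b[measurable]: "b \<in> borel_measurable borel" and b_le: "\<And>y. \<bar>b y\<bar> \<le> K"
    and s[measurable]: "s \<in> borel_measurable borel" and s_le: "\<And>y. \<bar>s y\<bar> \<le> K"
    and e: "distributed M lborel e (exponential_density q)" and q: "0 < q"
    and ind: "indep_of_process M e X"
    and g: "\<And>y. (g has_real_derivative g' y) (at y)" and g_le: "\<And>y. \<bar>g y\<bar> \<le> C" "\<And>y. \<bar>g' y\<bar> \<le> C"
    and g'_lip: "\<And>y z. \<bar>g' y - g' z\<bar> \<le> C * \<bar>y - z\<bar>"
    and h: "\<And>y. (g' has_real_derivative h y) (at_left y)"
  shows "expectation (\<lambda>\<omega>. q * g (X (e \<omega>) \<omega>) - (b (X (e \<omega>) \<omega>) * g' (X (e \<omega>) \<omega>) + (s (X (e \<omega>) \<omega>))\<^sup>2 / 2 * h (X (e \<omega>) \<omega>))) = q * g x"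
proof -
  have C: "0 \<le> C" using g_le(1)[of 0] by linarith
  \<comment> \<open>The average of \<open>g\<close> over a short interval is a difference quotient
    of an antiderivative.\<close>
  obtain G where G: "\<And>y. (G has_real_derivative g y) (at y)"
  proof -
    have "\<And>y. isCont g y" using g by (rule DERIV_isCont)
    then have "\<exists>G. \<forall>y::real. -\<infinity> < ereal y \<longrightarrow> ereal y < \<infinity> \<longrightarrow> (G has_vector_derivative g y) (at y)"
      by (intro einterval_antiderivative) auto
    then show ?thesis using that by (auto simp: has_real_derivative_iff_has_vector_derivative)
  qed
  define r where "r n = real (Suc n)" for n
  have r: "1 \<le> r n" for n by (simp add: r_def)
  \<comment> \<open>\<open>D n G\<close> is the averaged \<open>g\<close>; its first and second
    derivatives are \<open>D n g\<close> and \<open>D n g'\<close>.\<close>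
  define D where "D n f y = r n * (f y - f (y - 1 / r n))" for n and f :: "real \<Rightarrow> real" and y
  have D_deriv: "(D n f has_real_derivative D n f' y) (at y)" if "\<And>y. (f has_real_derivative f' y) (at y)" for n f f' y
    unfolding D_def[abs_def]
    by (rule derivative_eq_intros that DERIV_chain2[OF that] refl | simp)+
  have D_le: "\<bar>D n f y\<bar> \<le> C" if "\<And>y z. \<bar>f y - f z\<bar> \<le> C * \<bar>y - z\<bar>" for n f y
  proof -
    have "\<bar>D n f y\<bar> = r n * \<bar>f y - f (y - 1 / r n)\<bar>" using r[of n] by (simp add: D_def abs_mult)
    also have "\<dots> \<le> r n * (C * \<bar>y - (y - 1 / r n)\<bar>)" using that[of y "y - 1 / r n"] r[of n] by (intro mult_left_mono) auto
    also have "\<dots> = C" using r[of n] by simp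
    finally show ?thesis .
  qed
  \<comment> \<open>This constant grows with \<open>n\<close>. It only certifies that each average
    is a test function; the passage to the limit is dominated by the uniform bounds in
    \<open>D_le\<close>.\<close>
  have D_lip: "\<bar>D n f y - D n f z\<bar> \<le> (2 * r n * C) * \<bar>y - z\<bar>"
    if "\<And>y z. \<bar>f y - f z\<bar> \<le> C * \<bar>y - z\<bar>" for n f y z
  proof -
    have "D n f y - D n f z = r n * ((f y - f z) - (f (y - 1 / r n) - f (z - 1 / r n)))"
      by (simp add: D_def algebra_simps)
    then have "\<bar>D n f y - D n f z\<bar> = r n * \<bar>(f y - f z) - (f (y - 1 / r n) - f (z - 1 / r n))\<bar>"
      using r[of n] by (simp add: abs_mult)
    also have "\<dots> \<le> r n * (2 * (C * \<bar>y - z\<bar>))"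
      using that[of y z] that[of "y - 1 / r n" "z - 1 / r n"] r[of n] by (intro mult_left_mono) auto
    finally show ?thesis by (simp add: algebra_simps)
  qed
  have D_lim: "(\<lambda>n. D n f y) \<longlonglongrightarrow> d" if "(f has_real_derivative d) (at_left y)" for f y d
    using left_difference_quotient[OF that] unfolding D_def r_def .
  have lips: "\<bar>G y - G z\<bar> \<le> C * \<bar>y - z\<bar>" "\<bar>g y - g z\<bar> \<le> C * \<bar>y - z\<bar>" for y z
    using lipschitz_if_bounded_derivative[OF G g_le(1)] lipschitz_if_bounded_derivative[OF g g_le(2)] by auto
  have tf: "test_function (2 * r n * C) (D n G) (D n g) (D n g')" for n
  proof -
    have "1 * C \<le> 2 * r n * C" using r[of n] C by (intro mult_right_mono) auto
    then have C2: "C \<le> 2 * r n * C" by simp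
    show ?thesis
      unfolding test_function_def
      by (intro conjI allI D_deriv[OF G] D_deriv[OF g] D_lip[OF g'_lip] order_trans[OF D_le[OF lips(1)] C2]
        order_trans[OF D_le[OF lips(2)] C2] order_trans[OF D_le[OF g'_lip] C2])
  qed
  define Y where "Y \<omega> = X (e \<omega>) \<omega>" for \<omega>
  have Y[measurable]: "Y \<in> borel_measurable M"
    unfolding Y_def by (rule resolvent_identity_smooth(1)[OF bm ss b b_le s s_le e q ind])
  have lim: "(\<lambda>n. D n G y) \<longlonglongrightarrow> g y" "(\<lambda>n. D n g y) \<longlonglongrightarrow> g' y" "(\<lambda>n. D n g' y) \<longlonglongrightarrow> h y" for y
    by (rule D_lim[OF has_field_derivative_at_within[OF G]], rule D_lim[OF has_field_derivative_at_within[OF g]], rule D_lim[OF h])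
  note tfm[measurable] = test_function_measurable[OF tf]
  have [measurable]: "g \<in> borel_measurable borel" "g' \<in> borel_measurable borel" "h \<in> borel_measurable borel"
    by (rule borel_measurable_LIMSEQ_real[OF lim(1) tfm(1)], rule borel_measurable_LIMSEQ_real[OF lim(2) tfm(2)],
        rule borel_measurable_LIMSEQ_real[OF lim(3) tfm(3)])
  let ?T = "\<lambda>n y. q * D n G y - (b y * D n g y + (s y)\<^sup>2 / 2 * D n g' y)"
    and ?T' = "\<lambda>y. q * g y - (b y * g' y + (s y)\<^sup>2 / 2 * h y)"
  have "(\<lambda>n. expectation (\<lambda>\<omega>. ?T n (Y \<omega>)))
      \<longlonglongrightarrow> expectation (\<lambda>\<omega>. ?T' (Y \<omega>))"
  proof (rule integral_dominated_convergence[where w = "\<lambda>_. (q + K + K\<^sup>2) * C"])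
    show "AE \<omega> in M. (\<lambda>n. ?T n (Y \<omega>))
      \<longlonglongrightarrow> ?T' (Y \<omega>)"
      by (intro AE_I2 tendsto_intros lim)
    show "AE \<omega> in M. norm (?T n (Y \<omega>)) \<le> (q + K + K\<^sup>2) * C" for n
    proof (rule AE_I2)
      fix \<omega>
      have "\<bar>q * D n G (Y \<omega>)\<bar> \<le> q * C"
        unfolding abs_mult using D_le[OF lips(1)] q by (intro mult_mono) auto
      moreover have "\<bar>b (Y \<omega>) * D n g (Y \<omega>) + (s (Y \<omega>))\<^sup>2 / 2 * D n g' (Y \<omega>)\<bar> \<le> (K + K\<^sup>2) * C"
        by (rule generator_le[OF b_le s_le D_le[OF lips(2)] D_le[OF g'_lip]])
      ultimately show "norm (?T n (Y \<omega>)) \<le> (q + K + K\<^sup>2) * C"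
        unfolding real_norm_def distrib_right by linarith
    qed
  qed measurable
  moreover have "expectation (\<lambda>\<omega>. ?T n (Y \<omega>)) = q * D n G x" for n
    unfolding Y_def by (rule resolvent_identity_smooth(2)[OF bm ss b b_le s s_le e q ind tf])
  ultimately have "(\<lambda>n. q * D n G x) \<longlonglongrightarrow> expectation (\<lambda>\<omega>. ?T' (Y \<omega>))"
    by simp
  moreover have "(\<lambda>n. q * D n G x) \<longlonglongrightarrow> q * g x"
    by (intro tendsto_intros lim)
  ultimately show ?thesis unfolding Y_def by (rule LIMSEQ_unique)
qed

section \<open>Moments determine a finite measure on the unit interval\<close>

text \<open>Weierstrass approximation: equal moments give equal integrals of polynomials, and since
  both measures live on the unit interval, closeness there suffices.\<close>

lemma integral_eq_if_moments_eq:
  fixes P Q :: "real measure" and f :: "real \<Rightarrow> real"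
  assumes P: "finite_measure P" "sets P = sets borel" "AE w in P. w \<in> {0..1}"
    and Q: "finite_measure Q" "sets Q = sets borel" "AE w in Q. w \<in> {0..1}"
    and moments: "\<And>n. (\<integral>w. w ^ n \<partial>P) = (\<integral>w. w ^ n \<partial>Q)"
    and f: "continuous_on UNIV f"
  shows "(\<integral>w. f w \<partial>P) = (\<integral>w. f w \<partial>Q)"
proof (rule ccontr)
  assume neq: "(\<integral>w. f w \<partial>P) \<noteq> (\<integral>w. f w \<partial>Q)"
  have int: "integrable R g" and close: "(\<forall>w\<in>{0..1}. \<bar>f w - g w\<bar> < \<epsilon>) \<Longrightarrow> \<bar>(\<integral>w. f w \<partial>R) - (\<integral>w. g w \<partial>R)\<bar> \<le> \<epsilon> * measure R (space R)"
    if R: "finite_measure R" "sets R = sets borel" "AE w in R. w \<in> {0..1}" and g: "continuous_on UNIV g" for R and g :: "real \<Rightarrow> real" and \<epsilon>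
  proof -
    interpret finite_measure R by fact
    have int: "integrable R k" if k: "continuous_on UNIV k" for k :: "real \<Rightarrow> real"
    proof -
      have "bounded (k ` {0..1})"
        using k by (intro compact_imp_bounded compact_continuous_image) (auto intro: continuous_on_subset)
      then obtain L where L: "\<And>w. w \<in> {0..1} \<Longrightarrow> norm (k w) \<le> L" unfolding bounded_iff by (metis imageI)
      have "AE w in R. norm (k w) \<le> L" using R(3) by eventually_elim (rule L)
      moreover have "k \<in> borel_measurable R"
        using borel_measurable_continuous_onI[OF k] R(2) by (simp cong: measurable_cong_sets)
      ultimately show ?thesis
        by (rule integrable_const_bound)
    qed
    show "integrable R g" by (rule int[OF g])
    assume le: "\<forall>w\<in>{0..1}. \<bar>f w - g w\<bar> < \<epsilon>"
    have i: "integrable R (\<lambda>w. f w - g w)" using int[OF f] int[OF g] by simp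
    have "\<bar>(\<integral>w. f w \<partial>R) - (\<integral>w. g w \<partial>R)\<bar> = \<bar>\<integral>w. f w - g w \<partial>R\<bar>"
      using int[OF f] int[OF g] by simp
    also have "\<dots> \<le> (\<integral>w. \<bar>f w - g w\<bar> \<partial>R)" by (rule integral_abs_bound)
    also have "\<dots> \<le> (\<integral>w. \<epsilon> \<partial>R)"
    proof (rule integral_mono_AE)
      show "AE w in R. \<bar>f w - g w\<bar> \<le> \<epsilon>"
        using R(3) by eventually_elim (use le in \<open>force intro: less_imp_le\<close>)
    qed (use i in auto)
    finally show "\<bar>(\<integral>w. f w \<partial>R) - (\<integral>w. g w \<partial>R)\<bar> \<le> \<epsilon> * measure R (space R)" by (simp add: mult.commute)
  qed
  define m where "m = measure P (space P) + measure Q (space Q)"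
  define d where "d = \<bar>(\<integral>w. f w \<partial>P) - (\<integral>w. f w \<partial>Q)\<bar>"
  have d: "0 < d" using neq by (simp add: d_def)
  have m: "0 \<le> m" by (simp add: m_def)
  \<comment> \<open>The approximation error under both measures together is at most
    \<open>\<epsilon> * m\<close>, which is then strictly below \<open>d\<close>, even for
    \<open>m = 0\<close>.\<close>
  define \<epsilon> where "\<epsilon> = d / (2 * (m + 1))"
  have \<epsilon>: "0 < \<epsilon>" using d m by (simp add: \<epsilon>_def)
  obtain g where g: "real_polynomial_function g" "\<And>w. w \<in> {0..1} \<Longrightarrow> \<bar>f w - g w\<bar> < \<epsilon>"
    using Stone_Weierstrass_real_polynomial_function[of "{0..1::real}" f \<epsilon>] continuous_on_subset[OF f] \<epsilon> by auto
  obtain c k where c: "g = (\<lambda>w. \<Sum>i\<le>k. c i * w ^ i)"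
    using g(1) unfolding real_polynomial_function_iff_sum by auto
  have gc: "continuous_on UNIV g" unfolding c by (intro continuous_intros)
  have mono: "integrable P (\<lambda>w. c i * w ^ i)" "integrable Q (\<lambda>w. c i * w ^ i)" for i
    by (auto intro!: int[OF P] int[OF Q] continuous_intros)
  have "(\<integral>w. g w \<partial>P) = (\<Sum>i\<le>k. c i * (\<integral>w. w ^ i \<partial>P))" "(\<integral>w. g w \<partial>Q) = (\<Sum>i\<le>k. c i * (\<integral>w. w ^ i \<partial>Q))"
    unfolding c using mono by simp_all
  then have eq: "(\<integral>w. g w \<partial>P) = (\<integral>w. g w \<partial>Q)" by (simp add: moments)
  have "d \<le> \<epsilon> * measure P (space P) + \<epsilon> * measure Q (space Q)"
    using close[OF P gc, of \<epsilon>] close[OF Q gc, of \<epsilon>] g(2) eq unfolding d_def by auto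
  also have "\<dots> = \<epsilon> * m" by (simp add: m_def algebra_simps)
  also have "\<dots> < \<epsilon> * (m + 1) * 2" using \<epsilon> m by simp
  also have "\<dots> = d"
  proof -
    have "m + 1 \<noteq> 0" using m by linarith
    then show ?thesis unfolding \<epsilon>_def by (simp add: divide_simps)
  qed
  finally show False by simp
qed

text \<open>Half-lines form an intersection-stable generator, and their indicators are bounded
  limits of the ramps \<open>\<phi> n\<close>, which fall from 1 at \<open>t\<close> to 0 at t +
  1/n.\<close>

lemma measure_eq_if_moments_eq:
  fixes P Q :: "real measure"
  assumes P: "finite_measure P" "sets P = sets borel" "AE w in P. w \<in> {0..1}"
    and Q: "finite_measure Q" "sets Q = sets borel" "AE w in Q. w \<in> {0..1}"
    and moments: "\<And>n. (\<integral>w. w ^ n \<partial>P) = (\<integral>w. w ^ n \<partial>Q)"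
  shows "P = Q"
proof -
  interpret P: finite_measure P by fact
  interpret Q: finite_measure Q by fact
  have atMost: "measure P {..t} = measure Q {..t}" for t
  proof -
    define \<phi> where "\<phi> n w = max 0 (min 1 (1 - real n * (w - t)))" for n w
    have cont: "continuous_on UNIV (\<phi> n)" for n unfolding \<phi>_def by (intro continuous_intros)
    have lim: "(\<lambda>n. \<phi> n w) \<longlonglongrightarrow> indicator {..t} w" for w
    proof (cases "w \<le> t")
      case True
      then have "\<phi> n w = 1" for n by (simp add: \<phi>_def mult_nonneg_nonpos)
      with True show ?thesis by simp
    next
      case False
      obtain N where N: "1 / (w - t) < real N" using reals_Archimedean2 by blast
      have "\<phi> n w = 0" if "N \<le> n" for n
      proof -
        have "1 / (w - t) < real n" using N that by simp
        then have "1 < real n * (w - t)" using False by (simp add: divide_less_eq)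
        then show ?thesis by (simp add: \<phi>_def)
      qed
      then have "\<forall>\<^sub>F n in sequentially. \<phi> n w = 0" by (auto simp: eventually_sequentially)
      with False show ?thesis by (simp add: tendsto_eventually)
    qed
    have lim_int: "(\<lambda>n. \<integral>w. \<phi> n w \<partial>R) \<longlonglongrightarrow> measure R {..t}" if R: "finite_measure R" "sets R = sets borel" for R
    proof -
      interpret finite_measure R by fact
      have [measurable]: "\<phi> n \<in> borel_measurable R" "{..t} \<in> sets R" for n
        using borel_measurable_continuous_onI[OF cont] R(2) by (simp_all cong: measurable_cong_sets)
      have "(\<lambda>n. \<integral>w. \<phi> n w \<partial>R) \<longlonglongrightarrow> (\<integral>w. indicator {..t} w \<partial>R)"
      proof (rule integral_dominated_convergence[where w = "\<lambda>_. 1"])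
        show "AE w in R. norm (\<phi> n w) \<le> 1" for n by (simp add: \<phi>_def)
      qed (auto intro: lim)
      then show ?thesis by simp
    qed
    have "(\<integral>w. \<phi> n w \<partial>P) = (\<integral>w. \<phi> n w \<partial>Q)" for n
      by (rule integral_eq_if_moments_eq[OF P Q moments cont])
    with lim_int[OF P(1,2)] lim_int[OF Q(1,2)] show ?thesis by (auto intro: LIMSEQ_unique)
  qed
  show ?thesis
  proof (rule measure_eqI_generator_eq[where E = "range atMost" and A = "\<lambda>i. {..real i}" and \<Omega> = UNIV])
    show "sets P = sigma_sets UNIV (range atMost)" "sets Q = sigma_sets UNIV (range atMost)"
      using P(2) Q(2) by (simp_all add: borel_eq_atMost)
    show "Int_stable (range (atMost :: real \<Rightarrow> real set))" by (auto simp: Int_stable_def)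
    show "(\<Union>i. {..real i}) = UNIV" using real_arch_simple by auto
    show "emeasure P X = emeasure Q X" if "X \<in> range atMost" for X
      using that atMost by (auto simp: P.emeasure_eq_measure Q.emeasure_eq_measure)
  qed (auto simp: P.emeasure_eq_measure)
qed

text \<open>The map exp(c (y - a)) carries the relevant half-line injectively into the unit interval
  and turns the exponential moments into ordinary ones; its inverse \<open>a + ln w / c\<close>
  recovers the measures. The sign of \<open>c\<close> chooses the half-line.\<close>

lemma measure_eq_if_exponential_moments_eq:
  fixes P Q :: "real measure"
  assumes P: "finite_measure P" "sets P = sets borel" "AE y in P. c * (y - a) \<le> 0"
    and Q: "finite_measure Q" "sets Q = sets borel" "AE y in Q. c * (y - a) \<le> 0"
    and c: "c \<noteq> 0"
    and moments: "\<And>n. (\<integral>y. exp (real n * c * (y - a)) \<partial>P) = (\<integral>y. exp (real n * c * (y - a)) \<partial>Q)"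
  shows "P = Q"
proof -
  let ?\<phi> = "\<lambda>y. exp (c * (y - a))"
  have pow: "?\<phi> y ^ n = exp (real n * c * (y - a))" for n y
    by (simp add: exp_of_nat_mult[symmetric] mult.assoc)
  have pullback: "distr (distr R borel ?\<phi>) borel (\<lambda>w. a + ln w / c) = R"
    and fin: "finite_measure (distr R borel ?\<phi>)" and supp: "AE w in distr R borel ?\<phi>. w \<in> {0..1}"
    and mom: "(\<integral>w. w ^ n \<partial>distr R borel ?\<phi>) = (\<integral>y. exp (real n * c * (y - a)) \<partial>R)"
    if R: "finite_measure R" "sets R = sets borel" "AE y in R. c * (y - a) \<le> 0" for R n
  proof -
    have \<phi>: "?\<phi> \<in> borel_measurable R" using R(2) by (simp cong: measurable_cong_sets)
    have "distr (distr R borel ?\<phi>) borel (\<lambda>w. a + ln w / c) = distr R borel ((\<lambda>w. a + ln w / c) \<circ> ?\<phi>)"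
      by (rule distr_distr[OF _ \<phi>]) measurable
    also have "(\<lambda>w. a + ln w / c) \<circ> ?\<phi> = (\<lambda>y. y)" using c by (auto simp: fun_eq_iff)
    also have "distr R borel (\<lambda>y. y) = R" using R(2) by (intro distr_id2) simp
    finally show "distr (distr R borel ?\<phi>) borel (\<lambda>w. a + ln w / c) = R" .
    show "finite_measure (distr R borel ?\<phi>)" by (rule finite_measure.finite_measure_distr[OF R(1) \<phi>])
    show "AE w in distr R borel ?\<phi>. w \<in> {0..1}"
      using R(3) by (subst AE_distr_iff[OF \<phi>]) (auto elim!: eventually_mono)
    show "(\<integral>w. w ^ n \<partial>distr R borel ?\<phi>) = (\<integral>y. exp (real n * c * (y - a)) \<partial>R)"
      by (subst integral_distr[OF \<phi>]) (simp_all add: pow)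
  qed
  have "distr P borel ?\<phi> = distr Q borel ?\<phi>"
    using mom[OF P] mom[OF Q] moments
    by (intro measure_eq_if_moments_eq fin[OF P] fin[OF Q] supp[OF P] supp[OF Q]) auto
  then show ?thesis using pullback[OF P] pullback[OF Q] by metis
qed

section \<open>Resolvent equation for exponentials glued at \<open>a\<close>\<close>

text \<open>The point \<open>a\<close> belongs to the left piece, in agreement with the coefficients
  of the equation and with the use of left derivatives.\<close>

definition glue :: "real \<Rightarrow> (real \<Rightarrow> real) \<Rightarrow> (real \<Rightarrow> real) \<Rightarrow> real \<Rightarrow> real" where
  "glue a f g y = (if y \<le> a then f y else g y)"

text \<open>Approaching \<open>a\<close> from the left only \<open>f\<close> is seen, so the pieces
  may jump at \<open>a\<close>. Applied to \<open>g'\<close>, this provides the one-sided second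
  derivative of a function with a kink.\<close>

lemma glue_left_derivative:
  assumes f: "(f has_real_derivative f' y) (at y)" and g: "(g has_real_derivative g' y) (at y)"
  shows "(glue a f g has_real_derivative glue a f' g' y) (at_left y)"
proof (cases "y \<le> a")
  case True
  have "(f has_real_derivative f' y) (at_left y)" using f by (rule has_field_derivative_at_within)
  then have "(glue a f g has_real_derivative f' y) (at_left y)"
    unfolding has_field_derivative_iff
    by (rule Lim_transform_eventually) (use True in \<open>auto simp: glue_def eventually_at_filter\<close>)
  with True show ?thesis by (simp add: glue_def)
next
  case False
  have "(glue a f g has_real_derivative g' y) (at y)"
    by (rule has_field_derivative_transform_within_open[OF g, of "{a<..}"]) (use False in \<open>auto simp: glue_def\<close>)
  with False show ?thesis by (auto simp: glue_def intro: has_field_derivative_at_within)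
qed

lemma glue_derivative:
  assumes f: "\<And>y. (f has_real_derivative f' y) (at y)" and g: "\<And>y. (g has_real_derivative g' y) (at y)"
    and eq: "f a = g a" "f' a = g' a"
  shows "(glue a f g has_real_derivative glue a f' g' y) (at y)"
proof (cases y a rule: linorder_cases)
  case less
  then have "(glue a f g has_real_derivative f' y) (at y)"
    by (intro has_field_derivative_transform_within_open[OF f, of "{..<a}"]) (auto simp: glue_def)
  with less show ?thesis by (simp add: glue_def)
next
  case greater
  then have "(glue a f g has_real_derivative g' y) (at y)"
    by (intro has_field_derivative_transform_within_open[OF g, of "{a<..}"]) (auto simp: glue_def)
  with greater show ?thesis by (simp add: glue_def)
next
  case equal
  have "(g has_real_derivative f' a) (at_right a)" using g[of a] eq by (auto intro: has_field_derivative_at_within)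
  then have "(glue a f g has_real_derivative f' a) (at_right a)"
    unfolding has_field_derivative_iff
    by (rule Lim_transform_eventually) (use eq in \<open>auto simp: glue_def eventually_at_filter\<close>)
  moreover have "(glue a f g has_real_derivative f' a) (at_left a)"
    using glue_left_derivative[of f f' a g g' a, OF f g] by (simp add: glue_def)
  ultimately have "(glue a f g has_real_derivative f' a) (at a)"
    unfolding has_field_derivative_iff by (intro filterlim_split_at)
  then show ?thesis using equal by (simp add: glue_def)
qed

text \<open>Between points on opposite sides the increment is routed through \<open>a\<close>, where
  the pieces agree. Each derivative is bounded only on its own side, since the exponentials grow on
  the other one.\<close>

lemma glue_lipschitz:
  assumes f: "\<And>y. (f has_real_derivative f' y) (at y)" "\<And>y. y \<le> a \<Longrightarrow> \<bar>f' y\<bar> \<le> C"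
    and g: "\<And>y. (g has_real_derivative g' y) (at y)" "\<And>y. a \<le> y \<Longrightarrow> \<bar>g' y\<bar> \<le> C"
    and eq: "f a = g a"
  shows "\<bar>glue a f g y - glue a f g z\<bar> \<le> C * \<bar>y - z\<bar>"
proof -
  have L: "\<bar>f u - f v\<bar> \<le> C * \<bar>u - v\<bar>" if "u \<le> a" "v \<le> a" for u v
    using field_differentiable_bound[of "{..a}" f f' C u v] f that by (auto intro: has_field_derivative_at_within)
  have R: "\<bar>g u - g v\<bar> \<le> C * \<bar>u - v\<bar>" if "a \<le> u" "a \<le> v" for u v
    using field_differentiable_bound[of "{a..}" g g' C u v] g that by (auto intro: has_field_derivative_at_within)
  have "\<bar>glue a f g y - glue a f g z\<bar> \<le> C * \<bar>y - z\<bar>" if "y \<le> z" for y z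
  proof -
    consider "z \<le> a" | "y \<le> a" "a < z" | "a < y" by linarith
    then show ?thesis
    proof cases
      case 2
      have "C * \<bar>y - z\<bar> = C * \<bar>y - a\<bar> + C * \<bar>a - z\<bar>" using 2 by (simp add: algebra_simps)
      with L[of y a] R[of a z] 2 eq show ?thesis by (simp add: glue_def)
    qed (use that L[of y z] R[of y z] in \<open>auto simp: glue_def\<close>)
  qed
  from this[of y z] this[of z y] show ?thesis by (cases "y \<le> z") (auto simp: abs_minus_commute)
qed

text \<open>The factors such as \<open>q - \<mu>1 * k1 - \<sigma>1\<^sup>2 * k1\<^sup>2 / 2\<close>
  are what q - L does to the exponential with that exponent. The signs of the exponents keep the
  glued function bounded, and \<open>eq\<close> says that the values and the slopes match at
  \<open>a\<close>. Two exponentials per side leave room for one to survive and one to do the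
  matching.\<close>

lemma (in usual_filtered_prob_space) resolvent_exponential:
  assumes bm: "brownian_motion M F B"
    and ss: "strong_solution M F B (\<lambda>y. \<mu>1 * indicator {..a} y + \<mu>2 * indicator {a<..} y)
           (\<lambda>y. \<sigma>1 * indicator {..a} y + \<sigma>2 * indicator {a<..} y) x X"
    and e: "distributed M lborel e (exponential_density q)" and q: "0 < q"
    and ind: "indep_of_process M e X" and x: "x < a"
    and pos: "0 \<le> k1" "0 \<le> k2" "0 \<le> l1" "0 \<le> l2"
    and eq: "c1 + c2 = d1 + d2" "c1 * k1 + c2 * k2 = - d1 * l1 - d2 * l2"
  shows "expectation (\<lambda>\<omega>. glue a
      (\<lambda>y. c1 * (q - \<mu>1 * k1 - \<sigma>1\<^sup>2 * k1\<^sup>2 / 2) * exp (k1 * (y - a)) + c2 * (q - \<mu>1 * k2 - \<sigma>1\<^sup>2 * k2\<^sup>2 / 2) * exp (k2 * (y - a)))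
      (\<lambda>y. d1 * (q + \<mu>2 * l1 - \<sigma>2\<^sup>2 * l1\<^sup>2 / 2) * exp (- l1 * (y - a)) + d2 * (q + \<mu>2 * l2 - \<sigma>2\<^sup>2 * l2\<^sup>2 / 2) * exp (- l2 * (y - a)))
      (X (e \<omega>) \<omega>)) = q * (c1 * exp (k1 * (x - a)) + c2 * exp (k2 * (x - a)))"
    (is "expectation (\<lambda>\<omega>. glue a ?\<phi> ?\<theta> (X (e \<omega>) \<omega>)) = _")
proof -
  let ?b = "\<lambda>y. \<mu>1 * indicator {..a} y + \<mu>2 * indicator {a<..} y"
  let ?s = "\<lambda>y. \<sigma>1 * indicator {..a} y + \<sigma>2 * indicator {a<..} y"
  define K where "K = \<bar>\<mu>1\<bar> + \<bar>\<mu>2\<bar> + \<bar>\<sigma>1\<bar> + \<bar>\<sigma>2\<bar>"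
  define f0 f1 f2 g0 g1 g2 where
    "f0 y = c1 * exp (k1 * (y - a)) + c2 * exp (k2 * (y - a))" and
    "f1 y = c1 * k1 * exp (k1 * (y - a)) + c2 * k2 * exp (k2 * (y - a))" and
    "f2 y = c1 * k1\<^sup>2 * exp (k1 * (y - a)) + c2 * k2\<^sup>2 * exp (k2 * (y - a))" and
    "g0 y = d1 * exp (- l1 * (y - a)) + d2 * exp (- l2 * (y - a))" and
    "g1 y = - d1 * l1 * exp (- l1 * (y - a)) - d2 * l2 * exp (- l2 * (y - a))" and
    "g2 y = d1 * l1\<^sup>2 * exp (- l1 * (y - a)) + d2 * l2\<^sup>2 * exp (- l2 * (y - a))" for y
  define C where "C = \<bar>c1\<bar> * (1 + k1 + k1\<^sup>2) + \<bar>c2\<bar> * (1 + k2 + k2\<^sup>2) + \<bar>d1\<bar> * (1 + l1 + l1\<^sup>2) + \<bar>d2\<bar> * (1 + l2 + l2\<^sup>2)"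
  have f: "(f0 has_real_derivative f1 y) (at y)" "(f1 has_real_derivative f2 y) (at y)" for y
    unfolding f0_def[abs_def] f1_def[abs_def] f2_def
    by (auto intro!: derivative_eq_intros simp: power2_eq_square algebra_simps)
  have g: "(g0 has_real_derivative g1 y) (at y)" "(g1 has_real_derivative g2 y) (at y)" for y
    unfolding g0_def[abs_def] g1_def[abs_def] g2_def
    by (auto intro!: derivative_eq_intros simp: power2_eq_square algebra_simps)
  \<comment> \<open>One estimate serves the function and both derivatives: \<open>r\<close> is the
    factor produced by zero, one or two differentiations.\<close>
  have le: "\<bar>c * r * E\<bar> \<le> \<bar>c\<bar> * (1 + k + k\<^sup>2)"
    if "0 \<le> k" "r = 1 \<or> r = k \<or> r = k\<^sup>2" "0 \<le> E" "E \<le> 1" for c r k E :: real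
  proof -
    have r: "0 \<le> r" "r \<le> 1 + k + k\<^sup>2" using that by auto
    have "\<bar>c * r * E\<bar> = \<bar>c\<bar> * (r * E)" using r that by (simp add: abs_mult mult.assoc)
    also have "\<dots> \<le> \<bar>c\<bar> * (r * 1)" using r that by (intro mult_left_mono) auto
    also have "\<dots> \<le> \<bar>c\<bar> * (1 + k + k\<^sup>2)" using r by (intro mult_left_mono) auto
    finally show ?thesis .
  qed
  have nn: "0 \<le> \<bar>c\<bar> * (1 + k + k\<^sup>2)" if "0 \<le> k" for c k :: real using that by auto
  note nns = nn[OF pos(1), of c1] nn[OF pos(2), of c2] nn[OF pos(3), of d1] nn[OF pos(4), of d2]
  have f_le: "\<bar>f0 y\<bar> \<le> C" "\<bar>f1 y\<bar> \<le> C" "\<bar>f2 y\<bar> \<le> C" if "y \<le> a" for y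
  proof -
    have E: "0 \<le> exp (k1 * (y - a))" "exp (k1 * (y - a)) \<le> 1" "0 \<le> exp (k2 * (y - a))" "exp (k2 * (y - a)) \<le> 1"
      using that pos by (auto simp: mult_nonneg_nonpos)
    show "\<bar>f0 y\<bar> \<le> C" "\<bar>f1 y\<bar> \<le> C" "\<bar>f2 y\<bar> \<le> C"
      using le[OF pos(1) _ E(1,2), of 1 c1] le[OF pos(2) _ E(3,4), of 1 c2] le[OF pos(1) _ E(1,2), of k1 c1]
        le[OF pos(2) _ E(3,4), of k2 c2] le[OF pos(1) _ E(1,2), of "k1\<^sup>2" c1] le[OF pos(2) _ E(3,4), of "k2\<^sup>2" c2] nns
      unfolding f0_def f1_def f2_def C_def by (auto simp: abs_le_iff)
  qed
  have g_le: "\<bar>g0 y\<bar> \<le> C" "\<bar>g1 y\<bar> \<le> C" "\<bar>g2 y\<bar> \<le> C" if "a \<le> y" for y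
  proof -
    have E: "0 \<le> exp (- l1 * (y - a))" "exp (- l1 * (y - a)) \<le> 1" "0 \<le> exp (- l2 * (y - a))" "exp (- l2 * (y - a)) \<le> 1"
      using that pos by (auto simp: mult_nonpos_nonneg)
    show "\<bar>g0 y\<bar> \<le> C" "\<bar>g1 y\<bar> \<le> C" "\<bar>g2 y\<bar> \<le> C"
      using le[OF pos(3) _ E(1,2), of 1 d1] le[OF pos(4) _ E(3,4), of 1 d2] le[OF pos(3) _ E(1,2), of l1 d1]
        le[OF pos(4) _ E(3,4), of l2 d2] le[OF pos(3) _ E(1,2), of "l1\<^sup>2" d1] le[OF pos(4) _ E(3,4), of "l2\<^sup>2" d2] nns
      unfolding g0_def g1_def g2_def C_def by (auto simp: abs_le_iff)
  qed
  have eq': "f0 a = g0 a" "f1 a = g1 a" using eq by (simp_all add: f0_def g0_def f1_def g1_def)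
  have generator: "expectation (\<lambda>\<omega>. q * glue a f0 g0 (X (e \<omega>) \<omega>) - (?b (X (e \<omega>) \<omega>) * glue a f1 g1 (X (e \<omega>) \<omega>)
      + (?s (X (e \<omega>) \<omega>))\<^sup>2 / 2 * glue a f2 g2 (X (e \<omega>) \<omega>))) = q * glue a f0 g0 x"
  proof (rule resolvent_identity[OF bm ss _ _ _ _ e q ind])
    show "\<bar>?b y\<bar> \<le> K" "\<bar>?s y\<bar> \<le> K" for y by (auto simp: K_def indicator_def)
    show "(glue a f0 g0 has_real_derivative glue a f1 g1 y) (at y)" for y
      by (rule glue_derivative[OF f(1) g(1) eq'])
    show "\<bar>glue a f0 g0 y\<bar> \<le> C" "\<bar>glue a f1 g1 y\<bar> \<le> C" for y
      using f_le g_le by (auto simp: glue_def)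
    show "\<bar>glue a f1 g1 y - glue a f1 g1 z\<bar> \<le> C * \<bar>y - z\<bar>" for y z
      by (rule glue_lipschitz[OF f(2) f_le(3) g(2) g_le(3) eq'(2)])
    show "(glue a f1 g1 has_real_derivative glue a f2 g2 y) (at_left y)" for y
      by (rule glue_left_derivative[OF f(2) g(2)])
  qed measurable
  \<comment> \<open>The coefficients and \<open>glue\<close> take the same side at \<open>a\<close>,
    so the identity holds at every point.\<close>
  have expand: "(\<lambda>y. q * glue a f0 g0 y - (?b y * glue a f1 g1 y + (?s y)\<^sup>2 / 2 * glue a f2 g2 y)) = glue a ?\<phi> ?\<theta>"
    unfolding glue_def f0_def f1_def f2_def g0_def g1_def g2_def by (intro ext) (simp add: field_simps)
  with generator show ?thesis
    using x by (simp only: fun_cong[OF expand]) (simp add: glue_def f0_def)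
qed

section \<open>Laplace transforms and densities\<close>

text \<open>Up to the factor \<open>k\<close>, the integrand is the exponential density reflected
  and shifted to end at \<open>u\<close>, which has total mass 1.\<close>

lemma has_bochner_integral_exp_atMost:
  fixes k u :: real
  assumes k: "0 < k"
  shows "has_bochner_integral lborel (\<lambda>z. indicator {..u} z * exp (k * (z - u))) (1 / k)"
proof -
  interpret prob_space "density lborel (exponential_density k)" by (rule prob_space_exponential_density[OF k])
  have "(\<integral>\<^sup>+z. ennreal (exponential_density k z) \<partial>lborel) = ennreal 1"
    using emeasure_space_1 by (simp add: emeasure_density)
  then have "has_bochner_integral lborel (exponential_density k) 1"
    using k by (intro has_bochner_integral_nn_integral) (auto simp: exponential_density_def)
  then have "has_bochner_integral lborel (\<lambda>z. exponential_density k (u + (-1) * z)) (1 /\<^sub>R \<bar>-1\<bar>)"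
    by (subst (asm) lborel_has_bochner_integral_real_affine_iff[of "-1" _ _ u]) auto
  then have "has_bochner_integral lborel (\<lambda>z. exponential_density k (u - z)) 1" by simp
  then have "has_bochner_integral lborel (\<lambda>z. exponential_density k (u - z) / k) (1 / k)"
    by (rule has_bochner_integral_divide_zero)
  moreover have "(\<lambda>z. exponential_density k (u - z) / k) = (\<lambda>z. indicator {..u} z * exp (k * (z - u)))"
    using k by (auto simp: fun_eq_iff exponential_density_def indicator_def algebra_simps)
  ultimately show ?thesis by simp
qed

lemma has_bochner_integral_exp_greaterThan:
  fixes k u :: real
  assumes k: "0 < k"
  shows "has_bochner_integral lborel (\<lambda>z. indicator {u<..} z * exp (- k * (z - u))) (1 / k)"
proof -
  have "has_bochner_integral lborel (\<lambda>z. indicator {..- u} (0 + (-1) * z) * exp (k * ((0 + (-1) * z) - - u))) ((1 / k) /\<^sub>R \<bar>-1\<bar>)"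
    using has_bochner_integral_exp_atMost[OF k, of "- u"]
    by (subst (asm) lborel_has_bochner_integral_real_affine_iff[of "-1" _ _ 0]) auto
  moreover have "(\<lambda>z. indicator {..- u} (0 + (-1) * z) * exp (k * ((0 + (-1) * z) - - u)))
      = (\<lambda>z. indicator {u..} z * exp (- k * (z - u)))"
    by (auto simp: fun_eq_iff indicator_def algebra_simps)
  ultimately have "has_bochner_integral lborel (\<lambda>z. indicator {u..} z * exp (- k * (z - u))) (1 / k)" by simp
  moreover have "AE z in lborel. indicator {u..} z * exp (- k * (z - u)) = indicator {u<..} z * exp (- k * (z - u))"
    using AE_lborel_singleton[of u] by eventually_elim (auto simp: indicator_def)
  ultimately show ?thesis
    by (subst (asm) has_bochner_integral_cong_AE[of _ _ "\<lambda>z. indicator {u<..} z * exp (- k * (z - u))"]) auto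
qed

text \<open>The exponent may have either sign: it will be a Laplace exponent minus the root
  \<open>delta_minus q \<mu>1 \<sigma>1\<close>.\<close>

lemma has_bochner_integral_exp_greaterThanAtMost:
  fixes k u v :: real
  assumes k: "k \<noteq> 0" and "u \<le> v"
  shows "has_bochner_integral lborel (\<lambda>z. indicator {u<..v} z * exp (k * (z - v))) ((1 - exp (k * (u - v))) / k)"
proof -
  have "has_bochner_integral lborel (\<lambda>z. exp (k * (z - v)) * indicator {u..v} z) (exp (k * (v - v)) / k - exp (k * (u - v)) / k)"
    using k by (intro has_bochner_integral_FTC_Icc_real assms(2)) (auto intro!: derivative_eq_intros continuous_intros)
  moreover have "AE z in lborel. exp (k * (z - v)) * indicator {u..v} z = indicator {u<..v} z * exp (k * (z - v))"
    using AE_lborel_singleton[of u] by eventually_elim (auto simp: indicator_def)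
  ultimately show ?thesis
    by (subst (asm) has_bochner_integral_cong_AE[of _ _ "\<lambda>z. indicator {u<..v} z * exp (k * (z - v))"])
      (auto simp: diff_divide_distrib)
qed

text \<open>The law restricted to \<open>T\<close> and the measure with density \<open>f\<close> on
  \<open>T\<close> have the same exponential moments. \<open>T\<close> is a half-line, as the
  uniqueness argument requires, while \<open>S\<close> is the part of it on which a particular
  formula \<open>h\<close> is claimed; one transform can thus serve several pieces.\<close>

lemma (in prob_space) has_density_on_if_laplace_eq:
  assumes Y[measurable]: "Y \<in> borel_measurable M"
    and T[measurable]: "T \<in> sets borel" and T_le: "\<And>y. y \<in> T \<Longrightarrow> c * (y - a) \<le> 0" and c: "c \<noteq> 0"
    and f[measurable]: "f \<in> borel_measurable borel" and f_nonneg: "\<And>z. z \<in> T \<Longrightarrow> 0 \<le> f z"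
    and laplace: "\<And>n. has_bochner_integral lborel (\<lambda>z. indicator T z * f z * exp (real n * c * (z - a)))
        (expectation (\<lambda>\<omega>. indicator T (Y \<omega>) * exp (real n * c * (Y \<omega> - a))))"
    and S: "S \<in> sets borel" "S \<subseteq> T" and h: "\<And>z. z \<in> S \<Longrightarrow> h z = f z"
  shows "has_density_on M Y S h"
proof -
  let ?P = "density (distr M borel Y) (\<lambda>y. ennreal (indicator T y))"
  let ?Q = "density lborel (\<lambda>z. ennreal (indicator T z * f z))"
  have nonneg: "0 \<le> indicator T z * f z" for z using f_nonneg by (auto simp: indicator_def)
  have "?P = ?Q"
  proof (rule measure_eq_if_exponential_moments_eq[OF _ _ _ _ _ _ c])
    show "finite_measure ?P"
    proof (rule finite_measureI)
      have "emeasure ?P (space ?P) = (\<integral>\<^sup>+y. ennreal (indicator T y) \<partial>distr M borel Y)" by (simp add: emeasure_density)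
      also have "\<dots> = emeasure (distr M borel Y) T" by (simp add: ennreal_indicator)
      also have "\<dots> = emeasure M (Y -` T \<inter> space M)" by (simp add: emeasure_distr)
      finally show "emeasure ?P (space ?P) \<noteq> \<infinity>" by simp
    qed
    show "finite_measure ?Q"
    proof (rule finite_measureI)
      \<comment> \<open>The moment of order 0 is the total mass.\<close>
      have "integrable lborel (\<lambda>z. indicator T z * f z)"
        using laplace[of 0] by (simp add: has_bochner_integral_iff)
      then have "(\<integral>\<^sup>+z. ennreal (indicator T z * f z) \<partial>lborel) = ennreal (\<integral>z. indicator T z * f z \<partial>lborel)"
        using nonneg by (intro nn_integral_eq_integral) auto
      then show "emeasure ?Q (space ?Q) \<noteq> \<infinity>" by (simp add: emeasure_density)
    qed
    show "AE y in ?P. c * (y - a) \<le> 0" 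
      by (subst AE_density) (auto intro!: AE_I2 T_le simp: indicator_def split: if_splits)
    show "AE y in ?Q. c * (y - a) \<le> 0"
      by (subst AE_density) (auto intro!: AE_I2 T_le simp: indicator_def split: if_splits)
    fix n
    have "(\<integral>y. exp (real n * c * (y - a)) \<partial>?P) = (\<integral>y. indicator T y * exp (real n * c * (y - a)) \<partial>distr M borel Y)"
      by (subst integral_real_density) auto
    also have "\<dots> = expectation (\<lambda>\<omega>. indicator T (Y \<omega>) * exp (real n * c * (Y \<omega> - a)))"
      by (rule integral_distr) auto
    also have "\<dots> = (\<integral>y. exp (real n * c * (y - a)) \<partial>?Q)"
      using laplace[of n] nonneg by (subst integral_real_density) (auto simp: has_bochner_integral_iff)
    finally show "(\<integral>y. exp (real n * c * (y - a)) \<partial>?P) = (\<integral>y. exp (real n * c * (y - a)) \<partial>?Q)" .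
  qed simp_all
  then have PQ: "emeasure ?P A = emeasure ?Q A" for A by simp
  have h_meas: "h \<in> borel_measurable (restrict_space borel S)"
    using measurable_restrict_space1[OF f, of S] h by (subst measurable_cong[of _ h f]) (auto simp: space_restrict_space)
  have h_meas': "h \<in> borel_measurable (restrict_space lborel S)"
    using h_meas by (simp cong: measurable_cong_sets sets_restrict_space_cong)
  show ?thesis
    unfolding has_density_on_def
  proof (intro conjI ballI Y h_meas)
    show "0 \<le> h z" if "z \<in> S" for z using that S(2) h f_nonneg by auto
    show "restrict_space (distr M borel Y) S = density (restrict_space lborel S) (\<lambda>z. ennreal (h z))"
    proof (rule measure_eqI)
      show "sets (restrict_space (distr M borel Y) S) = sets (density (restrict_space lborel S) (\<lambda>z. ennreal (h z)))"
        by (simp cong: sets_restrict_space_cong)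
      fix A assume "A \<in> sets (restrict_space (distr M borel Y) S)"
      then have A[measurable]: "A \<in> sets borel" "A \<subseteq> S" and A': "A \<in> sets (restrict_space lborel S)"
        using S by (auto simp: sets_restrict_space_iff)
      have "emeasure (restrict_space (distr M borel Y) S) A = emeasure (distr M borel Y) A"
        using S A by (intro emeasure_restrict_space) auto
      also have "\<dots> = emeasure ?P A"
      proof -
        have "emeasure ?P A = (\<integral>\<^sup>+y. indicator T y * indicator A y \<partial>distr M borel Y)"
          by (simp add: emeasure_density ennreal_indicator)
        also have "\<dots> = (\<integral>\<^sup>+y. indicator A y \<partial>distr M borel Y)"
          using A(2) S(2) by (intro nn_integral_cong) (auto simp: indicator_def)
        finally show ?thesis by simp
      qed
      also have "\<dots> = (\<integral>\<^sup>+z. ennreal (indicator T z * f z) * indicator A z \<partial>lborel)"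
        unfolding PQ by (subst emeasure_density) auto
      also have "\<dots> = (\<integral>\<^sup>+z. (ennreal (h z) * indicator A z) * indicator S z \<partial>lborel)"
        using A(2) S(2) h by (intro nn_integral_cong) (auto simp: indicator_def)
      also have "\<dots> = (\<integral>\<^sup>+z. ennreal (h z) * indicator A z \<partial>restrict_space lborel S)"
        using S by (subst nn_integral_restrict_space) auto
      also have "\<dots> = emeasure (density (restrict_space lborel S) (\<lambda>z. ennreal (h z))) A"
        using h_meas' A' by (subst emeasure_density) auto
      finally show "emeasure (restrict_space (distr M borel Y) S) A = emeasure (density (restrict_space lborel S) (\<lambda>z. ennreal (h z))) A" .
    qed
  qed
qed

section \<open>Algebra of the characteristic roots\<close>

text \<open>\<open>delta_minus\<close> and the negative of \<open>delta_plus\<close> are the roots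
  of q - \<mu> k - \<sigma>^2 k^2 / 2 in k, and the last two claims are the factorizations of this
  quadratic and of its reflection under k to -k. They rest on the product and the difference of the
  two constants.\<close>

lemma delta_facts:
  assumes q: "0 < q" and \<sigma>: "0 < \<sigma>"
  shows "0 < delta_plus q \<mu> \<sigma>" "0 < delta_minus q \<mu> \<sigma>" "0 < sqrt (2 * q * \<sigma>\<^sup>2 + \<mu>\<^sup>2)"
    and "sqrt (2 * q * \<sigma>\<^sup>2 + \<mu>\<^sup>2) = \<sigma>\<^sup>2 * (delta_plus q \<mu> \<sigma> + delta_minus q \<mu> \<sigma>) / 2"
    and "q - \<mu> * k - \<sigma>\<^sup>2 * k\<^sup>2 / 2 = \<sigma>\<^sup>2 / 2 * (delta_minus q \<mu> \<sigma> - k) * (k + delta_plus q \<mu> \<sigma>)"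
    and "q + \<mu> * k - \<sigma>\<^sup>2 * k\<^sup>2 / 2 = \<sigma>\<^sup>2 / 2 * (delta_plus q \<mu> \<sigma> - k) * (k + delta_minus q \<mu> \<sigma>)"
proof -
  define D where "D = sqrt (2 * q * \<sigma>\<^sup>2 + \<mu>\<^sup>2)"
  have qs: "0 < 2 * q * \<sigma>\<^sup>2" using q \<sigma> by simp
  have D2: "D\<^sup>2 = 2 * q * \<sigma>\<^sup>2 + \<mu>\<^sup>2" using qs by (simp add: D_def)
  have "\<bar>\<mu>\<bar> < D" unfolding D_def using qs by (intro real_less_rsqrt) simp
  then have D: "0 < D" "0 < D + \<mu>" "0 < D - \<mu>" by auto
  have d: "delta_plus q \<mu> \<sigma> = (D + \<mu>) / \<sigma>\<^sup>2" "delta_minus q \<mu> \<sigma> = (D - \<mu>) / \<sigma>\<^sup>2"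
    by (simp_all add: delta_plus_def delta_minus_def D_def)
  have s: "\<sigma>\<^sup>2 \<noteq> 0" "0 < \<sigma>\<^sup>2" using \<sigma> by auto
  show "0 < delta_plus q \<mu> \<sigma>" "0 < delta_minus q \<mu> \<sigma>" "0 < sqrt (2 * q * \<sigma>\<^sup>2 + \<mu>\<^sup>2)"
    using D s unfolding d D_def by auto
  show "sqrt (2 * q * \<sigma>\<^sup>2 + \<mu>\<^sup>2) = \<sigma>\<^sup>2 * (delta_plus q \<mu> \<sigma> + delta_minus q \<mu> \<sigma>) / 2"
    using s unfolding d D_def[symmetric] by (simp add: field_simps)
  have prod: "delta_minus q \<mu> \<sigma> * delta_plus q \<mu> \<sigma> * \<sigma>\<^sup>2 = 2 * q"
  proof -
    have "(D - \<mu>) * (D + \<mu>) = 2 * q * \<sigma>\<^sup>2" using D2 by (simp add: power2_eq_square algebra_simps)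
    then have "(D - \<mu>) * (D + \<mu>) / \<sigma>\<^sup>2 = 2 * q" using s by simp
    then show ?thesis unfolding d using s by (simp add: field_simps)
  qed
  have diff: "(delta_plus q \<mu> \<sigma> - delta_minus q \<mu> \<sigma>) * \<sigma>\<^sup>2 = 2 * \<mu>"
    unfolding d using s by (simp add: field_simps)
  show "q - \<mu> * k - \<sigma>\<^sup>2 * k\<^sup>2 / 2 = \<sigma>\<^sup>2 / 2 * (delta_minus q \<mu> \<sigma> - k) * (k + delta_plus q \<mu> \<sigma>)"
  proof -
    have "\<sigma>\<^sup>2 / 2 * (delta_minus q \<mu> \<sigma> - k) * (k + delta_plus q \<mu> \<sigma>) =
      (delta_minus q \<mu> \<sigma> * delta_plus q \<mu> \<sigma> * \<sigma>\<^sup>2) / 2 - k * ((delta_plus q \<mu> \<sigma> - delta_minus q \<mu> \<sigma>) * \<sigma>\<^sup>2) / 2 - \<sigma>\<^sup>2 * k\<^sup>2 / 2"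
      by (simp add: power2_eq_square field_simps)
    then show ?thesis unfolding prod diff by simp
  qed
  show "q + \<mu> * k - \<sigma>\<^sup>2 * k\<^sup>2 / 2 = \<sigma>\<^sup>2 / 2 * (delta_plus q \<mu> \<sigma> - k) * (k + delta_minus q \<mu> \<sigma>)"
  proof -
    have "\<sigma>\<^sup>2 / 2 * (delta_plus q \<mu> \<sigma> - k) * (k + delta_minus q \<mu> \<sigma>) =
      (delta_minus q \<mu> \<sigma> * delta_plus q \<mu> \<sigma> * \<sigma>\<^sup>2) / 2 + k * ((delta_plus q \<mu> \<sigma> - delta_minus q \<mu> \<sigma>) * \<sigma>\<^sup>2) / 2 - \<sigma>\<^sup>2 * k\<^sup>2 / 2"
      by (simp add: power2_eq_square field_simps)
    then show ?thesis unfolding prod diff by simp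
  qed
qed

text \<open>Partial fractions: on the left the transform of the claimed density, piece by piece, on
  the right the value from the resolvent equation. Here \<open>v\<close> is \<sigma>1^2,
  \<open>p\<close> and \<open>m\<close> are the two constants below \<open>a\<close>,
  \<open>r\<close> is \<open>delta_plus\<close> above it, and \<open>E1\<close>, \<open>E2\<close>
  are the exponentials with exponents \<open>k\<close> and \<open>m\<close> at the starting
  point.\<close>

lemma left_laplace_algebra:
  fixes q D v p m r k E1 E2 :: real
  assumes "0 < v" "0 < p" "0 < m" "0 < r" "0 \<le> k" "k \<noteq> m" and D: "D = v * (p + m) / 2"
  shows "q / D * (E1 / (p + k) + (E2 - E1) / (k - m) + (p - r) / (m + r) * E2 / (p + k)) =
    q * (E1 - (k + r) / (m + r) * E2) / (v / 2 * (m - k) * (k + p))"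
proof -
  have nz: "p + k \<noteq> 0" "k - m \<noteq> 0" "m - k \<noteq> 0" "m + r \<noteq> 0" "k + p \<noteq> 0" "p + m \<noteq> 0" "v \<noteq> 0"
    using assms by auto
  have "E1 / (p + k) + (E2 - E1) / (k - m) + (p - r) / (m + r) * E2 / (p + k) =
    (p + m) * (E1 - (k + r) / (m + r) * E2) / ((m - k) * (k + p))"
    using nz by (simp add: divide_simps) (simp add: algebra_simps)
  then show ?thesis unfolding D using nz by (simp add: divide_simps)
qed


text \<open>The square root \<open>D\<close> is half of \<open>v\<close> times the sum of the
  constants above \<open>a\<close>, so \<open>(m + p) / D\<close> collapses to \<open>2 / v\<close>.
  Here \<open>r\<close> is \<open>delta_minus\<close> below \<open>a\<close>.\<close>

lemma right_laplace_algebra: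
  fixes q D v p m r k E :: real
  assumes "0 < v" "0 < p" "0 < m" "0 < r" "0 \<le> k" and D: "D = v * (p + m) / 2"
  shows "q / D * ((m + p) / (r + p)) * E * (1 / (m + k)) = q * E / (r + p) / (v / 2 * (k + m))"
proof -
  have nz: "m + p \<noteq> 0" "p + m \<noteq> 0" "r + p \<noteq> 0" "m + k \<noteq> 0" "k + m \<noteq> 0" "v \<noteq> 0" using assms by auto
  then have D': "(m + p) / D = 2 / v" unfolding D by (simp add: divide_simps)
  have "q / D * ((m + p) / (r + p)) * E * (1 / (m + k)) = q * ((m + p) / D) * E / ((r + p) * (m + k))" by simp
  also have "\<dots> = q * (2 / v) * E / ((r + p) * (m + k))" by (simp only: D')
  also have "\<dots> = q * E / (r + p) / (v / 2 * (k + m))" by (simp add: mult_ac add.commute)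
  finally show ?thesis .
qed

lemma combine_exponentials:
  fixes q D P R K c d E :: real
  shows "q / D * (P * R * K) + q / D * (c / d) * (P * E * K) = q * P / D * (R + c * E / d) * K"
  by (simp add: algebra_simps)

lemma sum_exponential_integrals:
  fixes q D E1 E2 P F G K w :: real
  assumes "E2 * (1 - F) = G"
  shows "q / D * E1 * (1 / P) + q / D * E2 * ((1 - F) / K) + q / D * w * E2 * (1 / P) = q / D * (E1 / P + G / K + w * E2 / P)"
proof -
  have 1: "q / D * E1 * (1 / P) = q / D * (E1 / P)" by simp
  have 2: "q / D * E2 * ((1 - F) / K) = q / D * (G / K)" unfolding assms[symmetric] by simp
  have 3: "q / D * w * E2 * (1 / P) = q / D * (w * E2 / P)" by simp
  show ?thesis unfolding 1 2 3 by (simp only: distrib_left)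
qed

text \<open>Keeps the Laplace exponents away from the root \<open>d\<close>, where the resolvent
  equation degenerates to 0 = 0.\<close>

lemma even_multiple_neq: "real n * (2 * d) \<noteq> d" if "0 < d"
proof -
  have "2 * n \<noteq> 1" by presburger
  then have "real (2 * n) \<noteq> real 1" by (simp only: of_nat_eq_iff not_False_eq_True)
  then show ?thesis using that by auto
qed

text \<open>The coefficient of \<open>B\<close> may be negative, but it equals (p + m)/(m + r) - 1
  and so exceeds -1, and \<open>B \<le> A\<close>.\<close>

lemma nonneg_combination:
  fixes A B m p r :: real
  assumes "0 < m" "0 < p" "0 < r" "0 \<le> B" "B \<le> A"
  shows "0 \<le> A + (p - r) * B / (m + r)"
proof -
  have "A + (p - r) * B / (m + r) = (A - B) + (p + m) * B / (m + r)"
    using assms by (simp add: field_simps)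
  moreover have "0 \<le> (p + m) * B / (m + r)" using assms by simp
  ultimately show ?thesis using assms by linarith
qed

section \<open>The law at the exponential time on either side of \<open>a\<close>\<close>

context usual_filtered_prob_space
begin

context
  fixes B X :: "real \<Rightarrow> 'a \<Rightarrow> real" and e :: "'a \<Rightarrow> real"
    and a \<mu>1 \<mu>2 \<sigma>1 \<sigma>2 q x :: real
  assumes \<sigma>: "0 < \<sigma>1" "0 < \<sigma>2" and q: "0 < q"
    and bm: "brownian_motion M F B"
    and ss: "strong_solution M F B
           (\<lambda>y. \<mu>1 * indicator {..a} y + \<mu>2 * indicator {a<..} y)
           (\<lambda>y. \<sigma>1 * indicator {..a} y + \<sigma>2 * indicator {a<..} y) x X"
    and e: "distributed M lborel e (exponential_density q)"
    and ind: "indep_of_process M e X"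
    and x: "x < a"
begin

abbreviation (input) "p1 \<equiv> delta_plus q \<mu>1 \<sigma>1"
abbreviation (input) "m1 \<equiv> delta_minus q \<mu>1 \<sigma>1"
abbreviation (input) "p2 \<equiv> delta_plus q \<mu>2 \<sigma>2"
abbreviation (input) "m2 \<equiv> delta_minus q \<mu>2 \<sigma>2"

lemma measurable_X_e: "(\<lambda>\<omega>. X (e \<omega>) \<omega>) \<in> borel_measurable M"
proof (rule resolvent_identity_smooth(1)[OF bm ss _ _ _ _ e q ind])
  let ?K = "\<bar>\<mu>1\<bar> + \<bar>\<mu>2\<bar> + \<bar>\<sigma>1\<bar> + \<bar>\<sigma>2\<bar>"
  show "\<bar>\<mu>1 * indicator {..a} y + \<mu>2 * indicator {a<..} y\<bar> \<le> ?K"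
    "\<bar>\<sigma>1 * indicator {..a} y + \<sigma>2 * indicator {a<..} y\<bar> \<le> ?K" for y
    by (auto simp: indicator_def)
qed measurable

lemma delta_pos: "0 < p1" "0 < m1" "0 < p2" "0 < m2"
  using delta_facts(1,2)[OF q \<sigma>(1)] delta_facts(1,2)[OF q \<sigma>(2)] by auto

text \<open>Below \<open>a\<close> the test function is the exponential with exponent
  \<open>k\<close> plus \<open>w\<close> times the one with the root \<open>m1\<close>; above it is
  a multiple of the decaying solution with exponent \<open>- p2\<close>. Both auxiliary terms are
  annihilated by q - L, so only the exponent \<open>k\<close> survives, with factor
  \<open>P\<close>.\<close>

lemma laplace_left:
  assumes k: "0 \<le> k" "k \<noteq> m1"
  shows "expectation (\<lambda>\<omega>. indicator {..a} (X (e \<omega>) \<omega>) * exp (k * (X (e \<omega>) \<omega> - a))) =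
    q * (exp (k * (x - a)) - (k + p2) / (m1 + p2) * exp (m1 * (x - a))) / (\<sigma>1\<^sup>2 / 2 * (m1 - k) * (k + p1))"
  (is "?E = _")
proof -
  \<comment> \<open>Solves \<open>k + w * m1 = - (1 + w) * p2\<close>, the matching of slopes at
    \<open>a\<close>; the matching of values has already fixed the multiple \<open>1 + w\<close>
    above \<open>a\<close>.\<close>
  define w where "w = - ((k + p2) / (m1 + p2))"
  define P where "P = \<sigma>1\<^sup>2 / 2 * (m1 - k) * (k + p1)"
  have nz: "m1 + p2 \<noteq> 0" "P \<noteq> 0" using delta_pos k \<sigma> by (auto simp: P_def)
  let ?G = "glue a
      (\<lambda>y. 1 * (q - \<mu>1 * k - \<sigma>1\<^sup>2 * k\<^sup>2 / 2) * exp (k * (y - a)) + w * (q - \<mu>1 * m1 - \<sigma>1\<^sup>2 * m1\<^sup>2 / 2) * exp (m1 * (y - a)))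
      (\<lambda>y. (1 + w) * (q + \<mu>2 * p2 - \<sigma>2\<^sup>2 * p2\<^sup>2 / 2) * exp (- p2 * (y - a)) + 0 * (q + \<mu>2 * 0 - \<sigma>2\<^sup>2 * 0\<^sup>2 / 2) * exp (- 0 * (y - a)))"
  have G: "?G y = P * (indicator {..a} y * exp (k * (y - a)))" for y
    unfolding glue_def delta_facts(5)[OF q \<sigma>(1)] delta_facts(6)[OF q \<sigma>(2)] by (auto simp: P_def indicator_def)
  have "expectation (\<lambda>\<omega>. ?G (X (e \<omega>) \<omega>)) = q * (1 * exp (k * (x - a)) + w * exp (m1 * (x - a)))"
  proof (rule resolvent_exponential[OF bm ss e q ind x])
    show "1 * k + w * m1 = - (1 + w) * p2 - 0 * 0" using nz(1) by (simp add: w_def field_simps)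
  qed (use k delta_pos in auto)
  then have "P * ?E =
    q * (exp (k * (x - a)) - (k + p2) / (m1 + p2) * exp (m1 * (x - a)))"
    unfolding G by (simp add: w_def)
  then show ?thesis using nz unfolding P_def[symmetric] by (simp add: eq_divide_eq mult.commute)
qed

text \<open>The mirror image, with the exponent \<open>- k\<close> prescribed above
  \<open>a\<close>. The starting point lies below \<open>a\<close>, where the test function is a
  multiple of the exponential with root \<open>m1\<close>; its multiple contains the factor
  \<open>p2 - k\<close>, which cancels against \<open>P\<close> and leaves a single pole at
  \<open>- m2\<close>.\<close>

lemma laplace_right:
  assumes k: "0 \<le> k" "k \<noteq> p2"
  shows "expectation (\<lambda>\<omega>. indicator {a<..} (X (e \<omega>) \<omega>) * exp (- k * (X (e \<omega>) \<omega> - a))) =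
    q * exp (m1 * (x - a)) / (m1 + p2) / (\<sigma>2\<^sup>2 / 2 * (k + m2))"
  (is "?E = _")
proof -
  \<comment> \<open>Solves the slope condition \<open>(1 + w) * m1 = - k - w * p2\<close> at
    \<open>a\<close>.\<close>
  define w where "w = - ((k + m1) / (m1 + p2))"
  define P where "P = \<sigma>2\<^sup>2 / 2 * (p2 - k) * (k + m2)"
  have nz: "m1 + p2 \<noteq> 0" "P \<noteq> 0" "p2 - k \<noteq> 0" using delta_pos k \<sigma> by (auto simp: P_def)
  have w: "1 + w = (p2 - k) / (m1 + p2)" using nz(1) by (simp add: w_def field_simps)
  let ?G = "glue a
      (\<lambda>y. (1 + w) * (q - \<mu>1 * m1 - \<sigma>1\<^sup>2 * m1\<^sup>2 / 2) * exp (m1 * (y - a)) + 0 * (q - \<mu>1 * 0 - \<sigma>1\<^sup>2 * 0\<^sup>2 / 2) * exp (0 * (y - a)))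
      (\<lambda>y. 1 * (q + \<mu>2 * k - \<sigma>2\<^sup>2 * k\<^sup>2 / 2) * exp (- k * (y - a)) + w * (q + \<mu>2 * p2 - \<sigma>2\<^sup>2 * p2\<^sup>2 / 2) * exp (- p2 * (y - a)))"
  have G: "?G y = P * (indicator {a<..} y * exp (- k * (y - a)))" for y
    unfolding glue_def delta_facts(5)[OF q \<sigma>(1)] delta_facts(6)[OF q \<sigma>(2)] by (auto simp: P_def indicator_def)
  have "expectation (\<lambda>\<omega>. ?G (X (e \<omega>) \<omega>)) = q * ((1 + w) * exp (m1 * (x - a)) + 0 * exp (0 * (x - a)))"
  proof (rule resolvent_exponential[OF bm ss e q ind x])
    show "(1 + w) * m1 + 0 * 0 = - 1 * k - w * p2" using nz(1) by (simp add: w_def field_simps)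
  qed (use k delta_pos in auto)
  then have "P * ?E =
    q * ((p2 - k) / (m1 + p2) * exp (m1 * (x - a)))"
    unfolding G by (simp add: w)
  then have "?E =
    q * ((p2 - k) / (m1 + p2) * exp (m1 * (x - a))) / P"
    unfolding nonzero_eq_divide_eq[OF nz(2)] by (subst mult.commute)
  then show ?thesis using nz by (simp add: P_def)
qed

text \<open>The transform is known only for the whole half-line below \<open>a\<close>, so both
  formulas are combined into one function and separated again through \<open>S\<close>.\<close>

lemma density_left:
  assumes "S \<in> sets borel" "S \<subseteq> {..a}"
    and h: "\<And>z. z \<in> S \<Longrightarrow> h z =
      (if z \<le> x then q * exp (p1 * (z - a)) / sqrt (2 * q * \<sigma>1\<^sup>2 + \<mu>1\<^sup>2) *
            (exp (- p1 * (x - a)) + (p1 - p2) * exp (m1 * (x - a)) / (m1 + p2))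
       else q * exp (m1 * (x - a)) / sqrt (2 * q * \<sigma>1\<^sup>2 + \<mu>1\<^sup>2) *
            (exp (- m1 * (z - a)) + (p1 - p2) * exp (p1 * (z - a)) / (m1 + p2)))"
      (is "\<And>z. _ \<Longrightarrow> _ = ?f z")
  shows "has_density_on M (\<lambda>\<omega>. X (e \<omega>) \<omega>) S h"
proof (rule has_density_on_if_laplace_eq[OF measurable_X_e _ _ _ _ _ _ assms])
  define D w where "D = sqrt (2 * q * \<sigma>1\<^sup>2 + \<mu>1\<^sup>2)" and "w = (p1 - p2) / (m1 + p2)"
  have D: "0 < D" "D = \<sigma>1\<^sup>2 * (p1 + m1) / 2"
    unfolding D_def by (rule delta_facts(3,4)[OF q \<sigma>(1)])+
  \<comment> \<open>The spacing is twice the root: with spacing \<open>m1\<close> the exponent for n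
    = 1 would be the excluded value \<open>m1\<close>.\<close>
  show "2 * m1 \<noteq> 0" using delta_pos by simp
  show "2 * m1 * (y - a) \<le> 0" if "y \<in> {..a}" for y
    using that delta_pos by (intro mult_nonneg_nonpos) auto
  show "?f \<in> borel_measurable borel" by measurable
  show "0 \<le> ?f z" if z: "z \<in> {..a}" for z
  proof -
    have le1: "exp (m1 * (x - a)) \<le> exp (- p1 * (x - a))"
    proof (subst exp_le_cancel_iff)
      have "m1 * (x - a) \<le> 0" "0 \<le> - p1 * (x - a)"
        using x delta_pos by (auto simp: mult_nonneg_nonpos)
      then show "m1 * (x - a) \<le> - p1 * (x - a)" by linarith
    qed
    have le2: "exp (p1 * (z - a)) \<le> exp (- m1 * (z - a))"
    proof (subst exp_le_cancel_iff)
      have "p1 * (z - a) \<le> 0" "0 \<le> - m1 * (z - a)"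
        using z delta_pos by (auto simp: mult_nonneg_nonpos)
      then show "p1 * (z - a) \<le> - m1 * (z - a)" by linarith
    qed
    have n1: "0 \<le> exp (- p1 * (x - a)) + (p1 - p2) * exp (m1 * (x - a)) / (m1 + p2)"
      using delta_pos le1 by (intro nonneg_combination) auto
    have n2: "0 \<le> exp (- m1 * (z - a)) + (p1 - p2) * exp (p1 * (z - a)) / (m1 + p2)"
      using delta_pos le2 by (intro nonneg_combination) auto
    show ?thesis unfolding D_def[symmetric]
      using mult_nonneg_nonneg[OF _ n1] mult_nonneg_nonneg[OF _ n2] q D(1) by auto
  qed
  fix n
  define k where "k = real n * (2 * m1)"
  have k: "0 \<le> k" "k \<noteq> m1"
    unfolding k_def using delta_pos even_multiple_neq by auto
  let ?E1 = "exp (k * (x - a))" and ?E2 = "exp (m1 * (x - a))"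
  let ?I = "q / D * ?E1 * (1 / (p1 + k)) + q / D * ?E2 * ((1 - exp ((k - m1) * (x - a))) / (k - m1)) + q / D * w * ?E2 * (1 / (p1 + k))"
  \<comment> \<open>The first two terms are the resolvent density of the process with constant
    coefficients \<open>\<mu>1\<close>, \<open>\<sigma>1\<close>, split at the starting point
    \<open>x\<close>. The third, weighted by \<open>w\<close>, is the correction due to the change
    of coefficients; it vanishes if \<open>p1 = p2\<close>.\<close>
  let ?F = "\<lambda>z. q / D * ?E1 * (indicator {..x} z * exp ((p1 + k) * (z - x)))
      + q / D * ?E2 * (indicator {x<..a} z * exp ((k - m1) * (z - a)))
      + q / D * w * ?E2 * (indicator {..a} z * exp ((p1 + k) * (z - a)))"
  have "has_bochner_integral lborel ?F
    ?I"
    using x k delta_pos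
    by (intro has_bochner_integral_add has_bochner_integral_mult_right has_bochner_integral_exp_atMost
        has_bochner_integral_exp_greaterThanAtMost) auto
  moreover have "?F = (\<lambda>z. indicator {..a} z * ?f z * exp (real n * (2 * m1) * (z - a)))"
  proof
    fix z
    have e1: "?E1 * exp ((p1 + k) * (z - x)) = exp (p1 * (z - a)) * exp (- p1 * (x - a)) * exp (k * (z - a))"
      and e2: "?E2 * exp ((k - m1) * (z - a)) = ?E2 * exp (- m1 * (z - a)) * exp (k * (z - a))"
      and e3: "?E2 * exp ((p1 + k) * (z - a)) = exp (p1 * (z - a)) * ?E2 * exp (k * (z - a))"
      by (simp_all add: exp_add[symmetric] algebra_simps)
    consider "z \<le> x" | "x < z" "z \<le> a" | "a < z" by linarith
    then show "?F z
      = indicator {..a} z * ?f z * exp (real n * (2 * m1) * (z - a))"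
    proof cases
      case 1
      have "q / D * ?E1 * exp ((p1 + k) * (z - x)) + q / D * w * ?E2 * exp ((p1 + k) * (z - a))
        = q / D * (?E1 * exp ((p1 + k) * (z - x))) + q / D * w * (?E2 * exp ((p1 + k) * (z - a)))"
        by (simp only: mult.assoc)
      also have "\<dots> = ?f z * exp (k * (z - a))"
        unfolding e1 e3 w_def combine_exponentials using 1 by (simp add: D_def)
      finally show ?thesis using 1 x by (simp add: k_def)
    next
      case 2
      have "q / D * ?E2 * exp ((k - m1) * (z - a)) + q / D * w * ?E2 * exp ((p1 + k) * (z - a))
        = q / D * (?E2 * exp ((k - m1) * (z - a))) + q / D * w * (?E2 * exp ((p1 + k) * (z - a)))"
        by (simp only: mult.assoc)
      also have "\<dots> = ?f z * exp (k * (z - a))"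
        unfolding e2 e3 mult.commute[of "exp (p1 * (z - a))" ?E2] w_def combine_exponentials using 2 by (simp add: D_def)
      finally show ?thesis using 2 by (simp add: k_def)
    next
      case 3
      then show ?thesis using x by simp
    qed
  qed
  moreover have "?I
    = expectation (\<lambda>\<omega>. indicator {..a} (X (e \<omega>) \<omega>) * exp (real n * (2 * m1) * (X (e \<omega>) \<omega> - a)))"
  proof -
    have "?E2 * (1 - exp ((k - m1) * (x - a))) = ?E2 - ?E1"
      by (simp add: right_diff_distrib exp_add[symmetric] algebra_simps)
    then have "?I
      = q / D * (?E1 / (p1 + k) + (?E2 - ?E1) / (k - m1) + (p1 - p2) / (m1 + p2) * ?E2 / (p1 + k))"
      unfolding w_def[symmetric] by (rule sum_exponential_integrals)
    also have "\<dots> = q * (?E1 - (k + p2) / (m1 + p2) * ?E2) / (\<sigma>1\<^sup>2 / 2 * (m1 - k) * (k + p1))"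
      using delta_pos k \<sigma> D(2) by (intro left_laplace_algebra) auto
    also have "\<dots> = expectation (\<lambda>\<omega>. indicator {..a} (X (e \<omega>) \<omega>) * exp (k * (X (e \<omega>) \<omega> - a)))"
      by (rule laplace_left[OF k, symmetric])
    finally show ?thesis by (simp add: k_def)
  qed
  ultimately show "has_bochner_integral lborel (\<lambda>z. indicator {..a} z * ?f z * exp (real n * (2 * m1) * (z - a)))
     (expectation (\<lambda>\<omega>. indicator {..a} (X (e \<omega>) \<omega>) * exp (real n * (2 * m1) * (X (e \<omega>) \<omega> - a))))"
    by (simp only:)
qed simp

text \<open>A transform with the single pole \<open>- m2\<close> belongs to a multiple of one
  exponential. The spacing is negative so that the half-line above \<open>a\<close> is carried into
  the unit interval, and it is twice \<open>p2\<close> to avoid the excluded exponent.\<close>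

lemma density_right:
  "has_density_on M (\<lambda>\<omega>. X (e \<omega>) \<omega>) {a<..}
     (\<lambda>z. q / sqrt (2 * q * \<sigma>2\<^sup>2 + \<mu>2\<^sup>2) * ((m2 + p2) / (m1 + p2)) * exp (m1 * (x - a)) * exp (- m2 * (z - a)))"
  (is "has_density_on _ _ _ ?f")
proof (rule has_density_on_if_laplace_eq[OF measurable_X_e, where T = "{a<..}" and c = "- (2 * p2)" and a = a])
  define D where "D = sqrt (2 * q * \<sigma>2\<^sup>2 + \<mu>2\<^sup>2)"
  define A where "A = q / D * ((m2 + p2) / (m1 + p2)) * exp (m1 * (x - a))"
  have D: "0 < D" "D = \<sigma>2\<^sup>2 * (p2 + m2) / 2"
    unfolding D_def by (rule delta_facts(3,4)[OF q \<sigma>(2)])+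
  show "- (2 * p2) \<noteq> 0" using delta_pos by simp
  show "- (2 * p2) * (y - a) \<le> 0" if "y \<in> {a<..}" for y
    using that delta_pos by (intro mult_nonpos_nonneg) auto
  show "0 \<le> ?f z" for z
    using delta_pos q D(1) unfolding D_def[symmetric] by simp
  fix n
  define k where "k = real n * (2 * p2)"
  have k: "0 \<le> k" "k \<noteq> p2"
    unfolding k_def using delta_pos even_multiple_neq by auto
  have kn: "real n * - (2 * p2) * y = - k * y" for y by (simp add: k_def)
  have "has_bochner_integral lborel (\<lambda>z. A * (indicator {a<..} z * exp (- (m2 + k) * (z - a)))) (A * (1 / (m2 + k)))"
    using k delta_pos by (intro has_bochner_integral_mult_right has_bochner_integral_exp_greaterThan) auto
  moreover have "(\<lambda>z. A * (indicator {a<..} z * exp (- (m2 + k) * (z - a)))) =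
    (\<lambda>z. indicator {a<..} z * (q / D * ((m2 + p2) / (m1 + p2)) * exp (m1 * (x - a)) * exp (- m2 * (z - a))) * exp (- k * (z - a)))"
  proof
    fix z
    have "exp (- (m2 + k) * (z - a)) = exp (- m2 * (z - a)) * exp (- k * (z - a))"
      by (simp add: exp_add[symmetric] algebra_simps)
    then show "A * (indicator {a<..} z * exp (- (m2 + k) * (z - a))) =
      indicator {a<..} z * (q / D * ((m2 + p2) / (m1 + p2)) * exp (m1 * (x - a)) * exp (- m2 * (z - a))) * exp (- k * (z - a))"
      unfolding A_def[symmetric] by simp
  qed
  moreover have "A * (1 / (m2 + k)) = expectation (\<lambda>\<omega>. indicator {a<..} (X (e \<omega>) \<omega>) * exp (- k * (X (e \<omega>) \<omega> - a)))"
  proof -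
    have "A * (1 / (m2 + k)) = q * exp (m1 * (x - a)) / (m1 + p2) / (\<sigma>2\<^sup>2 / 2 * (k + m2))"
      unfolding A_def using delta_pos k \<sigma> by (intro right_laplace_algebra D(2)) auto
    then show ?thesis using laplace_right[OF k] by simp
  qed
  ultimately show "has_bochner_integral lborel
     (\<lambda>z. indicator {a<..} z * ?f z
        * exp (real n * - (2 * p2) * (z - a)))
     (expectation (\<lambda>\<omega>. indicator {a<..} (X (e \<omega>) \<omega>) * exp (real n * - (2 * p2) * (X (e \<omega>) \<omega> - a))))"
    unfolding kn D_def[symmetric] by (simp only:)
qed auto

end

end

theorem corollary3p1:
  fixes M :: "'a measure" and F :: "real \<Rightarrow> 'a measure"
    and B X :: "real \<Rightarrow> 'a \<Rightarrow> real" and e :: "'a \<Rightarrow> real"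
    and a \<mu>1 \<mu>2 \<sigma>1 \<sigma>2 q x :: real
  defines "dp1 \<equiv> delta_plus q \<mu>1 \<sigma>1" and "dm1 \<equiv> delta_minus q \<mu>1 \<sigma>1"
    and "dp2 \<equiv> delta_plus q \<mu>2 \<sigma>2" and "dm2 \<equiv> delta_minus q \<mu>2 \<sigma>2"
  assumes "\<sigma>1 > 0" and "\<sigma>2 > 0" and "q > 0"
    and "usual_filtered_prob_space M F"
    and "brownian_motion M F B"
    and "strong_solution M F B
           (\<lambda>y. \<mu>1 * indicator {..a} y + \<mu>2 * indicator {a<..} y)
           (\<lambda>y. \<sigma>1 * indicator {..a} y + \<sigma>2 * indicator {a<..} y) x X"
    and "distributed M lborel e (exponential_density q)"
    and "indep_of_process M e X"
    and "x < a"
  shows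
    "has_density_on M (\<lambda>\<omega>. X (e \<omega>) \<omega>) {z. z \<le> x}
       (\<lambda>z. q * exp (dp1 * (z - a)) / sqrt (2 * q * \<sigma>1\<^sup>2 + \<mu>1\<^sup>2) *
            (exp (- dp1 * (x - a)) + (dp1 - dp2) * exp (dm1 * (x - a)) / (dm1 + dp2)))
     \<and> has_density_on M (\<lambda>\<omega>. X (e \<omega>) \<omega>) {z. x < z \<and> z \<le> a}
       (\<lambda>z. q * exp (dm1 * (x - a)) / sqrt (2 * q * \<sigma>1\<^sup>2 + \<mu>1\<^sup>2) *
            (exp (- dm1 * (z - a)) + (dp1 - dp2) * exp (dp1 * (z - a)) / (dm1 + dp2)))
     \<and> has_density_on M (\<lambda>\<omega>. X (e \<omega>) \<omega>) {z. a < z}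
       (\<lambda>z. q / sqrt (2 * q * \<sigma>2\<^sup>2 + \<mu>2\<^sup>2) * ((dm2 + dp2) / (dm1 + dp2)) *
            exp (dm1 * (x - a)) * exp (- dm2 * (z - a)))"
proof -
  interpret usual_filtered_prob_space M F by fact
  note rules = assms(5-7,9-13)
  have sets: "{z. z \<le> x} = {..x}" "{z. x < z \<and> z \<le> a} = {x<..a}" "{z. a < z} = {a<..}" by auto
  \<comment> \<open>Both lower formulas come from \<open>density_left\<close>; on each of these sets
    its case distinction at \<open>x\<close> is decided.\<close>
  have subsets: "{..x} \<subseteq> {..a}" "{x<..a} \<subseteq> {..a}" using \<open>x < a\<close> by auto
  show ?thesis
    unfolding dp1_def dm1_def dp2_def dm2_def sets
    by (intro conjI density_left[OF rules _ subsets(1)] density_left[OF rules _ subsets(2)] density_right[OF rules]) simp_all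
qed

end
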